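(* For any $\delta\in(0,1)$ there are $w_\delta,n_\delta>0$ depending only on $\delta$ with the following property. For any $\varepsilon\in(0,1)$, any integer $n\ge n_\delta$ and any integer $k$ with $2\le k\le \lceil w_\delta\log n/\log(2/\varepsilon)\rceil$, let $E$ be a uniformly distributed random $k$-dimensional subspace of $\mathbb{R}^n$. Then $$\mathbf{P}\big\{E\text{ is a }(1+\varepsilon)\text{-spherical subspace of }\ell^n_{(2-\delta)\log n}\big\}\ge 1-n^{-w_\delta},$$ and at the same time $$\mathbf{P}\big\{E\text{ is not a }\big(1+\tfrac{w_\delta}{\log n}\big)\text{-spherical subspace of }\ell^n_{(2+\delta)\log n}\big\}\ge w_\delta.$$
   Context: $\log$ is the natural logarithm. $\ell_p^n$ is $\mathbb{R}^n$ with the norm $\|x\|_p=(\sum_{i=1}^n|x_i|^p)^{1/p}$. Given a norm $\|\cdot\|$ on $\mathbb{R}^n$ and $K\ge1$, a linear subspace $E\subset\mathbb{R}^n$ is called $K$-spherical (in $(\mathbb{R}^n,\|\cdot\|)$) if $$\sup_{x\in E,\|x\|_2=1}\|x\|\Big/\inf_{x\in E,\|x\|_2=1}\|x\|\le K.$$ A uniformly distributed random $k$-dimensional subspace is one distributed according to the rotation-invariant probability measure on the Grassmannian of $k$-dimensional subspaces of $\mathbb{R}^n$. *)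

theory Defs
  imports "HOL-Probability.Probability" "HOL-Library.Function_Algebras"
begin

text \<open>
  The dimension \<open>n\<close> is quantified inside the statement, so \<open>\<real>\<^sup>n\<close> is rendered as the subspace of
  functions \<open>nat \<Rightarrow> real\<close> that vanish outside \<open>{..<n}\<close>. Functions form a real vector space with
  the pointwise addition of \<open>Function_Algebras\<close> and the following scaling.
\<close>

definition fscale :: "real \<Rightarrow> (nat \<Rightarrow> real) \<Rightarrow> nat \<Rightarrow> real" where
  "fscale c x = (\<lambda>i. c * x i)"

interpretation fvec: vector_space fscale
  by unfold_locales (auto simp: fscale_def fun_eq_iff algebra_simps)

definition Rn :: "nat \<Rightarrow> (nat \<Rightarrow> real) set" where
  "Rn n = {x. \<forall>i\<ge>n. x i = 0}"

definition inner_n :: "nat \<Rightarrow> (nat \<Rightarrow> real) \<Rightarrow> (nat \<Rightarrow> real) \<Rightarrow> real" where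
  "inner_n n x y = (\<Sum>i<n. x i * y i)"

definition lp_norm :: "nat \<Rightarrow> real \<Rightarrow> (nat \<Rightarrow> real) \<Rightarrow> real" where
  "lp_norm n p x = (\<Sum>i<n. \<bar>x i\<bar> powr p) powr (1 / p)"

definition spherical :: "nat \<Rightarrow> ((nat \<Rightarrow> real) \<Rightarrow> real) \<Rightarrow> real \<Rightarrow> (nat \<Rightarrow> real) set \<Rightarrow> bool" where
  "spherical n N K E \<longleftrightarrow>
     (SUP x\<in>{x \<in> E. lp_norm n 2 x = 1}. N x) / (INF x\<in>{x \<in> E. lp_norm n 2 x = 1}. N x) \<le> K"

definition Grassmannian :: "nat \<Rightarrow> nat \<Rightarrow> (nat \<Rightarrow> real) set set" where
  "Grassmannian n k = {E. fvec.subspace E \<and> E \<subseteq> Rn n \<and> fvec.dim E = k}"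

definition orth_proj :: "nat \<Rightarrow> (nat \<Rightarrow> real) set \<Rightarrow> (nat \<Rightarrow> real) \<Rightarrow> nat \<Rightarrow> real" where
  "orth_proj n E x = (THE y. y \<in> E \<and> (\<forall>z\<in>E. inner_n n (x - y) z = 0))"

definition proj_matrix :: "nat \<Rightarrow> (nat \<Rightarrow> real) set \<Rightarrow> nat \<Rightarrow> nat \<Rightarrow> real" where
  "proj_matrix n E = (\<lambda>i j. orth_proj n E (\<lambda>l. if l = j then 1 else 0) i)"

text \<open>
  The usual topology of the Grassmannian is the one induced by the injection sending a subspace
  to the matrix of its orthogonal projection, so the preimages of Borel sets of matrices form
  exactly its Borel \<open>\<sigma>\<close>-algebra. Matrix entries with an index \<open>\<ge> n\<close> are constantly \<open>0\<close>.
\<close>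

definition Gr_borel :: "nat \<Rightarrow> nat \<Rightarrow> (nat \<Rightarrow> real) set measure" where
  "Gr_borel n k = vimage_algebra (Grassmannian n k) (proj_matrix n) borel"

text \<open>
  Rotations are the elements of the orthogonal group of \<open>\<real>\<^sup>n\<close>; the values of \<open>g\<close> outside
  \<^term>\<open>Rn n\<close> are irrelevant.
\<close>

definition rotation :: "nat \<Rightarrow> ((nat \<Rightarrow> real) \<Rightarrow> nat \<Rightarrow> real) \<Rightarrow> bool" where
  "rotation n g \<longleftrightarrow> Vector_Spaces.linear fscale fscale g \<and> g ` Rn n \<subseteq> Rn n \<and>
     (\<forall>x\<in>Rn n. \<forall>y\<in>Rn n. inner_n n (g x) (g y) = inner_n n x y)"

text \<open>
  For \<open>k \<le> n\<close> exactly one measure on the Grassmannian has this property; for \<open>k > n\<close> the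
  Grassmannian is empty and there is none.
\<close>

definition uniform_Gr :: "nat \<Rightarrow> nat \<Rightarrow> (nat \<Rightarrow> real) set measure \<Rightarrow> bool" where
  "uniform_Gr n k \<mu> \<longleftrightarrow> prob_space \<mu> \<and> sets \<mu> = sets (Gr_borel n k) \<and>
     (\<forall>g. rotation n g \<longrightarrow> distr \<mu> (Gr_borel n k) (\<lambda>E. g ` E) = \<mu>)"

end

theory Submission
  imports Defs
begin

text \<open>
  Write \<open>L = ln n\<close>. The uniform subspace is replaced by the span of the columns of an \<open>n \<times> k\<close> matrix
  \<open>Y\<close> of independent standard normal entries, and both claims become statements about Gaussian
  vectors.

  Transfer to Gaussian matrices (\<open>uniform_Gr_transfer\<close>). The measure \<open>\<mu>\<close> is known only through its
  invariance. Call \<open>E\<close> and \<open>Y\<close> near each other if \<open>Y\<close> is well conditioned and every vector in the span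
  of its columns has relative distance at most \<open>t\<close> from \<open>E\<close>. Reflections act transitively on the
  Grassmannian and preserve both \<open>\<mu>\<close> and the law of \<open>Y\<close>. Hence the probability that \<open>Y\<close> is near \<open>E\<close>
  does not depend on \<open>E\<close>, and the \<open>\<mu>\<close>-measure of the subspaces near \<open>Y\<close> does not depend on the well
  conditioned matrix \<open>Y\<close>. Integrating the indicator of nearness in both orders bounds \<open>\<mu> B\<close>,
  multiplied by the probability of being well conditioned, by the probability that \<open>Y\<close> misses an event
  that rules out nearness to a member of \<open>B\<close>. Since \<open>t\<close> may depend
  on \<open>n\<close>, the passage from \<open>E\<close> to \<open>Y\<close> costs nothing. The reflection invariance of the Gaussian law comes
  from the invariance of Lebesgue measure under shears (\<open>leb_householder\<close>).

  Exponents \<open>p \<le> (2 - \<delta>) L\<close>. The \<open>p\<close>-th power of the norm of a Gaussian vector is a sum of \<open>n\<close>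
  independent copies of \<open>X = \<bar>g\<bar>\<^sup>p\<close>. Its variance is useless when \<open>\<delta>\<close> is small, because \<open>X\<close> has heavy
  tails at the scale \<open>p \<approx> 2 L\<close>. A moment of order \<open>q = 1 + \<delta> / 4\<close> suffices: by
  \<open>weak_law_moment\<close> the relative deviation is governed by
  \<open>n\<^bsup>1-q\<^esup> E X\<^sup>q / (E X)\<^sup>q\<close>, which is about \<open>exp (L (1 - q + (1 - \<delta>/2) q ln q))\<close>, a negative power of
  \<open>n\<close> (\<open>moment_ratio_bound\<close>). The hypotheses on \<open>k\<close> and \<open>\<epsilon>\<close> say that a net of \<open>(C / \<epsilon>)\<^sup>k\<close> points in the
  sphere of \<open>\<real>\<^sup>k\<close> has only a small power of \<open>n\<close> many points (\<open>net_size_bound\<close>), so a union bound over the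
  net shows that \<open>Y\<close> is nearly a multiple of an isometry for the \<open>\<ell>\<^sub>2\<close> norm and for the \<open>\<ell>\<^sub>p\<close> norm
  (\<open>gaussian_matrix_near_isometry\<close>).

  Exponents \<open>p = (2 + \<delta>) L\<close>. Choose \<open>s\<close> so that a bounded number of coordinates of a Gaussian vector is
  expected above \<open>s\<close>; then \<open>s\<^sup>2 \<le> 2 L\<close>. Since \<open>x\<^sup>p exp (-x\<^sup>2/2)\<close> grows exponentially fast up to \<open>s\<close>, the
  coordinates below \<open>s\<close> contribute at most \<open>s\<^sup>p / \<delta>\<close> to the \<open>p\<close>-th power of the norm, and the
  norm of one column is at most \<open>s (1 + O (1/L))\<close> with probability at least \<open>1/4\<close>
  (\<open>gauss_lp_norm_small_probability\<close>). The largest coordinate of another column exceeds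
  \<open>s exp (K/L)\<close> with probability bounded below, because this shift changes the Gaussian tail
  only by a constant factor (\<open>gauss_large_maximum_probability\<close>). The columns are independent and
  their Euclidean norms concentrate, so they agree up to a factor closer to \<open>1\<close> than this gap, and the
  normalised norms of two vectors in the span differ by a factor at least \<open>1 + c/L\<close>.
\<close>

section \<open>Gaussian measure is invariant under reflections\<close>

definition preserves :: "'a measure \<Rightarrow> ('a \<Rightarrow> 'a) \<Rightarrow> bool" where
  "preserves M T \<longleftrightarrow> T \<in> M \<rightarrow>\<^sub>M M \<and> distr M M T = M"

lemma preserves_comp:
  assumes "preserves M S" "preserves M T"
  shows "preserves M (S \<circ> T)"
  using assms distr_distr[of S M M T M] unfolding preserves_def by (auto intro: measurable_comp)

lemma preserves_cong:
  assumes "preserves M S" "\<And>x. x \<in> space M \<Longrightarrow> S x = T x"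
  shows "preserves M T"
  using assms measurable_cong[of M S T M] distr_cong[of M M M M S T]
  unfolding preserves_def by auto

lemma preserves_nn_integral:
  assumes "preserves M T" "f \<in> borel_measurable M"
  shows "(\<integral>\<^sup>+x. f (T x) \<partial>M) = (\<integral>\<^sup>+x. f x \<partial>M)"
  using assms nn_integral_distr[of T M M f] unfolding preserves_def by auto

lemma preserves_emeasure:
  assumes "preserves M T" "A \<in> sets M"
  shows "emeasure M (T -` A \<inter> space M) = emeasure M A"
  using assms emeasure_distr[of T M M A] unfolding preserves_def by auto

lemma preservesI_nn_integral:
  assumes T: "T \<in> M \<rightarrow>\<^sub>M M"
    and *: "\<And>f. f \<in> borel_measurable M \<Longrightarrow> (\<integral>\<^sup>+x. f (T x) \<partial>M) = (\<integral>\<^sup>+x. f x \<partial>M)"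
  shows "preserves M T"
proof -
  have "emeasure (distr M M T) A = emeasure M A" if A: "A \<in> sets M" for A
  proof -
    have "emeasure (distr M M T) A = (\<integral>\<^sup>+x. indicator A x \<partial>distr M M T)"
      using A by simp
    also have "\<dots> = (\<integral>\<^sup>+x. indicator A (T x) \<partial>M)"
      using A by (intro nn_integral_distr T) auto
    also have "\<dots> = (\<integral>\<^sup>+x. indicator A x \<partial>M)" using A by (intro *) auto
    finally show ?thesis using A by simp
  qed
  then show ?thesis unfolding preserves_def using T by (auto intro!: measure_eqI)
qed

abbreviation leb :: "'i set \<Rightarrow> ('i \<Rightarrow> real) measure" where
  "leb I \<equiv> PiM I (\<lambda>_. lborel)"

lemma space_leb: "space (leb I) = extensional I"
  by (auto simp: space_PiM PiE_def)

text \<open>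
  For fixed other coordinates the map is a translation of one coordinate, possibly combined with a
  change of sign, so Fubini reduces the claim to one-dimensional Lebesgue measure.
\<close>

lemma leb_shear:
  fixes c :: "'i \<Rightarrow> real" and s :: real
  assumes I: "finite I" "i \<in> I" and s: "s = 1 \<or> s = - 1"
  shows "preserves (leb I) (\<lambda>x. x(i := s * x i + (\<Sum>j\<in>I - {i}. c j * x j)))"
    (is "preserves _ ?T")
proof (rule preservesI_nn_integral)
  interpret product_sigma_finite "\<lambda>_::'i. lborel :: real measure" ..
  let ?J = "I - {i}"
  have II: "I = insert i ?J" using I by auto
  have fin: "finite ?J" "i \<notin> ?J" using I by auto
  have m1: "(\<lambda>x. s * x i + (\<Sum>j\<in>?J. c j * x j)) \<in> borel_measurable (leb I)"
    using I(2) by measurable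
  show T: "?T \<in> leb I \<rightarrow>\<^sub>M leb I"
    using I(2) m1 by (intro measurable_fun_upd[where J = I]) auto
  fix f :: "_ \<Rightarrow> ennreal" assume f: "f \<in> borel_measurable (leb I)"
  have f': "f \<in> borel_measurable (leb (insert i ?J))"
    using f II by metis
  have "(\<lambda>x. f (?T x)) \<in> borel_measurable (leb I)"
    using measurable_comp[OF T f] by (simp add: comp_def)
  then have fT': "(\<lambda>x. f (?T x)) \<in> borel_measurable (leb (insert i ?J))"
    using II by metis
  have "(\<integral>\<^sup>+x. f (?T x) \<partial>leb I) = (\<integral>\<^sup>+x. (\<integral>\<^sup>+y. f (?T (x(i := y))) \<partial>lborel) \<partial>leb ?J)"
    using product_nn_integral_insert[OF fin fT'] II by metis
  also have "\<dots> = (\<integral>\<^sup>+x. (\<integral>\<^sup>+y. f (x(i := y)) \<partial>lborel) \<partial>leb ?J)"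
  proof (rule nn_integral_cong)
    fix x assume x: "x \<in> space (leb ?J)"
    let ?a = "\<Sum>j\<in>?J. c j * x j"
    have "(\<Sum>j\<in>?J. c j * (x(i := y)) j) = ?a" for y
      by (intro sum.cong) auto
    then have "(\<integral>\<^sup>+y. f (?T (x(i := y))) \<partial>lborel) = (\<integral>\<^sup>+y. f (x(i := ?a + s * y)) \<partial>lborel)"
      by (simp add: algebra_simps)
    also have "\<dots> = (\<integral>\<^sup>+y. f (x(i := y)) \<partial>lborel)"
    proof -
      have m: "(\<lambda>y. f (x(i := y))) \<in> borel_measurable borel"
      proof -
        have "(\<lambda>y. x(i := y)) \<in> lborel \<rightarrow>\<^sub>M leb (insert i ?J)"
          using x by (intro measurable_fun_upd[where J = ?J]) auto
        from measurable_comp[OF this f'] show ?thesis by (simp add: comp_def)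
      qed
      show ?thesis
        using nn_integral_real_affine[OF m, of s ?a] s by auto
    qed
    finally show "(\<integral>\<^sup>+y. f (?T (x(i := y))) \<partial>lborel) = (\<integral>\<^sup>+y. f (x(i := y)) \<partial>lborel)" .
  qed
  also have "\<dots> = (\<integral>\<^sup>+x. f x \<partial>leb I)"
    using product_nn_integral_insert[OF fin f'] II by metis
  finally show "(\<integral>\<^sup>+x. f (?T x) \<partial>leb I) = (\<integral>\<^sup>+x. f x \<partial>leb I)" .
qed

lemma leb_multi_shear:
  fixes c :: "'i \<Rightarrow> real"
  assumes I: "finite I" "i \<in> I" and J: "J \<subseteq> I - {i}"
  shows "preserves (leb I) (\<lambda>x l. if l \<in> J then x l + c l * x i else x l)"
proof -
  have "finite J" using I J finite_subset by blast
  then show ?thesis using J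
  proof (induction J rule: finite_induct)
    case empty
    then show ?case by (auto simp: preserves_def distr_id2)
  next
    case (insert j J)
    have j: "j \<in> I" "i \<in> I - {j}" using insert I by auto
    have "(\<Sum>l\<in>I - {j}. (if l = i then c j else 0) * x l) = c j * x i" for x :: "'i \<Rightarrow> real"
      using j I by (subst sum.remove[of _ i]) auto
    then have "preserves (leb I) (\<lambda>x. x(j := x j + c j * x i))"
      using leb_shear[OF I(1) j(1), of 1 "\<lambda>l. if l = i then c j else 0"] by simp
    from preserves_comp[OF this insert.IH] insert.prems
    have "preserves (leb I) ((\<lambda>x. x(j := x j + c j * x i)) \<circ> (\<lambda>x l. if l \<in> J then x l + c l * x i else x l))"
      by auto
    then show ?case
      by (rule preserves_cong) (use insert in \<open>auto simp: fun_eq_iff\<close>)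
  qed
qed

text \<open>
  Elements of a product space are undefined outside the index set, hence the restriction.
\<close>

definition householder :: "'i set \<Rightarrow> ('i \<Rightarrow> real) \<Rightarrow> ('i \<Rightarrow> real) \<Rightarrow> 'i \<Rightarrow> real" where
  "householder I w x = (\<lambda>i\<in>I. x i - 2 * w i * (\<Sum>l\<in>I. w l * x l))"

text \<open>
  Replace a coordinate \<open>x\<^sub>i\<close> with \<open>w\<^sub>i \<noteq> 0\<close> by \<open>\<langle>w, x\<rangle> / w\<^sub>i\<close>, which is a shear. In the new
  coordinates the reflection changes the sign of the \<open>i\<close>-th one and shears the others, so it is a
  composition of shears and determinants are avoided.
\<close>

lemma leb_householder:
  fixes w :: "'i \<Rightarrow> real"
  assumes I: "finite I" and w: "(\<Sum>i\<in>I. (w i)\<^sup>2) = 1"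
  shows "preserves (leb I) (householder I w)"
proof -
  obtain i where i: "i \<in> I" "w i \<noteq> 0"
  proof (rule ccontr)
    assume "\<not> thesis"
    then have "\<forall>i\<in>I. (w i)\<^sup>2 = 0" using that by auto
    then show False using w by simp
  qed
  let ?J = "I - {i}"
  define A where "A = (\<lambda>x. x(i := 1 * x i + (\<Sum>j\<in>?J. (w j / w i) * x j)))"
  define F where "F = (\<lambda>x::'i\<Rightarrow>real. x(i := (-1) * x i + (\<Sum>j\<in>?J. 0 * x j)))"
  define B where "B = (\<lambda>(x::'i\<Rightarrow>real) l. if l \<in> ?J then x l + (2 * w i * w l) * x i else x l)"
  \<comment> \<open>\<open>C\<close> undoes the change of coordinates \<open>A\<close>\<close>
  define C where "C = (\<lambda>x. x(i := 1 * x i + (\<Sum>j\<in>?J. (- w j / w i) * x j)))"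
  have "preserves (leb I) A" "preserves (leb I) F" "preserves (leb I) C"
    unfolding A_def F_def C_def
    using leb_shear[OF I i(1), of 1 "\<lambda>j. w j / w i"] leb_shear[OF I i(1), of "-1" "\<lambda>_. 0"]
      leb_shear[OF I i(1), of 1 "\<lambda>j. - w j / w i"] by simp_all
  moreover have "preserves (leb I) B" unfolding B_def
    using leb_multi_shear[OF I i(1), of ?J "\<lambda>l. 2 * w i * w l"] by simp
  ultimately have *: "preserves (leb I) (C \<circ> (B \<circ> (F \<circ> A)))"
    by (intro preserves_comp)
  have "(C \<circ> (B \<circ> (F \<circ> A))) x = householder I w x" if x: "x \<in> space (leb I)" for x
  proof -
    define d where "d = (\<Sum>l\<in>I. w l * x l)"
    define d' where "d' = (\<Sum>l\<in>?J. w l * x l)"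
    have d: "d = w i * x i + d'" unfolding d_def d'_def using I i by (simp add: sum.remove)
    have w2: "(\<Sum>l\<in>?J. (w l)\<^sup>2) = 1 - (w i)\<^sup>2" using I i w by (simp add: sum.remove)
    have sA: "(\<Sum>j\<in>?J. w j / w i * x j) = d' / w i"
      unfolding d'_def by (simp add: sum_divide_distrib[symmetric])
    have Ai: "A x i = d / w i" using i(2) by (simp add: A_def sA[simplified] d add_divide_distrib)
    have Aj: "A x j = x j" if "j \<noteq> i" for j using that by (simp add: A_def)
    have Fi: "F (A x) i = - d / w i" using Ai by (simp add: F_def)
    have Fj: "F (A x) j = x j" if "j \<noteq> i" for j using that Aj by (simp add: F_def)
    have Bi: "B (F (A x)) i = - d / w i" using Fi by (simp add: B_def)
    have Bj: "B (F (A x)) j = x j - 2 * w j * d" if "j \<in> ?J" for j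
      using that Fi Fj[of j] i(2) by (auto simp add: B_def)
    have "(\<Sum>j\<in>?J. (- w j / w i) * B (F (A x)) j)
        = (\<Sum>j\<in>?J. (- 1 / w i) * (w j * x j) + (2 * d / w i) * (w j)\<^sup>2)"
      using i(2) by (intro sum.cong refl) (simp add: Bj field_simps power2_eq_square)
    also have "\<dots> = (- 1 / w i) * d' + (2 * d / w i) * (1 - (w i)\<^sup>2)"
      unfolding d'_def w2[symmetric] sum.distrib sum_distrib_left ..
    finally have s: "(\<Sum>j\<in>?J. (- w j / w i) * B (F (A x)) j)
        = (- 1 / w i) * d' + (2 * d / w i) * (1 - (w i)\<^sup>2)" .
    have Ci: "C (B (F (A x))) i = x i - 2 * w i * d"
    proof -
      have "C (B (F (A x))) i = B (F (A x)) i + (\<Sum>j\<in>?J. (- w j / w i) * B (F (A x)) j)"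
        by (simp only: C_def fun_upd_same mult_1)
      moreover have "- d / w i + ((- 1 / w i) * (d - w i * x i) + (2 * d / w i) * (1 - (w i)\<^sup>2))
          = x i - 2 * w i * d"
        using i(2) by (simp add: field_simps power2_eq_square)
      moreover have "d' = d - w i * x i" using d by simp
      ultimately show ?thesis unfolding s Bi by simp
    qed
    have Cj: "C (B (F (A x))) j = x j - 2 * w j * d" if "j \<in> ?J" for j
      using that Bj[OF that] by (simp add: C_def)
    have Co: "C (B (F (A x))) j = undefined" if "j \<notin> I" for j
      using that i x Fj[of j] by (auto simp: C_def B_def space_leb extensional_def)
    show "(C \<circ> (B \<circ> (F \<circ> A))) x = householder I w x"
      using Ci Cj Co by (auto simp: fun_eq_iff householder_def d_def[symmetric])
  qed
  with * show ?thesis by (rule preserves_cong)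
qed

definition gauss :: "'i set \<Rightarrow> ('i \<Rightarrow> real) measure" where
  "gauss I = PiM I (\<lambda>_. density lborel (\<lambda>x. ennreal (std_normal_density x)))"

lemma sets_gauss [measurable_cong]: "sets (gauss I) = sets (PiM I (\<lambda>_. borel))"
  unfolding gauss_def by (intro sets_PiM_cong) auto

lemma space_gauss [simp]: "space (gauss I) = extensional I"
  unfolding gauss_def by (auto simp: space_PiM PiE_def)

lemma prob_space_gauss: "prob_space (gauss I)"
  unfolding gauss_def
  by (intro prob_space_PiM prob_space_normal_density) auto

lemma gauss_density:
  assumes I: "finite I"
  shows "gauss I = density (leb I) (\<lambda>x. ennreal (\<Prod>i\<in>I. std_normal_density (x i)))"
proof -
  interpret N: prob_space "density lborel (\<lambda>x. ennreal (std_normal_density x))"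
    by (rule prob_space_normal_density) simp
  interpret N: product_sigma_finite "\<lambda>_. density lborel (\<lambda>x. ennreal (std_normal_density x))" ..
  interpret L: product_sigma_finite "\<lambda>_. lborel :: real measure" ..
  show ?thesis unfolding gauss_def
  proof (rule sym, rule N.PiM_eqI)
    show "sets (density (leb I) (\<lambda>x. ennreal (\<Prod>i\<in>I. std_normal_density (x i))))
      = sets (PiM I (\<lambda>_. density lborel (\<lambda>x. ennreal (std_normal_density x))))"
      by (simp, intro sets_PiM_cong) auto
    fix A :: "'a \<Rightarrow> real set"
    assume A: "\<And>i. i \<in> I \<Longrightarrow> A i \<in> sets (density lborel (\<lambda>x. ennreal (std_normal_density x)))"
    have A': "Pi\<^sub>E I A \<in> sets (leb I)" using A I by (intro sets_PiM_I_finite) auto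
    have "emeasure (density (leb I) (\<lambda>x. ennreal (\<Prod>i\<in>I. std_normal_density (x i)))) (Pi\<^sub>E I A)
      = (\<integral>\<^sup>+x. ennreal (\<Prod>i\<in>I. std_normal_density (x i)) * indicator (Pi\<^sub>E I A) x \<partial>leb I)"
      using A' by (subst emeasure_density) auto
    also have "\<dots> = (\<integral>\<^sup>+x. (\<Prod>i\<in>I. ennreal (std_normal_density (x i)) * indicator (A i) (x i)) \<partial>leb I)"
    proof (intro nn_integral_cong)
      fix x assume x: "x \<in> space (leb I)"
      have "(indicator (Pi\<^sub>E I A) x :: ennreal) = (\<Prod>i\<in>I. indicator (A i) (x i))"
        using x I by (auto simp: indicator_def space_leb PiE_def Pi_def)
      then show "ennreal (\<Prod>i\<in>I. std_normal_density (x i)) * indicator (Pi\<^sub>E I A) x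
        = (\<Prod>i\<in>I. ennreal (std_normal_density (x i)) * indicator (A i) (x i))"
        by (simp add: prod.distrib prod_ennreal)
    qed
    also have "\<dots> = (\<Prod>i\<in>I. (\<integral>\<^sup>+y. ennreal (std_normal_density y) * indicator (A i) y \<partial>lborel))"
      using A I by (intro L.product_nn_integral_prod) auto
    also have "\<dots> = (\<Prod>i\<in>I. emeasure (density lborel (\<lambda>x. ennreal (std_normal_density x))) (A i))"
      using A by (intro prod.cong refl) (subst emeasure_density, auto)
    finally show "emeasure (density (leb I) (\<lambda>x. ennreal (\<Prod>i\<in>I. std_normal_density (x i)))) (Pi\<^sub>E I A)
      = (\<Prod>i\<in>I. emeasure (density lborel (\<lambda>x. ennreal (std_normal_density x))) (A i))" .
  qed (use I in simp)
qed

lemma householder_sum_squares: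
  assumes I: "finite I" and w: "(\<Sum>i\<in>I. (w i)\<^sup>2) = 1"
  shows "(\<Sum>i\<in>I. (householder I w x i)\<^sup>2) = (\<Sum>i\<in>I. (x i)\<^sup>2)"
proof -
  define d where "d = (\<Sum>l\<in>I. w l * x l)"
  have "(\<Sum>i\<in>I. (householder I w x i)\<^sup>2) = (\<Sum>i\<in>I. (x i)\<^sup>2 - 4 * d * (w i * x i) + 4 * d\<^sup>2 * (w i)\<^sup>2)"
    by (intro sum.cong refl) (simp add: householder_def d_def[symmetric] power2_eq_square algebra_simps)
  also have "\<dots> = (\<Sum>i\<in>I. (x i)\<^sup>2) - 4 * d * d + 4 * d\<^sup>2 * 1"
    unfolding w[symmetric] sum.distrib sum_subtractf
    by (simp only: sum_distrib_left[symmetric] d_def)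
  finally show ?thesis by (simp add: power2_eq_square)
qed

lemma gauss_householder_unit:
  assumes I: "finite I" and w: "(\<Sum>i\<in>I. (w i)\<^sup>2) = 1"
  shows "preserves (gauss I) (householder I w)"
proof (rule preservesI_nn_integral)
  let ?D = "\<lambda>x. ennreal (\<Prod>i\<in>I. std_normal_density (x i))"
  have s: "sets (gauss I) = sets (leb I)" by (simp add: gauss_density[OF I])
  have L: "preserves (leb I) (householder I w)" by (rule leb_householder[OF I w])
  then show "householder I w \<in> gauss I \<rightarrow>\<^sub>M gauss I"
    unfolding preserves_def using measurable_cong_sets[OF s s] by auto
  have D: "?D (householder I w x) = ?D x" for x
  proof -
    have e: "(\<Prod>i\<in>I. std_normal_density (y i))
      = (\<Prod>i\<in>I. 1 / sqrt (2 * pi)) * exp (- (\<Sum>i\<in>I. (y i)\<^sup>2) / 2)" for y :: "'a \<Rightarrow> real"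
    proof -
      have "exp (- (\<Sum>i\<in>I. (y i)\<^sup>2) / 2) = (\<Prod>i\<in>I. exp (- (y i)\<^sup>2 / 2))"
        using I by (simp add: exp_sum[symmetric] sum_negf sum_divide_distrib)
      then show ?thesis by (simp only: std_normal_density_def prod.distrib)
    qed
    show ?thesis unfolding e householder_sum_squares[OF I w] ..
  qed
  fix f :: "_ \<Rightarrow> ennreal" assume "f \<in> borel_measurable (gauss I)"
  then have f: "f \<in> borel_measurable (leb I)" using measurable_cong_sets[OF s refl] by auto
  have Dm: "?D \<in> borel_measurable (leb I)" by measurable
  have fH: "(\<lambda>x. f (householder I w x)) \<in> borel_measurable (leb I)"
    using measurable_comp[OF _ f] L unfolding preserves_def comp_def by auto
  have "(\<integral>\<^sup>+x. f (householder I w x) \<partial>gauss I)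
      = (\<integral>\<^sup>+x. ?D (householder I w x) * f (householder I w x) \<partial>leb I)"
    unfolding gauss_density[OF I] D by (rule nn_integral_density[OF Dm fH])
  also have "\<dots> = (\<integral>\<^sup>+x. ?D x * f x \<partial>leb I)"
    using Dm f by (intro preserves_nn_integral[OF L, of "\<lambda>x. ?D x * f x"] borel_measurable_times_ennreal)
  also have "\<dots> = (\<integral>\<^sup>+x. f x \<partial>gauss I)"
    unfolding gauss_density[OF I] by (rule nn_integral_density[OF Dm f, symmetric])
  finally show "(\<integral>\<^sup>+x. f (householder I w x) \<partial>gauss I) = (\<integral>\<^sup>+x. f x \<partial>gauss I)" .
qed

lemma gauss_householder:
  assumes I: "finite I" and w: "(\<Sum>i\<in>I. (w i)\<^sup>2) \<in> {0, 1}"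
  shows "preserves (gauss I) (householder I w)"
proof (cases "(\<Sum>i\<in>I. (w i)\<^sup>2) = 1")
  case True
  then show ?thesis by (rule gauss_householder_unit[OF I])
next
  case False
  then have "(\<Sum>i\<in>I. (w i)\<^sup>2) = 0" using w by auto
  then have "\<forall>i\<in>I. w i = 0" using I by (simp add: sum_nonneg_eq_0_iff)
  moreover have "preserves (gauss I) (\<lambda>x. x)" by (auto simp: preserves_def distr_id2)
  ultimately show ?thesis
    by (elim preserves_cong) (auto simp: householder_def fun_eq_iff extensional_def)
qed

text \<open>
  Commuting reflections compose to the displayed map. On a matrix space, vectors \<open>w\<^sub>\<kappa>\<close> supported on
  the single rows or on the single columns turn it into multiplication by one reflection from the right
  or from the left. The zero vector is admitted as a name for the identity.
\<close>

lemma gauss_orthogonal_householders: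
  fixes w :: "'k \<Rightarrow> 'i \<Rightarrow> real"
  assumes I: "finite I" and K: "finite K"
    and w: "\<And>\<kappa>. \<kappa> \<in> K \<Longrightarrow> (\<Sum>i\<in>I. (w \<kappa> i)\<^sup>2) \<in> {0, 1}"
    and orth: "\<And>\<kappa> \<kappa>'. \<kappa> \<in> K \<Longrightarrow> \<kappa>' \<in> K \<Longrightarrow> \<kappa> \<noteq> \<kappa>' \<Longrightarrow> (\<Sum>i\<in>I. w \<kappa> i * w \<kappa>' i) = 0"
  shows "preserves (gauss I) (\<lambda>x. \<lambda>i\<in>I. x i - (\<Sum>\<kappa>\<in>K. 2 * w \<kappa> i * (\<Sum>l\<in>I. w \<kappa> l * x l)))"
  using K w orth
proof (induction K rule: finite_induct)
  case empty
  have "preserves (gauss I) (\<lambda>x. x)" by (auto simp: preserves_def distr_id2)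
  then show ?case by (rule preserves_cong) (auto simp: extensional_restrict)
next
  case (insert \<kappa> K)
  let ?T = "\<lambda>x. \<lambda>i\<in>I. x i - (\<Sum>\<kappa>\<in>K. 2 * w \<kappa> i * (\<Sum>l\<in>I. w \<kappa> l * x l))"
  have "preserves (gauss I) ?T" using insert by (intro insert.IH) auto
  moreover have "preserves (gauss I) (householder I (w \<kappa>))"
    using insert by (intro gauss_householder I) auto
  ultimately have "preserves (gauss I) (householder I (w \<kappa>) \<circ> ?T)" by (intro preserves_comp)
  then show ?case
  proof (rule preserves_cong)
    fix x :: "'i \<Rightarrow> real"
    have "(\<Sum>l\<in>I. w \<kappa> l * ?T x l)
      = (\<Sum>l\<in>I. w \<kappa> l * x l) - (\<Sum>l\<in>I. \<Sum>\<kappa>'\<in>K. 2 * (\<Sum>l\<in>I. w \<kappa>' l * x l) * (w \<kappa> l * w \<kappa>' l))"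
      by (simp add: sum_subtractf[symmetric] right_diff_distrib sum_distrib_left mult_ac cong: sum.cong)
    also have "(\<Sum>l\<in>I. \<Sum>\<kappa>'\<in>K. 2 * (\<Sum>l\<in>I. w \<kappa>' l * x l) * (w \<kappa> l * w \<kappa>' l))
      = (\<Sum>\<kappa>'\<in>K. 2 * (\<Sum>l\<in>I. w \<kappa>' l * x l) * (\<Sum>l\<in>I. w \<kappa> l * w \<kappa>' l))"
      by (subst sum.swap) (simp add: sum_distrib_left mult.assoc)
    also have "\<dots> = 0" using insert by (intro sum.neutral ballI) auto
    finally have "(\<Sum>l\<in>I. w \<kappa> l * ?T x l) = (\<Sum>l\<in>I. w \<kappa> l * x l)" by simp
    then show "(householder I (w \<kappa>) \<circ> ?T) x
      = (\<lambda>i\<in>I. x i - (\<Sum>\<kappa>\<in>insert \<kappa> K. 2 * w \<kappa> i * (\<Sum>l\<in>I. w \<kappa> l * x l)))"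
      using insert(1,2) by (auto simp: householder_def fun_eq_iff)
  qed
qed

section \<open>A weak law of large numbers under a moment of order above one\<close>

lemma integral_PiM_coordinate:
  fixes f :: "'a \<Rightarrow> real"
  assumes D: "prob_space D" and i: "i \<in> I" and f: "f \<in> borel_measurable D"
  shows "(\<integral>x. f (x i) \<partial>PiM I (\<lambda>_. D)) = (\<integral>y. f y \<partial>D)"
    and "integrable D f \<Longrightarrow> integrable (PiM I (\<lambda>_. D)) (\<lambda>x. f (x i))"
proof -
  have d: "distr (PiM I (\<lambda>_. D)) D (\<lambda>x. x i) = D"
    using distr_PiM_component[of I "\<lambda>_. D" i] D i by auto
  have m: "(\<lambda>x. x i) \<in> PiM I (\<lambda>_. D) \<rightarrow>\<^sub>M D" using i by auto
  show "(\<integral>x. f (x i) \<partial>PiM I (\<lambda>_. D)) = (\<integral>y. f y \<partial>D)"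
    using integral_distr[OF m f] d by simp
  show "integrable D f \<Longrightarrow> integrable (PiM I (\<lambda>_. D)) (\<lambda>x. f (x i))"
    using integrable_distr[OF m, of f] d by simp
qed

lemma integral_PiM_two_coordinates:
  fixes f :: "'a \<Rightarrow> real"
  assumes D: "prob_space D" and I: "finite I" "i \<in> I" "j \<in> I" "i \<noteq> j" and f: "integrable D f"
  shows "(\<integral>x. f (x i) * f (x j) \<partial>PiM I (\<lambda>_. D)) = (\<integral>y. f y \<partial>D)\<^sup>2"
    and "integrable (PiM I (\<lambda>_. D)) (\<lambda>x. f (x i) * f (x j))"
proof -
  interpret D: prob_space D by fact
  interpret product_sigma_finite "\<lambda>_. D" ..
  let ?F = "\<lambda>l y. if l = i \<or> l = j then f y else 1"
  have F: "integrable D (?F l)" for l using f by (cases "l = i \<or> l = j") auto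
  have e: "(\<Prod>l\<in>I. ?F l (x l)) = f (x i) * f (x j)" for x
  proof -
    have "(\<Prod>l\<in>I. ?F l (x l)) = (\<Prod>l\<in>{i, j}. ?F l (x l))"
      using I by (intro prod.mono_neutral_right) auto
    then show ?thesis using I by simp
  qed
  have e2: "(\<Prod>l\<in>I. integral\<^sup>L D (?F l)) = (\<integral>y. f y \<partial>D)\<^sup>2"
  proof -
    have "(\<Prod>l\<in>I. integral\<^sup>L D (?F l)) = (\<Prod>l\<in>{i, j}. integral\<^sup>L D (?F l))"
      using I by (intro prod.mono_neutral_right) (auto simp: D.prob_space)
    then show ?thesis using I by (simp add: power2_eq_square)
  qed
  show "(\<integral>x. f (x i) * f (x j) \<partial>PiM I (\<lambda>_. D)) = (\<integral>y. f y \<partial>D)\<^sup>2"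
    using product_integral_prod[OF I(1), of ?F, OF F] unfolding e e2 .
  show "integrable (PiM I (\<lambda>_. D)) (\<lambda>x. f (x i) * f (x j))"
    using product_integrable_prod[OF I(1), of ?F, OF F] unfolding e .
qed

lemma iid_sum_second_moment:
  fixes W :: "'a \<Rightarrow> real"
  assumes D: "prob_space D" and I: "finite I"
    and W: "integrable D W" "integrable D (\<lambda>y. (W y)\<^sup>2)" "(\<integral>y. W y \<partial>D) = 0"
  shows "(\<integral>x. (\<Sum>i\<in>I. W (x i))\<^sup>2 \<partial>PiM I (\<lambda>_. D)) = card I * (\<integral>y. (W y)\<^sup>2 \<partial>D)"
    and "integrable (PiM I (\<lambda>_. D)) (\<lambda>x. (\<Sum>i\<in>I. W (x i))\<^sup>2)"
proof -
  let ?P = "PiM I (\<lambda>_. D)"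
  have e: "(\<Sum>i\<in>I. W (x i))\<^sup>2 = (\<Sum>i\<in>I. \<Sum>j\<in>I. W (x i) * W (x j))" for x
    by (simp add: power2_eq_square sum_product)
  have int: "integrable ?P (\<lambda>x. W (x i) * W (x j))"
    and val: "(\<integral>x. W (x i) * W (x j) \<partial>?P) = (if i = j then (\<integral>y. (W y)\<^sup>2 \<partial>D) else 0)"
    if "i \<in> I" "j \<in> I" for i j
    using integral_PiM_two_coordinates[OF D I that _ W(1)] W
      integral_PiM_coordinate[OF D that(1), of "\<lambda>y. (W y)\<^sup>2"]
    by (cases "i = j"; auto simp: power2_eq_square)+
  show "integrable ?P (\<lambda>x. (\<Sum>i\<in>I. W (x i))\<^sup>2)"
    unfolding e by (intro Bochner_Integration.integrable_sum int)
  have "(\<integral>x. (\<Sum>i\<in>I. W (x i))\<^sup>2 \<partial>?P) = (\<Sum>i\<in>I. \<Sum>j\<in>I. (\<integral>x. W (x i) * W (x j) \<partial>?P))"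
    unfolding e by (simp add: Bochner_Integration.integral_sum int)
  also have "\<dots> = (\<Sum>i\<in>I. (\<integral>y. (W y)\<^sup>2 \<partial>D))"
    using I by (intro sum.cong refl) (simp add: val)
  finally show "(\<integral>x. (\<Sum>i\<in>I. W (x i))\<^sup>2 \<partial>?P) = card I * (\<integral>y. (W y)\<^sup>2 \<partial>D)" by simp
qed

text \<open>
  Truncate the summands at the mean \<open>T\<close> of the whole sum. Markov's inequality for \<open>X\<^sup>q\<close> bounds the
  probability that some summand is truncated by \<open>\<rho>\<close> and the change of the mean by \<open>\<rho> T\<close>, and the
  truncated sum has variance at most \<open>\<rho> T\<^sup>2\<close>; Chebyshev's inequality finishes. For \<open>\<rho> > \<tau> / 2\<close> the
  right hand side exceeds \<open>1\<close>.
\<close>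

lemma weak_law_moment:
  fixes X :: "'a \<Rightarrow> real" and q \<tau> T m \<rho> :: real
  assumes D: "prob_space D" and I: "finite I" "I \<noteq> {}"
    and X: "X \<in> borel_measurable D" "\<And>y. X y \<ge> 0"
    and q: "1 < q" "q \<le> 2" and int: "integrable D (\<lambda>y. X y powr q)"
    and m: "m = (\<integral>y. X y \<partial>D)" "m > 0" and \<tau>: "0 < \<tau>" "\<tau> \<le> 1"
    and T: "T = card I * m" and \<rho>: "\<rho> = card I * (\<integral>y. X y powr q \<partial>D) / T powr q"
  shows "measure (PiM I (\<lambda>_. D)) {x \<in> space (PiM I (\<lambda>_. D)). \<not> \<bar>(\<Sum>i\<in>I. X (x i)) - T\<bar> < \<tau> * T}
    \<le> 5 * \<rho> / \<tau>\<^sup>2"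
    (is "measure ?P ?A \<le> _")
proof -
  interpret D: prob_space D by fact
  interpret P: prob_space ?P by (intro prob_space_PiM D)
  define \<kappa> where "\<kappa> = (\<integral>y. X y powr q \<partial>D)"
  have \<kappa>0: "\<kappa> \<ge> 0" unfolding \<kappa>_def by (intro integral_nonneg_AE) auto
  have n: "real (card I) \<ge> 1" using I by (simp add: Suc_leI card_gt_0_iff)
  have T0: "T > 0" unfolding T using n m by simp
  have \<rho>0: "\<rho> \<ge> 0" unfolding \<rho> \<kappa>_def[symmetric] using \<kappa>0 by simp
  have \<tau>2: "\<tau>\<^sup>2 \<le> \<tau>" using \<tau> by (simp add: power2_eq_square mult_left_le)
  show ?thesis
  proof (cases "\<rho> \<le> \<tau> / 2")
    case False
    have "\<tau>\<^sup>2 < 5 * \<rho>" using False \<tau>2 \<tau> by linarith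
    then have "1 \<le> 5 * \<rho> / \<tau>\<^sup>2" using \<tau> by (simp add: field_simps)
    with P.prob_le_1 show ?thesis by (rule order_trans)
  next
    case True
    define Z where "Z y = (if X y \<le> T then X y else 0)" for y
    have Zm: "Z \<in> borel_measurable D" unfolding Z_def using X by measurable
    have Z0: "0 \<le> Z y" "Z y \<le> T" "Z y \<le> X y" for y using X T0 by (auto simp: Z_def)
    have Zi: "integrable D Z"
      using Z0 Zm by (intro D.integrable_const_bound[of _ T]) auto
    have Z2i: "integrable D (\<lambda>y. (Z y)\<^sup>2)"
      using Z0 Zm by (intro D.integrable_const_bound[of _ "T\<^sup>2"]) (auto intro!: power_mono)
    have Xi: "integrable D X"
    proof (rule Bochner_Integration.integrable_bound)
      show "integrable D (\<lambda>y. 1 + X y powr q)" using int by simp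
      show "AE y in D. norm (X y) \<le> norm (1 + X y powr q)"
      proof (rule AE_I2)
        fix y
        have "X y \<le> 1 + X y powr q"
        proof (cases "X y \<le> 1")
          case True then show ?thesis by (smt (verit) powr_ge_zero)
        next
          case False
          then have "X y powr 1 \<le> X y powr q" using q by (intro powr_mono) auto
          then show ?thesis using False by simp
        qed
        then show "norm (X y) \<le> norm (1 + X y powr q)" using X(2)[of y] by simp
      qed
    qed (use X in simp)
    define z where "z = (\<integral>y. Z y \<partial>D)"
    have tail: "X y - Z y \<le> X y powr q * T powr (1 - q)" for y
    proof (cases "X y \<le> T")
      case False
      have "X y = X y powr q * X y powr (1 - q)" using False T0 by (simp flip: powr_add)
      also have "\<dots> \<le> X y powr q * T powr (1 - q)"
        using False T0 q by (intro mult_left_mono powr_mono2') auto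
      finally show ?thesis using False by (simp add: Z_def)
    qed (simp add: Z_def)
    have mz: "\<bar>m - z\<bar> \<le> \<kappa> * T powr (1 - q)"
    proof -
      have "m - z = (\<integral>y. X y - Z y \<partial>D)" unfolding m z_def using Xi Zi by simp
      moreover have "(\<integral>y. X y - Z y \<partial>D) \<le> (\<integral>y. X y powr q * T powr (1 - q) \<partial>D)"
        using Xi Zi int tail by (intro integral_mono) auto
      moreover have "(\<integral>y. X y - Z y \<partial>D) \<ge> 0" using Z0 by (intro integral_nonneg_AE) auto
      ultimately show ?thesis unfolding \<kappa>_def by simp
    qed
    have Tp: "card I * (\<kappa> * T powr (1 - q)) = \<rho> * T" "card I * (\<kappa> * T powr (2 - q)) = \<rho> * T\<^sup>2"
      "card I * (\<kappa> * T powr (- q)) = \<rho>"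
      unfolding \<rho> \<kappa>_def[symmetric] using T0
      by (simp_all add: powr_diff powr_minus field_simps)
    define W where "W y = Z y - z" for y
    have Wi: "integrable D W" "(\<integral>y. W y \<partial>D) = 0"
      unfolding W_def z_def using Zi D.prob_space by simp_all
    have W2: "(W y)\<^sup>2 = (Z y)\<^sup>2 - 2 * z * Z y + z\<^sup>2" for y
      by (simp add: W_def power2_eq_square algebra_simps)
    have W2i: "integrable D (\<lambda>y. (W y)\<^sup>2)" unfolding W2 using Zi Z2i by simp
    have "(\<integral>y. (W y)\<^sup>2 \<partial>D) = (\<integral>y. (Z y)\<^sup>2 \<partial>D) - z\<^sup>2"
      unfolding W2 using Zi Z2i D.prob_space
      by (simp add: z_def[symmetric] power2_eq_square)
    also have "\<dots> \<le> (\<integral>y. X y powr q * T powr (2 - q) \<partial>D)"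
    proof -
      have "(\<integral>y. (Z y)\<^sup>2 \<partial>D) \<le> (\<integral>y. X y powr q * T powr (2 - q) \<partial>D)"
      proof (rule integral_mono)
        fix y
        show "(Z y)\<^sup>2 \<le> X y powr q * T powr (2 - q)"
        proof (cases "X y \<le> T \<and> X y \<noteq> 0")
          case True
          then have x: "X y > 0" using X(2)[of y] by simp
          have "(Z y)\<^sup>2 = X y powr q * X y powr (2 - q)"
            using True x by (simp add: Z_def powr_add[symmetric] powr_numeral)
          also have "\<dots> \<le> X y powr q * T powr (2 - q)"
            using True x q by (intro mult_left_mono powr_mono2) auto
          finally show ?thesis .
        qed (auto simp: Z_def)
      qed (use Z2i int in auto)
      then show ?thesis by (smt (verit) zero_le_power2)
    qed
    finally have W2b: "(\<integral>y. (W y)\<^sup>2 \<partial>D) \<le> \<kappa> * T powr (2 - q)" unfolding \<kappa>_def by simp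
    have V: "(\<integral>x. (\<Sum>i\<in>I. W (x i))\<^sup>2 \<partial>?P) \<le> \<rho> * T\<^sup>2"
      unfolding iid_sum_second_moment(1)[OF D I(1) Wi(1) W2i Wi(2)] Tp(2)[symmetric]
      using n by (intro mult_left_mono W2b) auto
    note Vi = iid_sum_second_moment(2)[OF D I(1) Wi(1) W2i Wi(2)]
    let ?V = "{x \<in> space ?P. (\<Sum>i\<in>I. W (x i))\<^sup>2 \<ge> (\<tau> * T / 2)\<^sup>2}"
    have V': "measure ?P ?V \<le> 4 * \<rho> / \<tau>\<^sup>2"
    proof -
      have "measure ?P ?V \<le> (\<integral>x. (\<Sum>i\<in>I. W (x i))\<^sup>2 \<partial>?P) / (\<tau> * T / 2)\<^sup>2"
        using integral_Markov_inequality_measure[OF Vi, of "space ?P" "(\<tau> * T / 2)\<^sup>2"] \<tau> T0 by simp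
      also have "\<dots> \<le> \<rho> * T\<^sup>2 / (\<tau> * T / 2)\<^sup>2"
        using V by (intro divide_right_mono) auto
      also have "\<dots> = 4 * \<rho> / \<tau>\<^sup>2" using T0 by (simp add: power2_eq_square field_simps)
      finally show ?thesis .
    qed
    let ?U = "\<lambda>i. {x \<in> space ?P. X (x i) > T}"
    have Um: "?U i \<in> sets ?P" if "i \<in> I" for i using that X(1) by measurable
    have U: "measure ?P (?U i) \<le> \<kappa> * T powr (- q)" if i: "i \<in> I" for i
    proof -
      have "measure ?P (?U i) = (\<integral>x. indicator {y \<in> space D. X y > T} (x i) \<partial>?P)"
      proof -
        have "measure ?P (?U i) = (\<integral>x. indicator (?U i) x \<partial>?P)" using Um[OF i] by simp
        also have "\<dots> = (\<integral>x. indicator {y \<in> space D. X y > T} (x i) \<partial>?P)"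
          using i by (intro Bochner_Integration.integral_cong) (auto simp: indicator_def space_PiM)
        finally show ?thesis .
      qed
      also have "\<dots> = (\<integral>y. indicator {y \<in> space D. X y > T} y \<partial>D)"
        using X(1) by (intro integral_PiM_coordinate[OF D i]) measurable
      also have "\<dots> \<le> (\<integral>y. X y powr q * T powr (- q) \<partial>D)"
      proof (rule integral_mono)
        show "integrable D (indicator {y \<in> space D. X y > T} :: _ \<Rightarrow> real)"
          using X(1) by (intro integrable_real_indicator) (auto simp: D.emeasure_eq_measure)
        show "integrable D (\<lambda>y. X y powr q * T powr (- q))" using int by simp
        show "indicator {y \<in> space D. X y > T} y \<le> X y powr q * T powr (- q)" for y
        proof (cases "X y > T")
          case True
          have "T powr q * T powr (- q) \<le> X y powr q * T powr (- q)"
            using True T0 q by (intro mult_right_mono powr_mono2) auto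
          then show ?thesis using T0 by (simp add: powr_minus indicator_def)
        qed auto
      qed
      finally show ?thesis unfolding \<kappa>_def by simp
    qed
    have Vm: "?V \<in> sets ?P" using Zm unfolding W_def by measurable
    have UU: "(\<Union>i\<in>I. ?U i) \<in> sets ?P" using Um I by (intro sets.finite_UN) auto
    have "?A \<subseteq> ?V \<union> (\<Union>i\<in>I. ?U i)"
    proof
      fix x assume x: "x \<in> ?A"
      show "x \<in> ?V \<union> (\<Union>i\<in>I. ?U i)"
      proof (cases "\<exists>i\<in>I. X (x i) > T")
        case True then show ?thesis using x by auto
      next
        case False
        then have "(\<Sum>i\<in>I. X (x i)) = (\<Sum>i\<in>I. Z (x i))" by (intro sum.cong) (auto simp: Z_def)
        also have "\<dots> = (\<Sum>i\<in>I. W (x i)) + card I * z" by (simp add: W_def sum_subtractf)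
        finally have "(\<Sum>i\<in>I. X (x i)) - T = (\<Sum>i\<in>I. W (x i)) - card I * (m - z)"
          unfolding T by (simp add: algebra_simps)
        moreover have "\<bar>card I * (m - z)\<bar> \<le> \<rho> * T"
        proof -
          have "\<bar>card I * (m - z)\<bar> = card I * \<bar>m - z\<bar>" by (simp add: abs_mult)
          also have "\<dots> \<le> card I * (\<kappa> * T powr (1 - q))" by (intro mult_left_mono mz) auto
          finally show ?thesis unfolding Tp .
        qed
        moreover have "\<rho> * T \<le> \<tau> * T / 2" using True T0 by simp
        moreover have "\<tau> * T \<le> \<bar>(\<Sum>i\<in>I. X (x i)) - T\<bar>" using x by auto
        ultimately have "\<tau> * T / 2 \<le> \<bar>\<Sum>i\<in>I. W (x i)\<bar>" by linarith
        then have "(\<tau> * T / 2)\<^sup>2 \<le> (\<Sum>i\<in>I. W (x i))\<^sup>2"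
          using \<tau> T0 abs_le_square_iff[of "\<tau> * T / 2" "\<Sum>i\<in>I. W (x i)"] by simp
        then show ?thesis using x by auto
      qed
    qed
    then have "measure ?P ?A \<le> measure ?P (?V \<union> (\<Union>i\<in>I. ?U i))"
      using Vm UU by (intro P.finite_measure_mono sets.Un) simp_all
    also have "\<dots> \<le> measure ?P ?V + measure ?P (\<Union>i\<in>I. ?U i)"
      using Vm UU by (intro measure_Un_le)
    also have "measure ?P (\<Union>i\<in>I. ?U i) \<le> (\<Sum>i\<in>I. measure ?P (?U i))"
      using Um I by (intro measure_UNION_le) auto
    also have "\<dots> \<le> (\<Sum>i\<in>I. \<kappa> * T powr (- q))" by (intro sum_mono U)
    also have "\<dots> = \<rho>" using Tp(3) by simp
    also note V'
    also have "4 * \<rho> / \<tau>\<^sup>2 + \<rho> \<le> 5 * \<rho> / \<tau>\<^sup>2"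
    proof -
      have "\<rho> * \<tau>\<^sup>2 \<le> \<rho> * 1" using \<rho>0 \<tau>2 \<tau> by (intro mult_left_mono) linarith+
      then have "\<rho> \<le> \<rho> / \<tau>\<^sup>2" using \<tau> by (simp add: pos_le_divide_eq)
      moreover have "5 * \<rho> / \<tau>\<^sup>2 = 4 * \<rho> / \<tau>\<^sup>2 + \<rho> / \<tau>\<^sup>2"
        by (simp flip: add_divide_distrib)
      ultimately show ?thesis by linarith
    qed
    finally show ?thesis by simp
  qed
qed

section \<open>Absolute moments of the normal distribution\<close>

abbreviation std_normal :: "real measure" where
  "std_normal \<equiv> density lborel (\<lambda>x. ennreal (std_normal_density x))"

text \<open>
  The maximum is attained at \<open>u = a / b\<close>.
\<close>

lemma powr_exp_bound:
  fixes u a b :: real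
  assumes "u \<ge> 0" "a > 0" "b > 0"
  shows "u powr a * exp (- b * u) \<le> (a / (exp 1 * b)) powr a"
proof (cases "u = 0")
  case False
  then have u: "u > 0" using assms by simp
  have "ln (u * b / a) \<le> u * b / a - 1" using u assms by (intro ln_le_minus_one) simp
  then have "a * (ln u + ln b - ln a) \<le> a * (u * b / a - 1)"
    using u assms by (intro mult_left_mono) (simp_all add: ln_mult ln_div)
  then have "a * ln u - b * u \<le> a * (ln a - 1 - ln b)" using assms by (simp add: algebra_simps)
  then have "exp (a * ln u - b * u) \<le> exp (a * (ln a - 1 - ln b))" by simp
  moreover have "u powr a * exp (- b * u) = exp (a * ln u - b * u)"
    using u by (simp add: powr_def exp_add[symmetric])
  moreover have "(a / (exp 1 * b)) powr a = exp (a * (ln a - 1 - ln b))"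
    using assms by (simp add: powr_def ln_div ln_mult algebra_simps)
  ultimately show ?thesis by simp
qed simp

text \<open>
  A share \<open>1 - 1/r\<close> of the Gaussian exponent controls the power, and the remaining share is the density
  of a normal distribution of variance \<open>r\<close> up to a factor \<open>sqrt r\<close>. This loses only a factor of order
  \<open>sqrt r\<close>, which is logarithmic in the dimension for the exponents that occur.
\<close>

lemma gauss_moment_upper:
  fixes r :: real
  assumes r: "r \<ge> 2"
  shows "integrable std_normal (\<lambda>x. \<bar>x\<bar> powr r)"
    and "(\<integral>x. \<bar>x\<bar> powr r \<partial>std_normal) \<le> exp 1 * sqrt r * (r / exp 1) powr (r / 2)"
proof -
  define C where "C = exp 1 * sqrt r * (r / exp 1) powr (r / 2)"
  define \<beta> where "\<beta> = 1 - 1 / r"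
  have \<beta>: "\<beta> > 0" "\<beta> \<ge> 1/2" unfolding \<beta>_def using r by (auto simp: field_simps)
  have b: "\<beta> powr (- (r / 2)) \<le> exp 1"
  proof -
    have "ln (1 / \<beta>) \<le> 1 / \<beta> - 1" using \<beta> by (intro ln_le_minus_one) simp
    then have "- ln \<beta> \<le> 1 / \<beta> - 1" using \<beta> by (simp add: ln_div)
    also have "1 / \<beta> - 1 \<le> 2 / r" using r by (simp add: \<beta>_def field_simps)
    finally have "(r / 2) * (- ln \<beta>) \<le> (r / 2) * (2 / r)" using r by (intro mult_left_mono) auto
    also have "\<dots> = 1" using r by simp
    finally show ?thesis using \<beta> by (simp add: powr_def)
  qed
  have bound: "std_normal_density x * \<bar>x\<bar> powr r \<le> C * normal_density 0 (sqrt r) x" for x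
  proof -
    have x2: "\<bar>x\<bar> powr r = (x\<^sup>2) powr (r / 2)"
    proof (cases "x = 0")
      case False
      then have "(x\<^sup>2) powr (r / 2) = (\<bar>x\<bar> powr 2) powr (r / 2)" by (simp add: powr_numeral)
      then show ?thesis unfolding powr_powr by simp
    qed simp
    have "(x\<^sup>2) powr (r / 2) * exp (- (\<beta> / 2) * x\<^sup>2) \<le> (r / 2 / (exp 1 * (\<beta> / 2))) powr (r / 2)"
      using r \<beta> by (intro powr_exp_bound) auto
    also have "r / 2 / (exp 1 * (\<beta> / 2)) = (r / exp 1) / \<beta>" by (simp add: field_simps)
    also have "\<dots> powr (r / 2) = (r / exp 1) powr (r / 2) * \<beta> powr (- (r / 2))"
    proof -
      have "((r / exp 1) / \<beta>) powr (r / 2) = (r / exp 1) powr (r / 2) / \<beta> powr (r / 2)"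
        by (rule powr_divide)
      then show ?thesis by (simp only: powr_minus divide_inverse)
    qed
    also have "\<dots> \<le> (r / exp 1) powr (r / 2) * exp 1" by (intro mult_left_mono b) auto
    finally have *: "(x\<^sup>2) powr (r / 2) * exp (- (\<beta> / 2) * x\<^sup>2) \<le> (r / exp 1) powr (r / 2) * exp 1" .
    have e: "exp (- x\<^sup>2 / 2) = exp (- (\<beta> / 2) * x\<^sup>2) * exp (- x\<^sup>2 / (2 * r))"
      unfolding exp_add[symmetric] \<beta>_def using r by (simp add: field_simps)
    have "std_normal_density x * \<bar>x\<bar> powr r
        = 1 / sqrt (2 * pi) * ((x\<^sup>2) powr (r / 2) * exp (- (\<beta> / 2) * x\<^sup>2)) * exp (- x\<^sup>2 / (2 * r))"
      unfolding x2 std_normal_density_def e by simp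
    also have "\<dots> \<le> 1 / sqrt (2 * pi) * ((r / exp 1) powr (r / 2) * exp 1) * exp (- x\<^sup>2 / (2 * r))"
      by (intro mult_right_mono mult_left_mono *) auto
    also have "\<dots> = C * normal_density 0 (sqrt r) x"
      using r by (simp add: C_def normal_density_def real_sqrt_mult)
    finally show ?thesis .
  qed
  have int: "integrable lborel (\<lambda>x. std_normal_density x * \<bar>x\<bar> powr r)"
  proof (rule Bochner_Integration.integrable_bound)
    show "integrable lborel (\<lambda>x. C * normal_density 0 (sqrt r) x)" using r by simp
    show "AE x in lborel. norm (std_normal_density x * \<bar>x\<bar> powr r) \<le> norm (C * normal_density 0 (sqrt r) x)"
    proof (rule AE_I2)
      fix x
      have "0 \<le> std_normal_density x * \<bar>x\<bar> powr r" by simp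
      with bound[of x] show "norm (std_normal_density x * \<bar>x\<bar> powr r) \<le> norm (C * normal_density 0 (sqrt r) x)"
        by simp
    qed
  qed simp
  then show "integrable std_normal (\<lambda>x. \<bar>x\<bar> powr r)"
    by (subst integrable_density) auto
  have "(\<integral>x. \<bar>x\<bar> powr r \<partial>std_normal) = (\<integral>x. std_normal_density x * \<bar>x\<bar> powr r \<partial>lborel)"
    by (subst integral_density) auto
  also have "\<dots> \<le> (\<integral>x. C * normal_density 0 (sqrt r) x \<partial>lborel)"
    using int r bound by (intro integral_mono) auto
  also have "\<dots> = C" using r by (simp add: integral_normal_density)
  finally show "(\<integral>x. \<bar>x\<bar> powr r \<partial>std_normal) \<le> exp 1 * sqrt r * (r / exp 1) powr (r / 2)"
    unfolding C_def .
qed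

text \<open>
  The integrand is at its maximum at \<open>sqrt p\<close> and stays within a constant factor of it on the interval
  of length one to the right.
\<close>

lemma gauss_moment_lower:
  fixes p :: real
  assumes p: "p \<ge> 2"
  shows "(p / exp 1) powr (p / 2) / 15 \<le> (\<integral>x. \<bar>x\<bar> powr p \<partial>std_normal)"
proof -
  define c where "c = (p / exp 1) powr (p / 2) / 15"
  have bound: "c * indicator {sqrt p .. sqrt p + 1} x \<le> std_normal_density x * \<bar>x\<bar> powr p" for x
  proof (cases "x \<in> {sqrt p .. sqrt p + 1}")
    case True
    define u where "u = x - sqrt p"
    have u: "0 \<le> u" "u \<le> 1" "x = sqrt p + u" using True by (auto simp: u_def)
    have sp: "sqrt p > 0" "sqrt p \<ge> 1" "sqrt p * sqrt p = p" using p by auto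
    have x: "x > 0" using u sp by linarith
    have z: "0 \<le> u / sqrt p" "u / sqrt p \<le> 1"
    proof -
      have "u \<le> sqrt p" using u sp by linarith
      with u sp show "0 \<le> u / sqrt p" "u / sqrt p \<le> 1" by (simp_all add: divide_le_eq)
    qed
    have lx: "ln x = ln p / 2 + ln (1 + u / sqrt p)"
    proof -
      have "x = sqrt p * (1 + u / sqrt p)" using u sp by (simp add: field_simps)
      moreover have "1 + u / sqrt p > 0" using z by linarith
      ultimately show ?thesis using sp p by (simp add: ln_mult ln_sqrt)
    qed
    have "p * (u / sqrt p - (u / sqrt p)\<^sup>2) \<le> p * ln (1 + u / sqrt p)"
      using p z by (intro mult_left_mono ln_one_plus_pos_lower_bound) auto
    moreover have "p * (u / sqrt p - (u / sqrt p)\<^sup>2) = sqrt p * u - u\<^sup>2"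
    proof -
      have "p * (u / sqrt p) = sqrt p * u" using sp by (simp add: field_simps)
      moreover have "p * (u / sqrt p)\<^sup>2 = u\<^sup>2" using p by (simp add: power_divide)
      ultimately show ?thesis by (simp add: right_diff_distrib)
    qed
    moreover have "x\<^sup>2 = p + 2 * sqrt p * u + u\<^sup>2"
      using sp u(3) by (simp add: power2_eq_square algebra_simps)
    ultimately have "p * ln (1 + u / sqrt p) \<ge> sqrt p * u - u\<^sup>2"
      and x2: "x\<^sup>2 = p + 2 * (sqrt p * u) + u\<^sup>2" by simp_all
    moreover have "u\<^sup>2 \<le> 1" using u by (simp add: power_le_one)
    moreover have "p * ln x = p * ln p / 2 + p * ln (1 + u / sqrt p)"
      unfolding lx by (simp add: distrib_left)
    moreover have "(p / 2) * (ln p - 1) = p * ln p / 2 - p / 2" by (simp add: right_diff_distrib)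
    ultimately have "p * ln x - x\<^sup>2 / 2 \<ge> (p / 2) * (ln p - 1) - 3 / 2" by linarith
    then have "exp ((p / 2) * (ln p - 1) - 3 / 2) \<le> exp (p * ln x - x\<^sup>2 / 2)" by simp
    moreover have "(p / exp 1) powr (p / 2) * exp (- 3 / 2) = exp ((p / 2) * (ln p - 1) - 3 / 2)"
      using p by (simp add: powr_def ln_div exp_add[symmetric])
    moreover have "\<bar>x\<bar> powr p * exp (- x\<^sup>2 / 2) = exp (p * ln x - x\<^sup>2 / 2)"
      using x by (simp add: powr_def exp_add[symmetric])
    ultimately have "(p / exp 1) powr (p / 2) * exp (- 3 / 2) \<le> \<bar>x\<bar> powr p * exp (- x\<^sup>2 / 2)" by simp
    then have "1 / sqrt (2 * pi) * ((p / exp 1) powr (p / 2) * exp (- 3 / 2))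
        \<le> 1 / sqrt (2 * pi) * (\<bar>x\<bar> powr p * exp (- x\<^sup>2 / 2))"
      by (intro mult_left_mono) auto
    moreover have "1 / 15 \<le> 1 / sqrt (2 * pi) * exp (- 3 / 2)"
    proof -
      have "sqrt (2 * pi) \<le> sqrt (3\<^sup>2)" using pi_less_4 by (intro real_sqrt_le_mono) simp
      then have "sqrt (2 * pi) \<le> 3" by simp
      moreover have "exp (3 / 2) \<le> (5::real)"
      proof -
        have "exp (3 / 2 :: real) ^ 2 = exp 1 ^ 3" by (simp flip: exp_of_nat_mult)
        also have "\<dots> \<le> 2.8 ^ 3" using e_less_272 by (intro power_mono) auto
        also have "\<dots> \<le> 5 ^ 2" by (simp add: power3_eq_cube)
        finally show ?thesis by (rule power2_le_imp_le) simp
      qed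
      ultimately have "sqrt (2 * pi) * exp (3 / 2) \<le> 3 * 5" by (intro mult_mono) auto
      then show ?thesis by (simp add: exp_minus field_simps)
    qed
    then have "c \<le> 1 / sqrt (2 * pi) * ((p / exp 1) powr (p / 2) * exp (- 3 / 2))"
      using mult_left_mono[of "1 / 15" "1 / sqrt (2 * pi) * exp (- 3 / 2)" "(p / exp 1) powr (p / 2)"]
      unfolding c_def by (simp add: mult_ac)
    ultimately show ?thesis using True by (simp add: std_normal_density_def mult_ac)
  qed simp
  have int: "integrable lborel (\<lambda>x. std_normal_density x * \<bar>x\<bar> powr p)"
    using gauss_moment_upper(1)[OF p] by (subst (asm) integrable_density) auto
  have "c = (\<integral>x. c * indicator {sqrt p .. sqrt p + 1} x \<partial>lborel)" by simp
  also have "\<dots> \<le> (\<integral>x. std_normal_density x * \<bar>x\<bar> powr p \<partial>lborel)"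
    using int bound by (intro integral_mono) auto
  also have "\<dots> = (\<integral>x. \<bar>x\<bar> powr p \<partial>std_normal)"
    by (subst integral_density) auto
  finally show ?thesis unfolding c_def .
qed

text \<open>
  By the two moment bounds the ratio is at most a multiple of
  \<open>ln n * n powr (1 - q) * q powr (p * q / 2)\<close>. With \<open>ln q \<le> q - 1\<close> the exponent of \<open>n\<close> is at most
  \<open>(q - 1) ((1 - \<delta>/2) q - 1)\<close>, which is negative for \<open>q = 1 + \<delta> / 4\<close>; this is where
  \<open>p < 2 ln n\<close> is used.
\<close>

lemma moment_ratio_bound:
  fixes p q \<delta> :: real and n :: nat
  assumes \<delta>: "0 < \<delta>" "\<delta> < 1" and n: "n \<ge> 1" and p: "2 \<le> p" "p \<le> (2 - \<delta>) * ln n"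
    and q: "q = 1 + \<delta> / 4"
  shows "n * (\<integral>x. \<bar>x\<bar> powr (p * q) \<partial>std_normal) / (n * (\<integral>x. \<bar>x\<bar> powr p \<partial>std_normal)) powr q
    \<le> 3000 * ln n * n powr (- (\<delta>\<^sup>2 / 16))"
proof -
  define L where "L = ln (real n)"
  define m where "m = (\<integral>x. \<bar>x\<bar> powr p \<partial>std_normal)"
  define b where "b = (p / exp 1) powr (p / 2)"
  have b0: "b > 0" unfolding b_def using p by simp
  have q12: "1 < q" "q \<le> 2" "q > 0" using \<delta> q by auto
  have pq: "p * q \<ge> 2" using p q12 mult_mono[of 2 p 1 q] by simp
  have m: "b / 15 \<le> m" using gauss_moment_lower[OF p(1)] unfolding m_def b_def .
  have m0: "m > 0" using m b0 by simp
  have n0: "real n > 0" using n by simp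
  have L0: "L \<ge> 1"
  proof -
    have "2 \<le> (2 - \<delta>) * L" using p by (simp add: L_def)
    moreover have "(2 - \<delta>) * L \<le> 2 * L" using \<delta> n by (intro mult_right_mono) (auto simp: L_def)
    ultimately show ?thesis by simp
  qed
  have npow: "real n powr x = exp (x * L)" for x using n0 by (simp add: powr_def L_def)
  have "(\<integral>x. \<bar>x\<bar> powr (p * q) \<partial>std_normal) \<le> exp 1 * sqrt (p * q) * (p * q / exp 1) powr (p * q / 2)"
    by (rule gauss_moment_upper(2)[OF pq])
  also have "(p * q / exp 1) powr (p * q / 2) = b powr q * q powr (p * q / 2)"
    unfolding b_def powr_powr using p q12 by (simp add: powr_mult powr_divide mult_ac)
  finally have up: "(\<integral>x. \<bar>x\<bar> powr (p * q) \<partial>std_normal) \<le> exp 1 * sqrt (p * q) * (b powr q * q powr (p * q / 2))" .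
  have low: "n powr q * (b powr q / 225) \<le> (n * m) powr q"
  proof -
    have "b powr q / 225 \<le> (b / 15) powr q"
    proof -
      have "(15::real) powr q \<le> 15 powr 2" using q12 by (intro powr_mono) auto
      then have "(15::real) powr q \<le> 225" by simp
      then have "b powr q / 225 \<le> b powr q / 15 powr q" by (intro divide_left_mono) auto
      then show ?thesis using b0 by (simp add: powr_divide)
    qed
    also have "\<dots> \<le> m powr q" using m b0 q12 by (intro powr_mono2) auto
    finally show ?thesis using n0 m0 by (simp add: powr_mult)
  qed
  have "n * (\<integral>x. \<bar>x\<bar> powr (p * q) \<partial>std_normal) / (n * m) powr q
      \<le> n * (exp 1 * sqrt (p * q) * (b powr q * q powr (p * q / 2))) / (n powr q * (b powr q / 225))"
    using up low b0 n0 q12 p by (intro frac_le mult_left_mono) (auto intro!: mult_nonneg_nonneg)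
  also have "\<dots> = 225 * exp 1 * sqrt (p * q) * (n powr (1 - q) * q powr (p * q / 2))"
    using b0 n0 by (simp add: powr_diff field_simps)
  also have "\<dots> \<le> 225 * 3 * (4 * L) * n powr (- (\<delta>\<^sup>2 / 16))"
  proof (intro mult_mono)
    show "exp 1 \<le> (3::real)" by (rule exp_le)
    have "(2 - \<delta>) * L \<le> 2 * L" using \<delta> L0 by (intro mult_right_mono) auto
    then have "p \<le> 2 * L" using p unfolding L_def by linarith
    then have "p * q \<le> 2 * L * 2" using q12 L0 p by (intro mult_mono) auto
    then have "sqrt (p * q) \<le> sqrt (4 * L)" by simp
    also have "\<dots> \<le> 4 * L" using L0
      by (intro real_le_lsqrt) (auto simp: power2_eq_square intro: order_trans[OF _ mult_left_mono[of 1]])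
    finally show "sqrt (p * q) \<le> 4 * L" .
    have "q powr (p * q / 2) = exp (p * q / 2 * ln q)" using q12 by (simp add: powr_def)
    also have "\<dots> \<le> exp ((2 - \<delta>) * L * q / 2 * (\<delta> / 4))"
    proof -
      have "ln q \<le> \<delta> / 4" using q \<delta> ln_add_one_self_le_self[of "\<delta> / 4"] by simp
      moreover have "ln q \<ge> 0" using q12 by simp
      ultimately have "p * q / 2 * ln q \<le> (2 - \<delta>) * L * q / 2 * (\<delta> / 4)"
        using p q12 \<delta> L0 by (intro mult_mono) (auto simp: L_def)
      then show ?thesis by simp
    qed
    finally have "n powr (1 - q) * q powr (p * q / 2)
        \<le> n powr (1 - q) * exp ((2 - \<delta>) * L * q / 2 * (\<delta> / 4))"
      by (intro mult_left_mono) auto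
    also have "\<dots> = exp (L * (1 - q + (2 - \<delta>) * q / 2 * (\<delta> / 4)))"
      unfolding npow exp_add[symmetric] by (simp add: algebra_simps)
    also have "1 - q + (2 - \<delta>) * q / 2 * (\<delta> / 4) = - (\<delta>\<^sup>2 / 16) - \<delta>^3 / 32"
      unfolding q by (simp add: field_simps power2_eq_square power3_eq_cube)
    also have "exp (L * (- (\<delta>\<^sup>2 / 16) - \<delta>^3 / 32)) \<le> n powr (- (\<delta>\<^sup>2 / 16))"
      unfolding npow using L0 \<delta> by (simp add: algebra_simps)
    finally show "n powr (1 - q) * q powr (p * q / 2) \<le> n powr (- (\<delta>\<^sup>2 / 16))" .
  qed (use L0 q12 p in auto)
  also have "\<dots> = 2700 * L * n powr (- (\<delta>\<^sup>2 / 16))" by simp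
  also have "\<dots> \<le> 3000 * L * n powr (- (\<delta>\<^sup>2 / 16))" using L0 by (intro mult_right_mono) auto
  finally show ?thesis unfolding m_def L_def .
qed

section \<open>Linear combinations of the columns of a Gaussian matrix\<close>

abbreviation gmat :: "nat \<Rightarrow> nat \<Rightarrow> (nat \<times> nat \<Rightarrow> real) measure" where
  "gmat n k \<equiv> gauss ({..<n} \<times> {..<k})"

abbreviation nrm :: "nat \<Rightarrow> (nat \<Rightarrow> real) \<Rightarrow> real" where
  "nrm n x \<equiv> L2_set x {..<n}"

definition comb :: "nat \<Rightarrow> nat \<Rightarrow> (nat \<Rightarrow> real) \<Rightarrow> (nat \<times> nat \<Rightarrow> real) \<Rightarrow> nat \<Rightarrow> real" where
  "comb n k a Y = (\<lambda>i. if i < n then \<Sum>j<k. a j * Y (i, j) else 0)"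

lemma sum_times_row:
  fixes f :: "nat \<Rightarrow> nat \<Rightarrow> real"
  assumes "i < n"
  shows "(\<Sum>l\<in>{..<n} \<times> {..<k}. (if fst l = i then f (fst l) (snd l) else 0)) = (\<Sum>j<k. f i j)"
proof -
  have "(\<Sum>l\<in>{..<n} \<times> {..<k}. (if fst l = i then f (fst l) (snd l) else 0))
    = (\<Sum>i'<n. \<Sum>j<k. (if i' = i then f i' j else 0))"
    by (simp add: sum.cartesian_product case_prod_beta)
  also have "\<dots> = (\<Sum>i'<n. (if i' = i then (\<Sum>j<k. f i' j) else 0))"
    by (intro sum.cong) auto
  finally show ?thesis using assms by simp
qed

lemma sum_times_column:
  fixes f :: "nat \<Rightarrow> nat \<Rightarrow> real"
  assumes "j < k"
  shows "(\<Sum>l\<in>{..<n} \<times> {..<k}. (if snd l = j then f (fst l) (snd l) else 0)) = (\<Sum>i<n. f i j)"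
proof -
  have "(\<Sum>l\<in>{..<n} \<times> {..<k}. (if snd l = j then f (fst l) (snd l) else 0))
    = (\<Sum>i<n. \<Sum>j'<k. (if j' = j then f i j' else 0))"
    unfolding sum.cartesian_product case_prod_beta ..
  then show ?thesis using assms by simp
qed

lemma gmat_row_householder:
  fixes v :: "nat \<Rightarrow> real"
  assumes v: "(\<Sum>j<k. (v j)\<^sup>2) \<in> {0, 1}"
  shows "preserves (gmat n k) (\<lambda>Y. \<lambda>l\<in>{..<n} \<times> {..<k}.
    Y l - 2 * v (snd l) * (\<Sum>j<k. v j * Y (fst l, j)))"
proof -
  define w where "w i l = (if fst l = i then v (snd l) else 0)" for i and l :: "nat \<times> nat"
  let ?I = "{..<n} \<times> {..<k}"
  have s: "(\<Sum>l\<in>?I. w i l * Y l) = (\<Sum>j<k. v j * Y (i, j))" if "i < n" for i Y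
  proof -
    have "(\<Sum>l\<in>?I. w i l * Y l) = (\<Sum>l\<in>?I. if fst l = i then v (snd l) * Y (fst l, snd l) else 0)"
      by (intro sum.cong) (auto simp: w_def)
    then show ?thesis using sum_times_row[OF that, where k = k and f = "\<lambda>i j. v j * Y (i, j)"] by simp
  qed
  have "preserves (gmat n k) (\<lambda>Y. \<lambda>l\<in>?I. Y l - (\<Sum>i\<in>{..<n}. 2 * w i l * (\<Sum>l\<in>?I. w i l * Y l)))"
  proof (rule gauss_orthogonal_householders)
    fix i assume "i \<in> {..<n}"
    then have "(\<Sum>l\<in>?I. (w i l)\<^sup>2) = (\<Sum>j<k. (v j)\<^sup>2)"
      using s[of i "w i"] by (simp add: power2_eq_square w_def)
    then show "(\<Sum>l\<in>?I. (w i l)\<^sup>2) \<in> {0, 1}" using v by simp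
  qed (auto simp: w_def intro!: sum.neutral)
  then show ?thesis
  proof (rule preserves_cong, intro restrict_ext)
    fix Y :: "nat \<times> nat \<Rightarrow> real" and l assume l: "l \<in> ?I"
    have "(\<Sum>i<n. 2 * w i l * (\<Sum>l\<in>?I. w i l * Y l)) = (\<Sum>i<n. if i = fst l then 2 * v (snd l) * (\<Sum>j<k. v j * Y (i, j)) else 0)"
      by (intro sum.cong refl) (auto simp: s, auto simp: w_def)
    also have "\<dots> = 2 * v (snd l) * (\<Sum>j<k. v j * Y (fst l, j))" using l by (simp add: mem_Times_iff)
    finally show "Y l - (\<Sum>i<n. 2 * w i l * (\<Sum>l\<in>?I. w i l * Y l)) = Y l - 2 * v (snd l) * (\<Sum>j<k. v j * Y (fst l, j))"
      by simp
  qed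
qed

lemma gmat_column_householder:
  fixes v :: "nat \<Rightarrow> real"
  assumes v: "(\<Sum>i<n. (v i)\<^sup>2) \<in> {0, 1}"
  shows "preserves (gmat n k) (\<lambda>Y. \<lambda>l\<in>{..<n} \<times> {..<k}.
    Y l - 2 * v (fst l) * (\<Sum>i<n. v i * Y (i, snd l)))"
proof -
  define w where "w j l = (if snd l = j then v (fst l) else 0)" for j and l :: "nat \<times> nat"
  let ?I = "{..<n} \<times> {..<k}"
  have s: "(\<Sum>l\<in>?I. w j l * Y l) = (\<Sum>i<n. v i * Y (i, j))" if "j < k" for j Y
  proof -
    have "(\<Sum>l\<in>?I. w j l * Y l) = (\<Sum>l\<in>?I. if snd l = j then v (fst l) * Y (fst l, snd l) else 0)"
      by (intro sum.cong) (auto simp: w_def)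
    then show ?thesis using sum_times_column[OF that, where n = n and f = "\<lambda>i j. v i * Y (i, j)"] by simp
  qed
  have "preserves (gmat n k) (\<lambda>Y. \<lambda>l\<in>?I. Y l - (\<Sum>j\<in>{..<k}. 2 * w j l * (\<Sum>l\<in>?I. w j l * Y l)))"
  proof (rule gauss_orthogonal_householders)
    fix j assume "j \<in> {..<k}"
    then have "(\<Sum>l\<in>?I. (w j l)\<^sup>2) = (\<Sum>i<n. (v i)\<^sup>2)"
      using s[of j "w j"] by (simp add: power2_eq_square w_def)
    then show "(\<Sum>l\<in>?I. (w j l)\<^sup>2) \<in> {0, 1}" using v by simp
  qed (auto simp: w_def intro!: sum.neutral)
  then show ?thesis
  proof (rule preserves_cong, intro restrict_ext)
    fix Y :: "nat \<times> nat \<Rightarrow> real" and l assume l: "l \<in> ?I"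
    have "(\<Sum>j<k. 2 * w j l * (\<Sum>l\<in>?I. w j l * Y l)) = (\<Sum>j<k. if j = snd l then 2 * v (fst l) * (\<Sum>i<n. v i * Y (i, j)) else 0)"
      by (intro sum.cong refl) (auto simp: s, auto simp: w_def)
    also have "\<dots> = 2 * v (fst l) * (\<Sum>i<n. v i * Y (i, snd l))" using l by (simp add: mem_Times_iff)
    finally show "Y l - (\<Sum>j<k. 2 * w j l * (\<Sum>l\<in>?I. w j l * Y l)) = Y l - 2 * v (fst l) * (\<Sum>i<n. v i * Y (i, snd l))"
      by simp
  qed
qed

lemma distr_gmat_first_column:
  assumes k: "0 < k"
  shows "distr (gmat n k) (gauss {..<n}) (\<lambda>Y. \<lambda>i\<in>{..<n}. Y (i, 0)) = gauss {..<n}"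
proof -
  have "distr (gmat n k) (PiM {..<n} (\<lambda>_. std_normal)) (\<lambda>Y. \<lambda>i\<in>{..<n}. Y (i, 0)) = PiM {..<n} (\<lambda>_. std_normal)"
    unfolding gauss_def using k
    by (intro distr_PiM_reindex) (auto intro!: prob_space_normal_density simp: inj_on_def)
  then show ?thesis by (simp add: gauss_def)
qed

lemma measurable_gauss_component:
  "i \<in> I \<Longrightarrow> (\<lambda>Y. Y i) \<in> borel_measurable (gauss I)"
  by (simp add: gauss_def)

lemma measurable_into_gauss:
  assumes "\<And>i. i \<in> I \<Longrightarrow> (\<lambda>x. f x i) \<in> borel_measurable M" "\<And>x i. i \<notin> I \<Longrightarrow> f x i = undefined"
  shows "f \<in> M \<rightarrow>\<^sub>M gauss I"
proof -
  have "(\<lambda>x. \<lambda>i\<in>I. f x i) \<in> M \<rightarrow>\<^sub>M PiM I (\<lambda>_. std_normal)"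
    using assms by (intro measurable_restrict) auto
  moreover have "(\<lambda>x. \<lambda>i\<in>I. f x i) = f" using assms(2) by (auto simp: fun_eq_iff restrict_def)
  ultimately show ?thesis by (simp add: gauss_def)
qed

text \<open>
  A reflection of \<open>\<real>\<^sup>k\<close> takes the first unit vector to \<open>a\<close>. Applied to all rows it preserves the law of
  \<open>Y\<close> and turns the first column into \<open>Y a\<close>.
\<close>

lemma distr_gmat_comb:
  assumes k: "0 < k" and a: "(\<Sum>j<k. (a j)\<^sup>2) = 1"
  shows "distr (gmat n k) (gauss {..<n}) (\<lambda>Y. \<lambda>i\<in>{..<n}. comb n k a Y i) = gauss {..<n}"
proof -
  define r where "r = sqrt (2 - 2 * a 0)"
  have a0: "(a 0)\<^sup>2 + (\<Sum>j\<in>{..<k} - {0}. (a j)\<^sup>2) = 1"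
    using a k by (subst (asm) sum.remove[of _ 0]) auto
  then have "(a 0)\<^sup>2 \<le> 1\<^sup>2" using sum_nonneg[of "{..<k} - {0}" "\<lambda>j. (a j)\<^sup>2"] by simp
  then have a01: "a 0 \<le> 1" by (rule power2_le_imp_le) simp
  then have r2: "r\<^sup>2 = 2 - 2 * a 0" by (simp add: r_def)
  \<comment> \<open>the normalised difference of the first unit vector and \<open>a\<close>; for \<open>r = 0\<close> they agree and the identity is used\<close>
  define q where "q j = (if r = 0 then 0 else ((if j = 0 then 1 else 0) - a j) / r)" for j :: nat
  have q2: "(\<Sum>j<k. (q j)\<^sup>2) \<in> {0, 1}"
  proof (cases "r = 0")
    case False
    have "(\<Sum>j<k. (q j)\<^sup>2) = (\<Sum>j<k. ((if j = 0 then 1 - 2 * a 0 else 0) + (a j)\<^sup>2)) / r\<^sup>2"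
      unfolding sum_divide_distrib using False
      by (intro sum.cong refl) (auto simp: q_def power_divide power2_eq_square algebra_simps)
    moreover have "r\<^sup>2 \<noteq> 0" using False by simp
    ultimately have "(\<Sum>j<k. (q j)\<^sup>2) = 1" using k a r2 False by (auto simp: sum.distrib)
    then show ?thesis by simp
  qed (simp add: q_def)
  have q: "Y (i, 0) - 2 * q 0 * (\<Sum>j<k. q j * Y (i, j)) = (\<Sum>j<k. a j * Y (i, j))" for i and Y :: "nat \<times> nat \<Rightarrow> real"
  proof (cases "r = 0")
    case True
    then have "a 0 = 1" using r2 by simp
    moreover from this have "\<forall>j\<in>{..<k} - {0}. a j = 0"
      using a0 by (simp add: sum_nonneg_eq_0_iff)
    then have "(\<Sum>j<k. a j * Y (i, j)) = (\<Sum>j\<in>{0}. a j * Y (i, j))"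
      using k by (intro sum.mono_neutral_right) auto
    ultimately show ?thesis using True by (simp add: q_def)
  next
    case False
    have "2 * q 0 * (\<Sum>j<k. q j * Y (i, j)) = (\<Sum>j<k. (2 * (1 - a 0) / r\<^sup>2) * (((if j = 0 then 1 else 0) - a j) * Y (i, j)))"
      unfolding sum_distrib_left using False
      by (intro sum.cong refl) (simp add: q_def power2_eq_square)
    also have "2 * (1 - a 0) / r\<^sup>2 = 1" using r2 zero_less_power2[of r] False by (simp add: field_simps)
    also have "(\<Sum>j<k. 1 * (((if j = 0 then 1 else 0) - a j) * Y (i, j))) = Y (i, 0) - (\<Sum>j<k. a j * Y (i, j))"
      using k by (simp add: left_diff_distrib sum_subtractf if_distrib[of "\<lambda>x. x * _"] cong: if_cong)
    finally show ?thesis by simp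
  qed
  let ?I = "{..<n} \<times> {..<k}"
  let ?H = "\<lambda>Y. \<lambda>l\<in>?I. Y l - 2 * q (snd l) * (\<Sum>j<k. q j * Y (fst l, j))"
  let ?F = "\<lambda>Y. \<lambda>i\<in>{..<n}. Y (i, 0::nat)"
  have H: "?H \<in> gmat n k \<rightarrow>\<^sub>M gmat n k" "distr (gmat n k) (gmat n k) ?H = gmat n k"
    using gmat_row_householder[OF q2] unfolding preserves_def by auto
  have F: "?F \<in> gmat n k \<rightarrow>\<^sub>M gauss {..<n}"
    using k by (intro measurable_into_gauss) (auto intro!: measurable_gauss_component)
  have "(\<lambda>Y. \<lambda>i\<in>{..<n}. comb n k a Y i) = ?F \<circ> ?H"
    using k q by (auto simp: fun_eq_iff comb_def)
  then have "distr (gmat n k) (gauss {..<n}) (\<lambda>Y. \<lambda>i\<in>{..<n}. comb n k a Y i)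
    = distr (distr (gmat n k) (gmat n k) ?H) (gauss {..<n}) ?F"
    using distr_distr[OF F H(1)] by simp
  then show ?thesis using H(2) distr_gmat_first_column[OF k] by simp
qed

lemma comb_measurable [measurable]: "(\<lambda>Y. comb n k a Y i) \<in> borel_measurable (gmat n k)"
  unfolding comb_def
  by (cases "i < n") (auto intro!: borel_measurable_sum borel_measurable_times measurable_gauss_component)

lemma measure_gmat_comb:
  assumes k: "0 < k" and a: "(\<Sum>j<k. (a j)\<^sup>2) = 1"
    and P: "Measurable.pred (gauss {..<n}) P"
    and cong: "\<And>x y. (\<And>i. i < n \<Longrightarrow> x i = y i) \<Longrightarrow> P x = P y"
  shows "measure (gmat n k) {Y \<in> space (gmat n k). P (comb n k a Y)} = measure (gauss {..<n}) {x \<in> space (gauss {..<n}). P x}"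
proof -
  let ?c = "\<lambda>Y. \<lambda>i\<in>{..<n}. comb n k a Y i"
  have c: "?c \<in> gmat n k \<rightarrow>\<^sub>M gauss {..<n}"
  proof (rule measurable_into_gauss)
    show "(\<lambda>Y. ?c Y i) \<in> borel_measurable (gmat n k)" if "i \<in> {..<n}" for i
      using comb_measurable[of n k a i] that by (simp only: restrict_apply' if_True)
    show "?c Y i = undefined" if "i \<notin> {..<n}" for Y i using that by (simp only: restrict_apply if_False)
  qed
  have A: "{x \<in> space (gauss {..<n}). P x} \<in> sets (gauss {..<n})" using predE[OF P] .
  have "measure (gauss {..<n}) {x \<in> space (gauss {..<n}). P x}
      = measure (distr (gmat n k) (gauss {..<n}) ?c) {x \<in> space (gauss {..<n}). P x}"
    by (simp add: distr_gmat_comb[OF k a])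
  also have "\<dots> = measure (gmat n k) (?c -` {x \<in> space (gauss {..<n}). P x} \<inter> space (gmat n k))"
    by (rule measure_distr[OF c A])
  also have "?c -` {x \<in> space (gauss {..<n}). P x} \<inter> space (gmat n k) = {Y \<in> space (gmat n k). P (comb n k a Y)}"
    using cong[of "\<lambda>i\<in>{..<n}. comb n k a _ i" "comb n k a _"] by auto
  finally show ?thesis by simp
qed

lemma lp_norm_cong: "(\<And>i. i < n \<Longrightarrow> x i = y i) \<Longrightarrow> lp_norm n p x = lp_norm n p y"
  by (simp add: lp_norm_def)

lemma lp_norm_measurable [measurable]: "(\<lambda>x. lp_norm n p x) \<in> borel_measurable (gauss {..<n})"
  unfolding lp_norm_def
  by (intro powr_real_measurable borel_measurable_sum borel_measurable_abs measurable_gauss_component borel_measurable_const) auto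

abbreviation deviation_bound :: "real \<Rightarrow> nat \<Rightarrow> real \<Rightarrow> real" where
  "deviation_bound \<delta> n \<tau> \<equiv> 15000 * ln n * n powr (- (\<delta>\<^sup>2 / 16)) / \<tau>\<^sup>2"

text \<open>
  The centre \<open>b\<close> is independent of \<open>\<tau>\<close>; the exponent \<open>p = 2\<close> is included and controls Euclidean norms.
\<close>

lemma gauss_lp_norm_concentration:
  fixes p \<delta> :: real and n :: nat
  assumes \<delta>: "0 < \<delta>" "\<delta> < 1" and n: "n \<ge> 1" and p: "2 \<le> p" "p \<le> (2 - \<delta>) * ln n"
  obtains b where "b > 0"
    "\<And>\<tau>. 0 < \<tau> \<Longrightarrow> \<tau> \<le> 1 \<Longrightarrow>
      measure (gauss {..<n}) {x \<in> space (gauss {..<n}). \<not> \<bar>lp_norm n p x - b\<bar> < \<tau> * b}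
        \<le> deviation_bound \<delta> n \<tau>"
proof -
  define m where "m = (\<integral>x. \<bar>x\<bar> powr p \<partial>std_normal)"
  define T where "T = n * m"
  define b where "b = T powr (1 / p)"
  define q where "q = 1 + \<delta> / 4"
  have q12: "1 < q" "q \<le> 2" using \<delta> by (auto simp: q_def)
  have pq: "p * q \<ge> 2" using p q12 mult_mono[of 2 p 1 q] by simp
  have "(p / exp 1) powr (p / 2) / 15 > 0" using p by simp
  then have m: "m > 0" using gauss_moment_lower[OF p(1)] unfolding m_def by linarith
  have T: "T > 0" using m n by (simp add: T_def)
  have b: "b > 0" using T by (simp add: b_def)
  have prob: "prob_space std_normal" by (rule prob_space_normal_density) simp
  have e: "(\<bar>y\<bar> powr p) powr q = \<bar>y\<bar> powr (p * q)" for y by (simp add: powr_powr)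
  have "measure (gauss {..<n}) {x \<in> space (gauss {..<n}). \<not> \<bar>lp_norm n p x - b\<bar> < \<tau> * b}
        \<le> deviation_bound \<delta> n \<tau>" if \<tau>: "0 < \<tau>" "\<tau> \<le> 1" for \<tau>
  proof -
    interpret prob_space "gauss {..<n}" by (rule prob_space_gauss)
    let ?A = "{x \<in> space (gauss {..<n}). \<not> \<bar>(\<Sum>i<n. \<bar>x i\<bar> powr p) - T\<bar> < \<tau> * T}"
    have "measure (gauss {..<n}) ?A \<le> 5 * (card {..<n} * (\<integral>x. (\<bar>x\<bar> powr p) powr q \<partial>std_normal) / T powr q) / \<tau>\<^sup>2"
      unfolding gauss_def
      by (rule weak_law_moment[OF prob, where m = m])
        (use n q12 m \<tau> gauss_moment_upper(1)[OF pq] in \<open>auto simp: m_def T_def e lessThan_empty_iff\<close>)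
    also have "\<dots> \<le> 5 * (3000 * ln n * n powr (- (\<delta>\<^sup>2 / 16))) / \<tau>\<^sup>2"
      unfolding e using moment_ratio_bound[OF \<delta> n p q_def]
      by (intro divide_right_mono mult_left_mono) (auto simp: T_def m_def)
    finally have A: "measure (gauss {..<n}) ?A \<le> deviation_bound \<delta> n \<tau>" by simp
    have "{x \<in> space (gauss {..<n}). \<not> \<bar>lp_norm n p x - b\<bar> < \<tau> * b} \<subseteq> ?A"
    proof (intro Collect_mono impI, elim conjE, intro conjI)
      fix x assume x: "\<not> \<bar>lp_norm n p x - b\<bar> < \<tau> * b"
      define S where "S = (\<Sum>i<n. \<bar>x i\<bar> powr p)"
      show "\<not> \<bar>(\<Sum>i<n. \<bar>x i\<bar> powr p) - T\<bar> < \<tau> * T"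
      proof
        assume "\<bar>(\<Sum>i<n. \<bar>x i\<bar> powr p) - T\<bar> < \<tau> * T"
        then have S: "\<bar>S - T\<bar> < \<tau> * T" by (simp add: S_def)
        define s where "s = S / T"
        have "S = s * T" using T by (simp add: s_def)
        with S have "\<bar>(s - 1) * T\<bar> < \<tau> * T" by (simp only: left_diff_distrib mult_1)
        then have "\<bar>s - 1\<bar> * T < \<tau> * T" using T by (simp only: abs_mult abs_of_pos)
        then have s: "\<bar>s - 1\<bar> < \<tau>" using T by simp
        then have s0: "s > 0" using \<tau> by linarith
        have sb: "\<bar>s powr (1 / p) - 1\<bar> < \<tau>"
        proof (cases "s \<le> 1")
          case True
          have "s powr 1 \<le> s powr (1 / p)" using True s0 p by (intro powr_mono') auto
          moreover have "s powr (1 / p) \<le> 1" using True s0 p by (intro powr_le1) auto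
          ultimately show ?thesis using s s0 by simp
        next
          case False
          have "s powr (1 / p) \<le> s powr 1" using False p by (intro powr_mono) auto
          moreover have "1 \<le> s powr (1 / p)" using False p by (intro ge_one_powr_ge_zero) auto
          ultimately show ?thesis using s s0 by simp
        qed
        have "lp_norm n p x = s powr (1 / p) * b"
          using T s0 \<open>S = s * T\<close> by (simp add: lp_norm_def S_def[symmetric] b_def powr_mult)
        then have "\<bar>lp_norm n p x - b\<bar> = \<bar>s powr (1 / p) - 1\<bar> * b"
        proof -
          have "\<bar>lp_norm n p x - b\<bar> = \<bar>(s powr (1 / p) - 1) * b\<bar>"
            using \<open>lp_norm n p x = s powr (1 / p) * b\<close> by (simp only: left_diff_distrib mult_1)
          then show ?thesis using b by (simp only: abs_mult abs_of_pos)
        qed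
        then show False using x sb b by simp
      qed
    qed
    then have "measure (gauss {..<n}) {x \<in> space (gauss {..<n}). \<not> \<bar>lp_norm n p x - b\<bar> < \<tau> * b} \<le> measure (gauss {..<n}) ?A"
    proof (rule finite_measure_mono)
      have Sm: "(\<lambda>x. \<Sum>i<n. \<bar>x i\<bar> powr p) \<in> borel_measurable (gauss {..<n})"
        by (intro borel_measurable_sum powr_real_measurable borel_measurable_abs
            measurable_gauss_component borel_measurable_const) auto
      show "?A \<in> sets (gauss {..<n})" using Sm by measurable
    qed
    with A show ?thesis by linarith
  qed
  with b that show ?thesis by blast
qed

section \<open>Nets in the sphere and seminorms\<close>

lemma sum_abs_le_sqrt_card:
  fixes a :: "nat \<Rightarrow> real"
  shows "(\<Sum>j<k. \<bar>a j\<bar>) \<le> sqrt (real k) * nrm k a"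
  using L2_set_mult_ineq[of "\<lambda>_. 1" a "{..<k}"] by (simp add: L2_set_constant)

lemma geometric_sum_int:
  fixes x :: real
  assumes x: "0 < x" "x < 1"
  shows "(\<Sum>m\<in>{- int B..int B}. x ^ nat \<bar>m\<bar>) \<le> 2 / (1 - x)"
proof -
  have g: "(\<Sum>i\<le>B. x ^ i) \<le> 1 / (1 - x)"
  proof -
    have "(\<Sum>i\<le>B. x ^ i) = (1 - x ^ Suc B) / (1 - x)" using x by (subst sum_gp0) auto
    also have "\<dots> \<le> 1 / (1 - x)" using x by (intro divide_right_mono) auto
    finally show ?thesis .
  qed
  have "(\<Sum>m\<in>{- int B..int B}. x ^ nat \<bar>m\<bar>) \<le> (\<Sum>m\<in>(int ` {..B}) \<union> ((\<lambda>i. - int i) ` {..B}). x ^ nat \<bar>m\<bar>)"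
  proof (intro sum_mono2)
    show "{- int B..int B} \<subseteq> (int ` {..B}) \<union> ((\<lambda>i. - int i) ` {..B})"
    proof
      fix m assume m: "m \<in> {- int B..int B}"
      show "m \<in> (int ` {..B}) \<union> ((\<lambda>i. - int i) ` {..B})"
      proof (cases "m \<ge> 0")
        case True
        then have "m = int (nat m)" "nat m \<in> {..B}" using m by auto
        then show ?thesis by blast
      next
        case False
        then have "m = - int (nat (- m))" "nat (- m) \<in> {..B}" using m by auto
        then show ?thesis by blast
      qed
    qed
  qed (use x in auto)
  also have "\<dots> \<le> (\<Sum>m\<in>int ` {..B}. x ^ nat \<bar>m\<bar>) + (\<Sum>m\<in>(\<lambda>i. - int i) ` {..B}. x ^ nat \<bar>m\<bar>)"
    using x by (simp add: sum_Un sum_nonneg)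
  also have "\<dots> = (\<Sum>i\<le>B. x ^ i) + (\<Sum>i\<le>B. x ^ i)"
    by (simp add: sum.reindex inj_on_def)
  also have "\<dots> \<le> 2 / (1 - x)" using g by (simp add: field_simps)
  finally show ?thesis .
qed

text \<open>
  Weigh each lattice point \<open>m\<close> with \<open>exp (- (\<theta>/2) * \<Sum>\<bar>m\<^sub>j\<bar>)\<close>. On the ball the weight is at least
  \<open>exp (- k)\<close>, while the total weight of the lattice is the \<open>k\<close>-th power of a geometric series. A bound
  by coordinates would produce an additional factor \<open>k powr (k / 2)\<close>, which is not a small power of \<open>n\<close>
  for \<open>k\<close> of order \<open>ln n\<close>.
\<close>

lemma card_lattice_l1_ball:
  fixes k :: nat and \<theta> :: real
  assumes \<theta>: "0 < \<theta>" "\<theta> \<le> (1::real)"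
  defines "A \<equiv> {m \<in> {..<k} \<rightarrow>\<^sub>E (UNIV :: int set). real_of_int (\<Sum>j<k. \<bar>m j\<bar>) \<le> 2 * real k / \<theta>}"
  shows "finite A" and "real (card A) \<le> (24 / \<theta>) ^ k"
proof -
  obtain B :: nat where B: "2 * real k / \<theta> \<le> real B" using real_arch_simple by blast
  let ?P = "{..<k} \<rightarrow>\<^sub>E {- int B..int B}"
  have sub: "A \<subseteq> ?P"
  proof
    fix m assume m: "m \<in> A"
    have "\<bar>m j\<bar> \<le> int B" if "j < k" for j
    proof -
      have "\<bar>m j\<bar> \<le> (\<Sum>j<k. \<bar>m j\<bar>)" using that by (intro member_le_sum) auto
      then have "real_of_int \<bar>m j\<bar> \<le> real_of_int (\<Sum>j<k. \<bar>m j\<bar>)" by (simp only: of_int_le_iff)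
      moreover have "real_of_int (\<Sum>j<k. \<bar>m j\<bar>) \<le> real B" using m B unfolding A_def by simp
      ultimately have "real_of_int \<bar>m j\<bar> \<le> real B" by linarith
      then show ?thesis by linarith
    qed
    then have "m j \<in> {- int B..int B}" if "j < k" for j using that by (fastforce simp: abs_le_iff)
    then show "m \<in> ?P" using m unfolding A_def by (auto simp: PiE_iff)
  qed
  have finP: "finite ?P" by (intro finite_PiE) auto
  then show finA: "finite A" using sub finite_subset by blast
  define x where "x = exp (- \<theta> / 2)"
  have x: "0 < x" "x < 1" using \<theta> by (auto simp: x_def)
  have x1: "\<theta> / 4 \<le> 1 - x"
  proof -
    have "x = inverse (exp (\<theta> / 2))" unfolding x_def by (simp flip: exp_minus)
    also have "\<dots> \<le> inverse (1 + \<theta> / 2)"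
      using \<theta> by (intro le_imp_inverse_le exp_ge_add_one_self) auto
    also have "\<dots> = 1 / (1 + \<theta> / 2)" by (rule inverse_eq_divide)
    also have "\<dots> \<le> 1 - \<theta> / 4" 
    proof -
      have "1 \<le> (1 - \<theta> / 4) * (1 + \<theta> / 2)"
        using \<theta> mult_right_mono[of \<theta> 1 \<theta>] by (simp add: algebra_simps)
      then show ?thesis using \<theta> by (subst pos_divide_le_eq) auto
    qed
    finally show ?thesis by simp
  qed
  have "real (card A) * exp (- real k) = (\<Sum>m\<in>A. exp (- real k))" by simp
  also have "\<dots> \<le> (\<Sum>m\<in>A. \<Prod>j<k. x ^ nat \<bar>m j\<bar>)"
  proof (rule sum_mono)
    fix m assume m: "m \<in> A"
    have "(\<Prod>j<k. x ^ nat \<bar>m j\<bar>) = exp (- (\<theta> / 2) * real_of_int (\<Sum>j<k. \<bar>m j\<bar>))"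
      by (simp add: x_def exp_of_nat_mult[symmetric] exp_sum[symmetric] sum_distrib_left mult.commute)
    moreover have "- real k \<le> - (\<theta> / 2) * real_of_int (\<Sum>j<k. \<bar>m j\<bar>)"
      using m \<theta> unfolding A_def by (simp add: field_simps)
    ultimately show "exp (- real k) \<le> (\<Prod>j<k. x ^ nat \<bar>m j\<bar>)" by simp
  qed
  also have "\<dots> \<le> (\<Sum>m\<in>?P. \<Prod>j<k. x ^ nat \<bar>m j\<bar>)"
    using sub finP x by (intro sum_mono2 prod_nonneg) auto
  also have "\<dots> = (\<Prod>j<k. \<Sum>m\<in>{- int B..int B}. x ^ nat \<bar>m\<bar>)"
    by (subst prod_sum_PiE) auto
  also have "\<dots> \<le> (\<Prod>j<k. 8 / \<theta>)"
  proof (intro prod_mono conjI)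
    have "2 / (1 - x) \<le> 2 / (\<theta> / 4)" using x1 \<theta> by (intro divide_left_mono) auto
    with geometric_sum_int[OF x, of B] show "(\<Sum>m\<in>{- int B..int B}. x ^ nat \<bar>m\<bar>) \<le> 8 / \<theta>" by simp
  qed (use x in \<open>auto intro!: sum_nonneg\<close>)
  finally have "real (card A) * exp (- real k) \<le> (8 / \<theta>) ^ k" by simp
  then have "real (card A) \<le> (8 / \<theta>) ^ k * exp (real k)"
    by (simp add: exp_minus field_simps)
  also have "exp (real k) = exp 1 ^ k" by (simp flip: exp_of_nat_mult)
  also have "(8 / \<theta>) ^ k * exp 1 ^ k \<le> (8 / \<theta>) ^ k * 3 ^ k"
    using \<theta> exp_le by (intro mult_left_mono power_mono) auto
  finally show "real (card A) \<le> (24 / \<theta>) ^ k" by (simp flip: power_mult_distrib)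
qed

text \<open>
  Cut \<open>\<real>\<^sup>k\<close> into cubes of side \<open>\<theta> / sqrt k\<close>, which have diameter \<open>\<theta>\<close>, and take one point of
  the sphere from every cube that meets it. These cubes are indexed by lattice points in an \<open>\<ell>\<^sub>1\<close> ball,
  because the \<open>\<ell>\<^sub>1\<close> norm is at most \<open>sqrt k\<close> on the sphere.
\<close>

lemma sphere_net:
  assumes k: "0 < k" and \<theta>: "0 < \<theta>" "\<theta> \<le> (1::real)"
  obtains N :: "(nat \<Rightarrow> real) set" where "finite N" "real (card N) \<le> (24 / \<theta>) ^ k"
    "\<And>b. b \<in> N \<Longrightarrow> nrm k b = 1"
    "\<And>a. nrm k a = 1 \<Longrightarrow> \<exists>b\<in>N. nrm k (\<lambda>j. a j - b j) \<le> \<theta>"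
proof -
  define h where "h = \<theta> / sqrt (real k)"
  have h: "h > 0" using k \<theta> by (simp add: h_def)
  define cell where "cell a = (\<lambda>j\<in>{..<k}. \<lfloor>a j / h\<rfloor>)" for a :: "nat \<Rightarrow> real"
  let ?S = "{a :: nat \<Rightarrow> real. nrm k a = 1}"
  define pick where "pick m = (SOME a. a \<in> ?S \<and> cell a = m)" for m
  define A where "A = {m \<in> {..<k} \<rightarrow>\<^sub>E (UNIV :: int set). real_of_int (\<Sum>j<k. \<bar>m j\<bar>) \<le> 2 * real k / \<theta>}"
  have cA: "cell a \<in> A" if a: "a \<in> ?S" for a
  proof -
    have "real_of_int (\<Sum>j<k. \<bar>cell a j\<bar>) = (\<Sum>j<k. \<bar>real_of_int \<lfloor>a j / h\<rfloor>\<bar>)"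
      by (simp add: cell_def)
    also have "\<dots> \<le> (\<Sum>j<k. \<bar>a j\<bar> / h + 1)"
    proof (rule sum_mono)
      fix j
      have "\<bar>real_of_int \<lfloor>a j / h\<rfloor>\<bar> \<le> \<bar>a j / h\<bar> + 1" by linarith
      then show "\<bar>real_of_int \<lfloor>a j / h\<rfloor>\<bar> \<le> \<bar>a j\<bar> / h + 1" using h by simp
    qed
    also have "\<dots> = (\<Sum>j<k. \<bar>a j\<bar>) / h + k" by (simp add: sum.distrib sum_divide_distrib)
    also have "\<dots> \<le> sqrt k / h + k"
      using sum_abs_le_sqrt_card[of a k] a h by (intro add_right_mono divide_right_mono) auto
    also have "sqrt k / h = k / \<theta>" using k \<theta> by (simp add: h_def)
    also have "k / \<theta> + k \<le> 2 * k / \<theta>" using \<theta> mult_right_mono[of \<theta> 1 "real k"] by (simp add: field_simps)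
    finally show ?thesis unfolding A_def by (simp add: cell_def)
  qed
  have p: "pick (cell a) \<in> ?S \<and> cell (pick (cell a)) = cell a" if "a \<in> ?S" for a
    unfolding pick_def by (rule someI[of _ a]) (use that in simp)
  let ?N = "pick ` cell ` ?S"
  have sub: "cell ` ?S \<subseteq> A" using cA by auto
  note cardA = card_lattice_l1_ball[OF \<theta>, of k, folded A_def]
  show thesis
  proof (rule that[of ?N])
    show "finite ?N" using sub cardA(1) finite_subset by blast
    have "finite (cell ` ?S)" using sub cardA(1) finite_subset by blast
    then have "card ?N \<le> card (cell ` ?S)" by (rule card_image_le)
    also have "\<dots> \<le> card A" by (rule card_mono[OF cardA(1) sub])
    finally have "card ?N \<le> card A" .
    then show "real (card ?N) \<le> (24 / \<theta>) ^ k" using cardA(2) by linarith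
    show "nrm k b = 1" if "b \<in> ?N" for b using that p by auto
    show "\<exists>b\<in>?N. nrm k (\<lambda>j. a j - b j) \<le> \<theta>" if a: "nrm k a = 1" for a
    proof
      let ?b = "pick (cell a)"
      show "?b \<in> ?N" using a by auto
      have c: "cell ?b = cell a" using p a by auto
      have "\<bar>a j - ?b j\<bar> \<le> h" if j: "j < k" for j
      proof -
        have "\<lfloor>a j / h\<rfloor> = \<lfloor>?b j / h\<rfloor>" using fun_cong[OF c, of j] j by (simp add: cell_def)
        then have "\<bar>a j / h - ?b j / h\<bar> \<le> 1" by linarith
        then have "\<bar>a j - ?b j\<bar> / h \<le> 1" using h by (simp add: diff_divide_distrib[symmetric])
        then show ?thesis using h by (simp add: field_simps)
      qed
      then have "nrm k (\<lambda>j. \<bar>a j - ?b j\<bar>) \<le> nrm k (\<lambda>_. h)"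
        by (intro L2_set_mono) auto
      also have "\<dots> = \<theta>" using h k by (simp add: L2_set_constant) (simp add: h_def)
      finally show "nrm k (\<lambda>j. a j - ?b j) \<le> \<theta>" by (simp add: L2_set_def)
    qed
  qed
qed

text \<open>
  If \<open>M\<close> is the supremum of the seminorm on the sphere, approximating a point by the net changes its
  value by at most \<open>\<theta> M\<close>. This bounds \<open>M\<close> itself first, and then every value from below.
\<close>

lemma seminorm_near_constant_on_sphere:
  fixes f :: "(nat \<Rightarrow> real) \<Rightarrow> real"
  assumes \<theta>: "0 < \<theta>" "\<theta> \<le> 1 / 3"
    and N: "\<And>b. b \<in> N \<Longrightarrow> nrm k b = 1"
      "\<And>a. nrm k a = 1 \<Longrightarrow> \<exists>b\<in>N. nrm k (\<lambda>j. a j - b j) \<le> \<theta>"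
    and tri: "\<And>a b. f a \<le> f b + f (\<lambda>j. a j - b j)"
    and scale: "\<And>c a. f (\<lambda>j. c * a j) = \<bar>c\<bar> * f a"
    and cong: "\<And>a b. (\<And>j. j < k \<Longrightarrow> a j = b j) \<Longrightarrow> f a = f b"
    and bdd: "\<And>a. nrm k a = 1 \<Longrightarrow> f a \<le> C"
    and m: "m \<ge> 0" and near: "\<And>b. b \<in> N \<Longrightarrow> \<bar>f b - m\<bar> \<le> \<theta> * m"
    and a: "nrm k a = 1"
  shows "\<bar>f a - m\<bar> \<le> 3 * \<theta> * m"
proof -
  let ?S = "{a. nrm k a = 1}"
  define M where "M = (SUP a\<in>?S. f a)"
  have bd: "bdd_above (f ` ?S)" using bdd by (intro bdd_aboveI[of _ C]) auto
  have fM: "f b \<le> M" if "nrm k b = 1" for b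
    unfolding M_def using that bd by (intro cSUP_upper) auto
  have f0: "f (\<lambda>_. 0) = 0" using scale[of 0 "\<lambda>_. 0"] by simp
  have fneg: "f (\<lambda>j. - b j) = f b" for b using scale[of "-1" b] by simp
  have fge: "f b \<ge> 0" for b
    using tri[of "\<lambda>_. 0" b] f0 fneg[of b] by simp
  have fsc: "f b \<le> nrm k b * M" for b
  proof (cases "nrm k b = 0")
    case True
    then have "f b = f (\<lambda>_. 0)" by (intro cong) (simp add: L2_set_eq_0_iff)
    then show ?thesis using True f0 by simp
  next
    case False
    let ?r = "nrm k b"
    have r: "?r > 0" using False L2_set_nonneg[of b "{..<k}"] by linarith
    have "L2_set (\<lambda>j. (1 / ?r) * b j) {..<k} = (1 / ?r) * ?r"
      using r by (subst L2_set_right_distrib[symmetric]) auto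
    then have "f (\<lambda>j. (1 / ?r) * b j) \<le> M" using r by (intro fM) simp
    then have "(1 / ?r) * f b \<le> M" unfolding scale using r by simp
    then show ?thesis using r by (simp add: field_simps)
  qed
  have M0: "M \<ge> 0" using fM[OF a] fge[of a] by linarith
  have up: "f a \<le> (1 + \<theta>) * m + \<theta> * M" if a: "nrm k a = 1" for a
  proof -
    obtain b where b: "b \<in> N" "nrm k (\<lambda>j. a j - b j) \<le> \<theta>" using N(2)[OF a] by blast
    have "f a \<le> f b + f (\<lambda>j. a j - b j)" by (rule tri)
    also have "f (\<lambda>j. a j - b j) \<le> \<theta> * M"
      by (rule order_trans[OF fsc]) (use b M0 in \<open>auto intro: mult_right_mono\<close>)
    also have "f b \<le> (1 + \<theta>) * m" using near[OF b(1)] by (simp add: algebra_simps)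
    finally show ?thesis by simp
  qed
  have "M \<le> (1 + \<theta>) * m + \<theta> * M"
    unfolding M_def using a up by (intro cSUP_least) (auto simp: M_def)
  then have M1: "(1 - \<theta>) * M \<le> (1 + \<theta>) * m" by (simp add: algebra_simps)
  have "(1 - \<theta>) * (1 + 3 * \<theta>) = 1 + \<theta> + (\<theta> - 3 * \<theta>\<^sup>2)" by (simp add: power2_eq_square algebra_simps)
  moreover have t3: "3 * \<theta>\<^sup>2 \<le> \<theta>" using \<theta> by (simp add: power2_eq_square)
  ultimately have "(1 + \<theta>) \<le> (1 - \<theta>) * (1 + 3 * \<theta>)" by simp
  then have "(1 + \<theta>) * m \<le> (1 - \<theta>) * (1 + 3 * \<theta>) * m" using m by (intro mult_right_mono)
  with M1 have "(1 - \<theta>) * M \<le> (1 - \<theta>) * ((1 + 3 * \<theta>) * m)" by (simp add: mult.assoc)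
  then have M: "M \<le> (1 + 3 * \<theta>) * m" using \<theta> by (subst (asm) mult_le_cancel_left_pos) auto
  obtain b where b: "b \<in> N" "nrm k (\<lambda>j. a j - b j) \<le> \<theta>" using N(2)[OF a] by blast
  have "f b \<le> f a + f (\<lambda>j. b j - a j)" by (rule tri)
  also have "f (\<lambda>j. b j - a j) = f (\<lambda>j. a j - b j)" using fneg[of "\<lambda>j. a j - b j"] by simp
  also have "\<dots> \<le> \<theta> * M"
    by (rule order_trans[OF fsc]) (use b M0 in \<open>auto intro: mult_right_mono\<close>)
  also have "\<dots> \<le> \<theta> * ((1 + 3 * \<theta>) * m)" using M \<theta> by (intro mult_left_mono) auto
  also have "\<dots> = \<theta> * m + 3 * \<theta>\<^sup>2 * m" by (simp add: power2_eq_square algebra_simps)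
  also have "\<dots> \<le> \<theta> * m + \<theta> * m" using t3 m by (intro add_left_mono mult_right_mono) auto
  finally have "f b \<le> f a + 2 * (\<theta> * m)" by simp
  moreover have "f b \<ge> m - \<theta> * m" using near[OF b(1)] by linarith
  moreover have "f a \<le> m + 3 * \<theta> * m" using fM[OF a] M by (simp add: algebra_simps)
  ultimately show ?thesis by linarith
qed

lemma lp_norm_nonneg: "lp_norm n p x \<ge> 0"
  by (simp add: lp_norm_def)

lemma lp_norm_scale:
  assumes "p \<ge> 1"
  shows "lp_norm n p (\<lambda>i. c * x i) = \<bar>c\<bar> * lp_norm n p x"
proof -
  have "(\<Sum>i<n. \<bar>c * x i\<bar> powr p) = \<bar>c\<bar> powr p * (\<Sum>i<n. \<bar>x i\<bar> powr p)"
    by (simp add: abs_mult powr_mult sum_distrib_left)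
  then show ?thesis using assms by (simp add: lp_norm_def powr_mult powr_powr sum_nonneg)
qed

lemma lp_norm_mono:
  assumes "p \<ge> 1" "\<And>i. i < n \<Longrightarrow> \<bar>x i\<bar> \<le> \<bar>y i\<bar>"
  shows "lp_norm n p x \<le> lp_norm n p y"
  unfolding lp_norm_def using assms
  by (intro powr_mono2 sum_mono sum_nonneg) auto

lemma lp_norm_powr:
  assumes "p \<ge> 1"
  shows "lp_norm n p x powr p = (\<Sum>i<n. \<bar>x i\<bar> powr p)"
  using assms by (simp add: lp_norm_def powr_powr sum_nonneg)

lemma lp_norm_pow_sum_le_1:
  assumes "p \<ge> 1" "lp_norm n p x \<le> 1"
  shows "(\<Sum>i<n. \<bar>x i\<bar> powr p) \<le> 1"
  unfolding lp_norm_powr[OF assms(1), symmetric] using assms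
  by (intro powr_le1) (auto simp: lp_norm_nonneg)

lemma lp_norm_eq_0:
  assumes "p \<ge> 1" "lp_norm n p x = 0" "i < n"
  shows "x i = 0"
proof -
  have "(\<Sum>i<n. \<bar>x i\<bar> powr p) = 0" using lp_norm_powr[of p n x] assms by simp
  then have "\<bar>x i\<bar> powr p = 0" using assms by (subst (asm) sum_nonneg_eq_0_iff) auto
  then show ?thesis by simp
qed

lemma powr_convex_nonneg:
  fixes x y u p :: real
  assumes p: "p \<ge> 1" and xy: "x \<ge> 0" "y \<ge> 0" and u: "0 \<le> u" "u \<le> 1"
  shows "(u * x + (1 - u) * y) powr p \<le> u * x powr p + (1 - u) * y powr p"
proof -
  have pw: "v powr p \<le> v" if "0 \<le> v" "v \<le> 1" for v :: real
  proof (cases "v = 0")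
    case False
    then have "v powr p \<le> v powr 1" using that p by (intro powr_mono') auto
    then show ?thesis using that by simp
  qed simp
  consider "x = 0" | "y = 0" | "x > 0" "y > 0" using xy by linarith
  then show ?thesis
  proof cases
    case 1
    have "(1 - u) powr p * y powr p \<le> (1 - u) * y powr p"
      using pw[of "1 - u"] u by (intro mult_right_mono) auto
    then show ?thesis using 1 xy u p by (simp add: powr_mult)
  next
    case 2
    have "u powr p * x powr p \<le> u * x powr p"
      using pw[of u] u by (intro mult_right_mono) auto
    then show ?thesis using 2 xy u p by (simp add: powr_mult)
  next
    case 3
    then show ?thesis using convex_onD[OF powr_convex[OF p], of "1 - u" x y] u by simp
  qed
qed

text \<open>
  Minkowski's inequality: the unit ball is convex because \<open>x powr p\<close> is, and the norm is homogeneous.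
\<close>

lemma lp_norm_triangle:
  assumes p: "p \<ge> 1"
  shows "lp_norm n p (\<lambda>i. x i + y i) \<le> lp_norm n p x + lp_norm n p y"
proof -
  define \<alpha> where "\<alpha> = lp_norm n p x"
  define \<beta> where "\<beta> = lp_norm n p y"
  have ab: "\<alpha> \<ge> 0" "\<beta> \<ge> 0" by (auto simp: \<alpha>_def \<beta>_def lp_norm_nonneg)
  consider "\<alpha> = 0" | "\<beta> = 0" | "\<alpha> > 0" "\<beta> > 0" using ab by linarith
  then show ?thesis
  proof cases
    case 1
    then have "lp_norm n p (\<lambda>i. x i + y i) = lp_norm n p y"
      using lp_norm_eq_0[OF p, of n x] by (intro lp_norm_cong) (auto simp: \<alpha>_def)
    then show ?thesis using lp_norm_nonneg[of n p x] by simp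
  next
    case 2
    then have "lp_norm n p (\<lambda>i. x i + y i) = lp_norm n p x"
      using lp_norm_eq_0[OF p, of n y] by (intro lp_norm_cong) (auto simp: \<beta>_def)
    then show ?thesis using lp_norm_nonneg[of n p y] by simp
  next
    case 3
    define u where "u = \<alpha> / (\<alpha> + \<beta>)"
    have u: "0 \<le> u" "u \<le> 1" "1 - u = \<beta> / (\<alpha> + \<beta>)" using 3 by (auto simp: u_def field_simps)
    have s: "(\<Sum>i<n. \<bar>x i / \<alpha>\<bar> powr p) \<le> 1" "(\<Sum>i<n. \<bar>y i / \<beta>\<bar> powr p) \<le> 1"
      using lp_norm_scale[OF p, of n "1 / \<alpha>" x] lp_norm_scale[OF p, of n "1 / \<beta>" y] 3
      by (intro lp_norm_pow_sum_le_1[OF p]; simp add: \<alpha>_def \<beta>_def)+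
    have "(\<Sum>i<n. \<bar>(x i + y i) / (\<alpha> + \<beta>)\<bar> powr p)
      \<le> (\<Sum>i<n. u * \<bar>x i / \<alpha>\<bar> powr p + (1 - u) * \<bar>y i / \<beta>\<bar> powr p)"
    proof (rule sum_mono)
      fix i
      have "\<alpha> \<noteq> 0" "\<beta> \<noteq> 0" "\<alpha> + \<beta> \<noteq> 0" using 3 by auto
      then have "(x i + y i) / (\<alpha> + \<beta>) = u * (x i / \<alpha>) + (1 - u) * (y i / \<beta>)"
        unfolding u(3) by (simp add: u_def add_divide_distrib)
      then have "\<bar>(x i + y i) / (\<alpha> + \<beta>)\<bar> \<le> \<bar>u * (x i / \<alpha>)\<bar> + \<bar>(1 - u) * (y i / \<beta>)\<bar>"
        using abs_triangle_ineq[of "u * (x i / \<alpha>)" "(1 - u) * (y i / \<beta>)"] by simp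
      also have "\<dots> = u * \<bar>x i / \<alpha>\<bar> + (1 - u) * \<bar>y i / \<beta>\<bar>"
        unfolding abs_mult using u(1,2) by simp
      finally have "\<bar>(x i + y i) / (\<alpha> + \<beta>)\<bar> powr p \<le> (u * \<bar>x i / \<alpha>\<bar> + (1 - u) * \<bar>y i / \<beta>\<bar>) powr p"
        using p by (intro powr_mono2) auto
      also have "\<dots> \<le> u * \<bar>x i / \<alpha>\<bar> powr p + (1 - u) * \<bar>y i / \<beta>\<bar> powr p"
        using p u by (intro powr_convex_nonneg) auto
      finally show "\<bar>(x i + y i) / (\<alpha> + \<beta>)\<bar> powr p \<le> u * \<bar>x i / \<alpha>\<bar> powr p + (1 - u) * \<bar>y i / \<beta>\<bar> powr p" .
    qed
    also have "\<dots> = u * (\<Sum>i<n. \<bar>x i / \<alpha>\<bar> powr p) + (1 - u) * (\<Sum>i<n. \<bar>y i / \<beta>\<bar> powr p)"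
      by (simp add: sum.distrib sum_distrib_left)
    also have "\<dots> \<le> u * 1 + (1 - u) * 1" using s u by (intro add_mono mult_left_mono) auto
    finally have "(\<Sum>i<n. \<bar>(x i + y i) / (\<alpha> + \<beta>)\<bar> powr p) \<le> 1" by simp
    then have "lp_norm n p (\<lambda>i. (x i + y i) / (\<alpha> + \<beta>)) \<le> 1"
      unfolding lp_norm_def using p by (intro powr_le1) (simp_all add: abs_of_nonneg sum_nonneg)
    then have "lp_norm n p (\<lambda>i. (1 / (\<alpha> + \<beta>)) * (x i + y i)) \<le> 1" by simp
    then have "(1 / (\<alpha> + \<beta>)) * lp_norm n p (\<lambda>i. x i + y i) \<le> 1"
      unfolding lp_norm_scale[OF p] using 3 by simp
    then show ?thesis using 3 by (simp add: \<alpha>_def \<beta>_def field_simps)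
  qed
qed

lemma lp_norm_2: "lp_norm n 2 x = nrm n x"
  by (simp add: lp_norm_def L2_set_def powr_half_sqrt sum_nonneg powr_numeral)

section \<open>Orthonormal bases, projections and reflections\<close>

lemma inner_n_commute: "inner_n n x y = inner_n n y x"
  by (simp add: inner_n_def mult.commute)

lemma inner_n_add: "inner_n n (x + y) z = inner_n n x z + inner_n n y z"
  "inner_n n z (x + y) = inner_n n z x + inner_n n z y"
  by (simp_all add: inner_n_def algebra_simps sum.distrib)

lemma inner_n_diff: "inner_n n (x - y) z = inner_n n x z - inner_n n y z"
  "inner_n n z (x - y) = inner_n n z x - inner_n n z y"
  by (simp_all add: inner_n_def algebra_simps sum_subtractf)

lemma inner_n_scale: "inner_n n (fscale c x) z = c * inner_n n x z"
  "inner_n n z (fscale c x) = c * inner_n n z x"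
  by (simp_all add: inner_n_def fscale_def algebra_simps sum_distrib_left)

lemma inner_n_0: "inner_n n 0 z = 0" "inner_n n z 0 = 0"
  by (simp_all add: inner_n_def)

lemma inner_n_sum: "inner_n n (\<Sum>j\<in>A. f j) z = (\<Sum>j\<in>A. inner_n n (f j) z)"
  "inner_n n z (\<Sum>j\<in>A. f j) = (\<Sum>j\<in>A. inner_n n z (f j))"
  by (induction A rule: infinite_finite_induct) (simp_all add: inner_n_0 inner_n_add)

lemma inner_n_self: "inner_n n x x = (nrm n x)\<^sup>2"
  by (simp add: inner_n_def L2_set_def sum_nonneg power2_eq_square)

lemma nrm_0_iff: "x \<in> Rn n \<Longrightarrow> nrm n x = 0 \<longleftrightarrow> x = 0"
  by (auto simp: L2_set_eq_0_iff Rn_def fun_eq_iff) (metis lessThan_iff not_le)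

lemma nrm_pos: "x \<in> Rn n \<Longrightarrow> x \<noteq> 0 \<Longrightarrow> nrm n x > 0"
  using nrm_0_iff[of x n] L2_set_nonneg[of x "{..<n}"] by (simp add: less_eq_real_def)

lemma nrm_triangle: "nrm n (x + y) \<le> nrm n x + nrm n y"
  using L2_set_triangle_ineq[of x y "{..<n}"] by (simp add: plus_fun_def)

lemma nrm_scale: "nrm n (fscale c x) = \<bar>c\<bar> * nrm n x"
  using lp_norm_scale[of 2 n c x] by (simp add: fscale_def lp_norm_2)

lemma nrm_minus_commute: "nrm n (x - y) = nrm n (y - x)"
  by (simp add: L2_set_def power2_commute)

lemma subspace_Rn: "fvec.subspace (Rn n)"
  by (auto simp: fvec.subspace_def Rn_def fscale_def)

text \<open>
  Families indexed by \<open>{..<k}\<close> rather than sets of vectors, so that the coefficients of a combination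
  can be compared between a family and its images.
\<close>

definition lincomb :: "nat \<Rightarrow> (nat \<Rightarrow> nat \<Rightarrow> real) \<Rightarrow> (nat \<Rightarrow> real) \<Rightarrow> nat \<Rightarrow> real" where
  "lincomb k u a = (\<Sum>j<k. fscale (a j) (u j))"

lemma lincomb_apply: "lincomb k u a i = (\<Sum>j<k. a j * u j i)"
proof -
  have "(\<Sum>j\<in>A. fscale (a j) (u j)) i = (\<Sum>j\<in>A. a j * u j i)" for A :: "nat set"
    by (induction A rule: infinite_finite_induct) (simp_all add: fscale_def)
  then show ?thesis by (simp add: lincomb_def)
qed

definition lin_indep :: "nat \<Rightarrow> (nat \<Rightarrow> nat \<Rightarrow> real) \<Rightarrow> bool" where
  "lin_indep k u \<longleftrightarrow> (\<forall>a. lincomb k u a = 0 \<longrightarrow> (\<forall>j<k. a j = 0))"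

lemma lin_indep_span:
  assumes u: "lin_indep k u"
  shows "inj_on u {..<k}" "fvec.independent (u ` {..<k})"
    "range (lincomb k u) = fvec.span (u ` {..<k})" "fvec.dim (range (lincomb k u)) = k"
proof -
  show inj: "inj_on u {..<k}"
  proof (rule inj_onI, rule ccontr)
    fix i j assume ij: "i \<in> {..<k}" "j \<in> {..<k}" "u i = u j" "i \<noteq> j"
    define a where "a l = (if l = i then 1 else if l = j then - 1 else 0 :: real)" for l
    have "lincomb k u a = (\<Sum>l\<in>{i, j}. fscale (a l) (u l))"
      unfolding lincomb_def using ij by (intro sum.mono_neutral_right) (auto simp: a_def fscale_def fun_eq_iff)
    also have "\<dots> = 0" using ij by (simp add: a_def fscale_def fun_eq_iff)
    finally have "a i = 0" using u ij unfolding lin_indep_def by blast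
    then show False by (simp add: a_def)
  qed
  have s: "(\<Sum>v\<in>u ` {..<k}. fscale (c v) v) = lincomb k u (\<lambda>j. c (u j))" for c
    unfolding lincomb_def using inj by (simp add: sum.reindex)
  show ind: "fvec.independent (u ` {..<k})"
  proof (rule fvec.independent_if_scalars_zero)
    fix c x assume "(\<Sum>v\<in>u ` {..<k}. fscale (c v) v) = 0" "x \<in> u ` {..<k}"
    then show "c x = 0" using u unfolding s lin_indep_def by auto
  qed simp
  show sp: "range (lincomb k u) = fvec.span (u ` {..<k})"
  proof -
    have "lincomb k u a = (\<Sum>v\<in>u ` {..<k}. fscale (a (the_inv_into {..<k} u v)) v)" for a
      unfolding s lincomb_def using inj by (intro sum.cong) (auto simp: the_inv_into_f_f)
    then have "lincomb k u a \<in> range (\<lambda>c. \<Sum>v\<in>u ` {..<k}. fscale (c v) v)" for a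
      by (rule range_eqI)
    moreover have "(\<Sum>v\<in>u ` {..<k}. fscale (c v) v) \<in> range (lincomb k u)" for c
      unfolding s by (rule rangeI)
    ultimately show ?thesis unfolding fvec.span_finite[OF finite_imageI[OF finite_lessThan]] by blast
  qed
  show "fvec.dim (range (lincomb k u)) = k"
    unfolding sp fvec.dim_span_eq_card_independent[OF ind] using inj by (simp add: card_image)
qed

lemma lin_indep_Grassmannian:
  assumes "lin_indep k u" "\<And>j. j < k \<Longrightarrow> u j \<in> Rn n"
  shows "range (lincomb k u) \<in> Grassmannian n k"
proof -
  have "lincomb k u a \<in> Rn n" for a
    using assms(2) by (auto simp: Rn_def lincomb_apply)
  then have "range (lincomb k u) \<subseteq> Rn n" by blast
  then show ?thesis
    using lin_indep_span(4)[OF assms(1)] fvec.subspace_span[of "u ` {..<k}"]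
    unfolding lin_indep_span(3)[OF assms(1)] by (simp add: Grassmannian_def)
qed

text \<open>
  A vector outside the span would give \<open>k + 1\<close> independent vectors in a space spanned by \<open>k\<close> vectors.
\<close>

lemma Grassmannian_lin_indep_spans:
  assumes E: "E \<in> Grassmannian n k" and k: "0 < k" and u: "lin_indep k u" "\<And>j. j < k \<Longrightarrow> u j \<in> E"
  shows "E = range (lincomb k u)"
proof -
  have sub: "fvec.subspace E" and dim: "fvec.dim E = k" using E by (auto simp: Grassmannian_def)
  obtain B where B: "B \<subseteq> E" "fvec.independent B" "E \<subseteq> fvec.span B" "card B = fvec.dim E"
    by (rule fvec.basis_exists)
  have fB: "finite B" using B dim k by (intro card_ge_0_finite) simp
  let ?S = "u ` {..<k}"
  note s = lin_indep_span[OF u(1)]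
  have SE: "?S \<subseteq> E" using u by auto
  have "E \<subseteq> fvec.span ?S"
  proof
    fix x assume x: "x \<in> E"
    show "x \<in> fvec.span ?S"
    proof (rule ccontr)
      assume nx: "x \<notin> fvec.span ?S"
      then have "fvec.independent (insert x ?S)" using s(2) by (intro fvec.independent_insertI) auto
      moreover have "insert x ?S \<subseteq> fvec.span B" using x SE B(3) by blast
      ultimately have "card (insert x ?S) \<le> card B" using fvec.independent_span_bound[OF fB] by blast
      moreover have "x \<notin> ?S" by (rule contrapos_nn[OF nx]) (rule fvec.span_base)
      ultimately show False using B dim s(1) by (simp add: card_image)
    qed
  qed
  moreover have "fvec.span ?S \<subseteq> E" using SE sub by (rule fvec.span_minimal)
  ultimately show ?thesis using s(3) by auto
qed

definition orthonormal :: "nat \<Rightarrow> nat \<Rightarrow> (nat \<Rightarrow> nat \<Rightarrow> real) \<Rightarrow> bool" where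
  "orthonormal n k u \<longleftrightarrow> (\<forall>i<k. u i \<in> Rn n) \<and>
     (\<forall>i<k. \<forall>j<k. inner_n n (u i) (u j) = (if i = j then 1 else 0))"

lemma inner_lincomb: "inner_n n (lincomb k u a) z = (\<Sum>j<k. a j * inner_n n (u j) z)"
  by (simp add: lincomb_def inner_n_sum inner_n_scale)

lemma orthonormal_inner:
  assumes "orthonormal n k u" "i < k"
  shows "inner_n n (lincomb k u a) (u i) = a i"
proof -
  have "inner_n n (lincomb k u a) (u i) = (\<Sum>j<k. if j = i then a j else 0)"
    unfolding inner_lincomb using assms by (intro sum.cong) (auto simp: orthonormal_def)
  then show ?thesis using assms by simp
qed

lemma orthonormal_inner':
  "orthonormal n k u \<Longrightarrow> i < k \<Longrightarrow> inner_n n (u i) (lincomb k u a) = a i"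
  using orthonormal_inner by (simp add: inner_n_commute)

lemma orthonormal_residual:
  assumes u: "orthonormal n k u"
  shows "inner_n n (x - lincomb k u (\<lambda>j. inner_n n x (u j))) (lincomb k u a) = 0"
proof -
  let ?y = "lincomb k u (\<lambda>j. inner_n n x (u j))"
  have "inner_n n (lincomb k u a) (x - ?y) = (\<Sum>j<k. a j * inner_n n (u j) (x - ?y))"
    by (rule inner_lincomb)
  also have "\<dots> = 0"
    by (intro sum.neutral ballI) (simp add: inner_n_diff(2) orthonormal_inner'[OF u] inner_n_commute)
  finally show ?thesis by (simp add: inner_n_commute)
qed

lemma orthonormal_lin_indep:
  assumes u: "orthonormal n k u"
  shows "lin_indep k u"
  unfolding lin_indep_def using orthonormal_inner[OF u] by (metis inner_n_0(1))

text \<open>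
  Take an orthonormal family in \<open>E\<close> of maximal length; a vector outside its span would extend it by one
  Gram-Schmidt step.
\<close>

lemma orthonormal_basis:
  assumes E: "E \<in> Grassmannian n k" and k: "0 < k"
  obtains u where "orthonormal n k u" "E = range (lincomb k u)"
proof -
  have sub: "fvec.subspace E" and dim: "fvec.dim E = k" and ER: "E \<subseteq> Rn n"
    using E by (auto simp: Grassmannian_def)
  obtain B where B: "B \<subseteq> E" "fvec.independent B" "E \<subseteq> fvec.span B" "card B = fvec.dim E"
    by (rule fvec.basis_exists)
  have fB: "finite B" using B dim k by (intro card_ge_0_finite) simp
  let ?P = "\<lambda>r. \<exists>u. orthonormal n r u \<and> (\<forall>j<r. u j \<in> E)"
  have bound: "r \<le> k" if P: "?P r" for r
  proof -
    obtain u where u: "orthonormal n r u" "\<forall>j<r. u j \<in> E" using P by blast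
    note s = lin_indep_span[OF orthonormal_lin_indep[OF u(1)]]
    have "card (u ` {..<r}) \<le> card B"
      using fvec.independent_span_bound[OF fB s(2)] u B by auto
    then show ?thesis using s(1) B dim by (simp add: card_image)
  qed
  have "?P 0" by (auto simp: orthonormal_def)
  then obtain r where r: "?P r" "\<And>s. ?P s \<Longrightarrow> s \<le> r"
    using GreatestI_nat[of ?P 0 k] Greatest_le_nat[of ?P _ k] bound by blast
  then obtain u where u: "orthonormal n r u" "\<And>j. j < r \<Longrightarrow> u j \<in> E" by blast
  have cE: "lincomb r u a \<in> E" for a
    unfolding lincomb_def using u by (intro fvec.subspace_sum fvec.subspace_scale sub) auto
  have "E \<subseteq> range (lincomb r u)"
  proof
    fix x assume x: "x \<in> E"
    show "x \<in> range (lincomb r u)"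
    proof (rule ccontr)
      assume nx: "x \<notin> range (lincomb r u)"
      define y where "y = lincomb r u (\<lambda>j. inner_n n x (u j))"
      define z where "z = x - y"
      have zE: "z \<in> E" unfolding z_def y_def using x cE sub by (intro fvec.subspace_diff)
      have "z \<noteq> 0" using nx unfolding z_def y_def by auto
      then have z0: "nrm n z > 0" using zE ER by (intro nrm_pos) auto
      have zu: "inner_n n z (u i) = 0" if "i < r" for i
        unfolding z_def y_def inner_n_diff orthonormal_inner[OF u(1) that] by simp
      define w where "w = fscale (1 / nrm n z) z"
      have w: "w \<in> E" unfolding w_def using zE sub by (intro fvec.subspace_scale)
      have ww: "inner_n n w w = 1" unfolding w_def inner_n_self nrm_scale using z0
        by (simp add: power2_eq_square)
      have wu: "inner_n n w (u i) = 0" "inner_n n (u i) w = 0" if "i < r" for i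
        using zu[OF that] by (auto simp: w_def inner_n_scale inner_n_commute[of n "u i"])
      let ?u = "\<lambda>j. if j < r then u j else w"
      have "?P (Suc r)"
      proof (intro exI[of _ ?u] conjI)
        show "orthonormal n (Suc r) ?u"
          using u(1) w ER ww wu unfolding orthonormal_def by (auto simp: less_Suc_eq)
        show "\<forall>j<Suc r. ?u j \<in> E" using u(2) w by auto
      qed
      then have "Suc r \<le> r" by (rule r(2))
      then show False by simp
    qed
  qed
  then have eq: "E = range (lincomb r u)" using cE by auto
  have "r = k" using lin_indep_span(4)[OF orthonormal_lin_indep[OF u(1)]] dim eq by simp
  then show thesis using that u(1) eq by blast
qed

lemma orthonormal_Grassmannian:
  "orthonormal n k u \<Longrightarrow> range (lincomb k u) \<in> Grassmannian n k"
  by (intro lin_indep_Grassmannian orthonormal_lin_indep) (auto simp: orthonormal_def)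

lemma orth_proj_eq:
  assumes u: "orthonormal n k u"
  shows "orth_proj n (range (lincomb k u)) x = lincomb k u (\<lambda>j. inner_n n x (u j))"
  unfolding orth_proj_def
proof (rule the_equality)
  let ?y = "lincomb k u (\<lambda>j. inner_n n x (u j))"
  show "?y \<in> range (lincomb k u) \<and> (\<forall>z\<in>range (lincomb k u). inner_n n (x - ?y) z = 0)"
  proof (intro conjI ballI)
    fix z assume "z \<in> range (lincomb k u)"
    then show "inner_n n (x - ?y) z = 0" using orthonormal_residual[OF u] by auto
  qed simp
  fix y assume y: "y \<in> range (lincomb k u) \<and> (\<forall>z\<in>range (lincomb k u). inner_n n (x - y) z = 0)"
  then obtain a where a: "y = lincomb k u a" by blast
  have "a j = inner_n n x (u j)" if j: "j < k" for j
  proof -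
    have "u j = lincomb k u (\<lambda>l. if l = j then 1 else 0)"
      using j by (simp add: fun_eq_iff lincomb_apply if_distrib[of "\<lambda>c. c * _"] cong: if_cong)
    then have "inner_n n (x - y) (u j) = 0" using y by (metis rangeI)
    then show ?thesis unfolding inner_n_diff a orthonormal_inner[OF u j] by simp
  qed
  then show "y = ?y" unfolding a by (auto simp: lincomb_def intro!: sum.cong)
qed

lemma proj_matrix_eq:
  assumes u: "orthonormal n k u"
  shows "proj_matrix n (range (lincomb k u)) i j = (\<Sum>l<k. u l i * u l j)"
proof -
  have "inner_n n (\<lambda>l. if l = j then 1 else 0) (u l) = u l j" if "l < k" for l
    using u that by (auto simp: inner_n_def orthonormal_def Rn_def if_distrib[of "\<lambda>c. c * _"] cong: if_cong)
  then show ?thesis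
    by (simp add: proj_matrix_def orth_proj_eq[OF u] lincomb_apply mult.commute)
qed

text \<open>
  The entries of the projection matrix generate the \<open>\<sigma>\<close>-algebra of the Grassmannian, so this formula is
  what makes quantities defined through projections measurable.
\<close>

lemma orth_proj_matrix:
  assumes E: "E \<in> Grassmannian n k" and k: "0 < k"
  shows "orth_proj n E x i = (\<Sum>j<n. proj_matrix n E i j * x j)"
proof -
  obtain u where u: "orthonormal n k u" "E = range (lincomb k u)" using orthonormal_basis[OF E k] .
  have "orth_proj n E x i = (\<Sum>l<k. (\<Sum>j<n. x j * u l j) * u l i)"
    unfolding u(2) orth_proj_eq[OF u(1)] lincomb_apply inner_n_def ..
  also have "\<dots> = (\<Sum>j<n. \<Sum>l<k. x j * u l j * u l i)"
    by (subst sum.swap) (simp add: sum_distrib_right)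
  also have "\<dots> = (\<Sum>j<n. proj_matrix n E i j * x j)"
    unfolding u(2) proj_matrix_eq[OF u(1)] by (simp add: sum_distrib_left sum_distrib_right mult_ac)
  finally show ?thesis .
qed

lemma orth_proj_props:
  assumes E: "E \<in> Grassmannian n k" and k: "0 < k"
  shows "orth_proj n E x \<in> E" "z \<in> E \<Longrightarrow> inner_n n (x - orth_proj n E x) z = 0"
    "x \<in> E \<Longrightarrow> orth_proj n E x = x"
    "z \<in> E \<Longrightarrow> nrm n (x - orth_proj n E x) \<le> nrm n (x - z)"
proof -
  obtain u where u: "orthonormal n k u" "E = range (lincomb k u)" using orthonormal_basis[OF E k] .
  show m: "orth_proj n E x \<in> E" for x unfolding u(2) orth_proj_eq[OF u(1)] by simp
  show o: "inner_n n (x - orth_proj n E x) z = 0" if z: "z \<in> E" for x z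
    using z orthonormal_residual[OF u(1)] unfolding u(2) orth_proj_eq[OF u(1)] by auto
  have sub: "fvec.subspace E" and ER: "E \<subseteq> Rn n" using E by (auto simp: Grassmannian_def)
  show le: "nrm n (x - orth_proj n E x) \<le> nrm n (x - z)" if z: "z \<in> E" for x z
  proof -
    define d where "d = orth_proj n E x - z"
    define e where "e = x - orth_proj n E x"
    have "d \<in> E" unfolding d_def using m z sub by (intro fvec.subspace_diff)
    then have "inner_n n e d = 0" unfolding e_def by (rule o)
    moreover have "x - z = e + d" by (simp add: d_def e_def)
    ultimately have "(nrm n (x - z))\<^sup>2 = (nrm n e)\<^sup>2 + (nrm n d)\<^sup>2"
      unfolding inner_n_self[symmetric] by (simp add: inner_n_add inner_n_commute[of n d e])
    then have "(nrm n e)\<^sup>2 \<le> (nrm n (x - z))\<^sup>2" by simp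
    then show ?thesis unfolding e_def by (rule power2_le_imp_le) simp
  qed
  show "orth_proj n E x = x" if "x \<in> E"
  proof -
    have "nrm n (x - orth_proj n E x) \<le> nrm n (x - x)" by (rule le[OF that])
    also have "nrm n (x - x) = 0" by (simp add: L2_set_def)
    finally have "nrm n (x - orth_proj n E x) = 0" using L2_set_nonneg[of "x - orth_proj n E x" "{..<n}"] by linarith
    moreover have "x - orth_proj n E x \<in> Rn n" using ER that m sub fvec.subspace_diff[OF sub] by blast
    ultimately show ?thesis by (simp add: nrm_0_iff)
  qed
qed

definition reflection :: "nat \<Rightarrow> (nat \<Rightarrow> real) \<Rightarrow> (nat \<Rightarrow> real) \<Rightarrow> nat \<Rightarrow> real" where
  "reflection n v x = x - fscale (2 * inner_n n v x) v"

lemma reflection_linear: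
  "reflection n v (x + y) = reflection n v x + reflection n v y"
  "reflection n v (x - y) = reflection n v x - reflection n v y"
  "reflection n v (fscale c x) = fscale c (reflection n v x)"
  by (auto simp: reflection_def inner_n_add inner_n_diff inner_n_scale fun_eq_iff)
    (auto simp: fscale_def algebra_simps)

lemma reflection_lincomb: "reflection n v (lincomb k u a) = lincomb k (\<lambda>j. reflection n v (u j)) a"
proof -
  have "reflection n v 0 = 0" by (simp add: reflection_def inner_n_0 fscale_def fun_eq_iff)
  then have "reflection n v (\<Sum>j\<in>A. fscale (a j) (u j)) = (\<Sum>j\<in>A. fscale (a j) (reflection n v (u j)))" for A :: "nat set"
    by (induction A rule: infinite_finite_induct) (simp_all add: reflection_linear)
  then show ?thesis by (simp add: lincomb_def)
qed

lemma reflection_Rn: "v \<in> Rn n \<Longrightarrow> x \<in> Rn n \<Longrightarrow> reflection n v x \<in> Rn n"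
  by (auto simp: reflection_def Rn_def fscale_def)

lemma reflection_adjoint: "inner_n n (reflection n v x) y = inner_n n x (reflection n v y)"
  by (simp add: reflection_def inner_n_diff inner_n_scale inner_n_commute mult_ac)

lemma reflection_involution:
  assumes "inner_n n v v = 1"
  shows "reflection n v (reflection n v x) = x"
proof -
  have "inner_n n v (reflection n v x) = - inner_n n v x"
    using assms by (simp add: reflection_def inner_n_diff inner_n_scale)
  then show ?thesis by (simp add: reflection_def[of n v "reflection n v x"]) (simp add: reflection_def fscale_def fun_eq_iff)
qed

lemma reflection_inner:
  assumes "inner_n n v v = 1"
  shows "inner_n n (reflection n v x) (reflection n v y) = inner_n n x y"
  using assms by (simp add: reflection_adjoint reflection_involution)

lemma reflection_nrm: "inner_n n v v = 1 \<Longrightarrow> nrm n (reflection n v x) = nrm n x"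
  using reflection_inner[of n v x x] unfolding inner_n_self by simp

lemma rotation_reflection:
  assumes "v \<in> Rn n" "inner_n n v v = 1"
  shows "rotation n (reflection n v)"
proof -
  have "Vector_Spaces.linear fscale fscale (reflection n v)"
    by unfold_locales (auto simp: reflection_linear)
  then show ?thesis unfolding rotation_def using reflection_Rn[OF assms(1)] reflection_inner[OF assms(2)] by auto
qed

lemma orthonormal_reflection:
  assumes "v \<in> Rn n" "inner_n n v v = 1" "orthonormal n k u"
  shows "orthonormal n k (\<lambda>j. reflection n v (u j))"
  using assms by (auto simp: orthonormal_def reflection_Rn reflection_inner)

lemma reflection_image_lincomb:
  "reflection n v ` range (lincomb k u) = range (lincomb k (\<lambda>j. reflection n v (u j)))"
  unfolding image_image reflection_lincomb ..

lemma reflection_Grassmannian: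
  assumes v: "v \<in> Rn n" "inner_n n v v = 1" and E: "E \<in> Grassmannian n k" and k: "0 < k"
  shows "reflection n v ` E \<in> Grassmannian n k"
  using orthonormal_basis[OF E k] orthonormal_reflection[OF v] orthonormal_Grassmannian reflection_image_lincomb
  by metis

text \<open>
  Reflections act transitively: starting from an orthonormal basis \<open>u\<close> of \<open>E\<close>, the reflection in the
  direction of \<open>u\<^sub>j - w\<^sub>j\<close> moves \<open>u\<^sub>j\<close> to \<open>w\<^sub>j\<close> and fixes the vectors \<open>w\<^sub>i\<close> with \<open>i < j\<close> that have been
  reached before.
\<close>

lemma reflection_invariant_constant:
  fixes f :: "(nat \<Rightarrow> real) set \<Rightarrow> 'b"
  assumes k: "0 < k" and E: "E \<in> Grassmannian n k" and F: "F \<in> Grassmannian n k"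
    and inv: "\<And>E v. E \<in> Grassmannian n k \<Longrightarrow> v \<in> Rn n \<Longrightarrow> inner_n n v v = 1 \<Longrightarrow> f (reflection n v ` E) = f E"
  shows "f E = f F"
proof -
  obtain u where u: "orthonormal n k u" "E = range (lincomb k u)" using orthonormal_basis[OF E k] .
  obtain w where w: "orthonormal n k w" "F = range (lincomb k w)" using orthonormal_basis[OF F k] .
  have "\<exists>u'. orthonormal n k u' \<and> (\<forall>i<j. u' i = w i) \<and> f (range (lincomb k u')) = f E" if "j \<le> k" for j
    using that
  proof (induction j)
    case 0
    then show ?case using u by auto
  next
    case (Suc j)
    then obtain u' where u': "orthonormal n k u'" "\<forall>i<j. u' i = w i" "f (range (lincomb k u')) = f E" by auto
    have j: "j < k" using Suc by simp
    show ?case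
    proof (cases "u' j = w j")
      case True
      then show ?thesis using u' by (auto simp: less_Suc_eq)
    next
      case False
      define z where "z = u' j - w j"
      have uR: "u' i \<in> Rn n" "w i \<in> Rn n" if "i < k" for i using u' w that by (auto simp: orthonormal_def)
      have zR: "z \<in> Rn n" unfolding z_def using uR[OF j] by (intro fvec.subspace_diff subspace_Rn)
      have "z \<noteq> 0" using False by (simp add: z_def)
      then have z0: "nrm n z > 0" using zR by (intro nrm_pos)
      define v where "v = fscale (1 / nrm n z) z"
      have v: "v \<in> Rn n" "inner_n n v v = 1"
        unfolding v_def using zR z0
        by (auto intro!: fvec.subspace_scale subspace_Rn simp: inner_n_self nrm_scale power2_eq_square)
      have self: "inner_n n (u' j) (u' j) = 1" "inner_n n (w j) (w j) = 1"
        using u' w j by (auto simp: orthonormal_def)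
      have zz: "(nrm n z)\<^sup>2 = 2 * inner_n n z (u' j)"
        unfolding inner_n_self[symmetric] using self by (simp add: z_def inner_n_diff inner_n_commute)
      have "reflection n v (u' j) = u' j - fscale (2 * inner_n n z (u' j) / (nrm n z)\<^sup>2) z"
      proof -
        have "inner_n n v (u' j) = inner_n n z (u' j) / nrm n z" by (simp add: v_def inner_n_scale)
        then show ?thesis by (simp add: reflection_def v_def fscale_def fun_eq_iff power2_eq_square)
      qed
      also have "2 * inner_n n z (u' j) / (nrm n z)\<^sup>2 = 1" unfolding zz[symmetric] using z0 by simp
      also have "u' j - fscale 1 z = w j" by (simp add: z_def)
      finally have rj: "reflection n v (u' j) = w j" .
      have ri: "reflection n v (u' i) = w i" if "i < j" for i
      proof -
        have "inner_n n (u' j) (u' i) = 0" using u'(1) j that by (auto simp: orthonormal_def)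
        moreover have "inner_n n (w j) (u' i) = 0" using u' w j that by (auto simp: orthonormal_def)
        ultimately have "inner_n n v (u' i) = 0" by (simp add: v_def z_def inner_n_scale inner_n_diff)
        then show ?thesis using u'(2) that by (simp add: reflection_def)
      qed
      show ?thesis
      proof (intro exI[of _ "\<lambda>i. reflection n v (u' i)"] conjI)
        show "orthonormal n k (\<lambda>i. reflection n v (u' i))" by (rule orthonormal_reflection[OF v u'(1)])
        show "\<forall>i<Suc j. reflection n v (u' i) = w i" using rj ri by (auto simp: less_Suc_eq)
        show "f (range (lincomb k (\<lambda>i. reflection n v (u' i)))) = f E"
          using inv[OF orthonormal_Grassmannian[OF u'(1)] v] u'(3) reflection_image_lincomb by metis
      qed
    qed
  qed
  from this[of k] obtain u' where "\<forall>i<k. u' i = w i" "f (range (lincomb k u')) = f E" by auto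
  moreover from this have "lincomb k u' = lincomb k w" by (auto simp: lincomb_apply fun_eq_iff)
  ultimately show ?thesis using w by simp
qed

section \<open>From Gaussian matrices to uniform subspaces\<close>

definition column :: "nat \<Rightarrow> (nat \<times> nat \<Rightarrow> real) \<Rightarrow> nat \<Rightarrow> nat \<Rightarrow> real" where
  "column n Y j = (\<lambda>i. if i < n then Y (i, j) else 0)"

lemma comb_lincomb: "comb n k a Y = lincomb k (column n Y) a"
  by (auto simp: fun_eq_iff comb_def lincomb_apply column_def)

text \<open>
  A quantitative form of linear independence of the columns. With a fixed constant it is a closed
  condition, hence measurable, and it is implied by the near isometry property below.
\<close>

definition well_cond :: "nat \<Rightarrow> nat \<Rightarrow> real \<Rightarrow> (nat \<times> nat \<Rightarrow> real) \<Rightarrow> bool" where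
  "well_cond n k \<beta> Y \<longleftrightarrow> (\<forall>a. \<beta> * nrm k a \<le> nrm n (comb n k a Y))"

definition close_to :: "nat \<Rightarrow> real \<Rightarrow> (nat \<Rightarrow> real) set \<Rightarrow> (nat \<Rightarrow> real) set \<Rightarrow> bool" where
  "close_to n t F E \<longleftrightarrow> (\<forall>y\<in>F. \<exists>x\<in>E. nrm n (y - x) \<le> t * nrm n y)"

definition colspan :: "nat \<Rightarrow> nat \<Rightarrow> (nat \<times> nat \<Rightarrow> real) \<Rightarrow> (nat \<Rightarrow> real) set" where
  "colspan n k Y = range (\<lambda>a. comb n k a Y)"

lemma colspan_lincomb: "colspan n k Y = range (lincomb k (column n Y))"
  by (simp add: colspan_def comb_lincomb)

lemma well_cond_lin_indep:
  assumes "well_cond n k \<beta> Y" "\<beta> > 0"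
  shows "lin_indep k (column n Y)"
  unfolding lin_indep_def
proof (intro allI impI)
  fix a j assume a: "lincomb k (column n Y) a = 0" and j: "j < k"
  have "\<beta> * nrm k a \<le> 0"
    using assms(1) a unfolding well_cond_def comb_lincomb[symmetric] by (metis L2_set_0' zero_fun_apply)
  then have "nrm k a = 0" using assms(2) L2_set_nonneg[of a "{..<k}"] by (simp add: mult_le_0_iff)
  then show "a j = 0" using j by (simp add: L2_set_eq_0_iff)
qed

lemma well_cond_Grassmannian:
  assumes "well_cond n k \<beta> Y" "\<beta> > 0"
  shows "colspan n k Y \<in> Grassmannian n k"
  unfolding colspan_lincomb
  by (intro lin_indep_Grassmannian well_cond_lin_indep[OF assms]) (simp add: column_def Rn_def)

definition ratvec :: "nat \<Rightarrow> (nat \<Rightarrow> real) set" where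
  "ratvec k = {..<k} \<rightarrow>\<^sub>E \<rat>"

lemma countable_ratvec: "countable (ratvec k)"
  unfolding ratvec_def by (intro countable_PiE countable_rat) auto

lemma ratvec_approx:
  fixes a :: "nat \<Rightarrow> real"
  obtains s where "\<And>m. s m \<in> ratvec k" "\<And>j. j < k \<Longrightarrow> (\<lambda>m. s m j) \<longlonglongrightarrow> a j"
proof -
  define s where "s m = (\<lambda>j\<in>{..<k}. real_of_int \<lfloor>real (Suc m) * a j\<rfloor> / real (Suc m))" for m
  have "s m \<in> ratvec k" for m by (auto simp: s_def ratvec_def)
  moreover have "(\<lambda>m. s m j) \<longlonglongrightarrow> a j" if j: "j < k" for j
  proof (rule LIM_zero_cancel, rule tendsto_rabs_zero_cancel, rule tendsto_sandwich[of "\<lambda>_. 0"])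
    show "\<forall>\<^sub>F m in sequentially. \<bar>s m j - a j\<bar> \<le> inverse (real (Suc m))"
    proof (rule always_eventually, rule allI)
      fix m
      define M where "M = real (Suc m)"
      have M: "M > 0" by (simp add: M_def)
      have "\<bar>real_of_int \<lfloor>M * a j\<rfloor> - M * a j\<bar> \<le> 1" by linarith
      then have "\<bar>(real_of_int \<lfloor>M * a j\<rfloor> - M * a j) / M\<bar> \<le> 1 / M"
        using M by (simp add: abs_divide divide_right_mono)
      then show "\<bar>s m j - a j\<bar> \<le> inverse (real (Suc m))"
        using M j unfolding s_def M_def[symmetric] by (simp add: diff_divide_distrib inverse_eq_divide)
    qed
    show "(\<lambda>m. inverse (real (Suc m))) \<longlonglongrightarrow> 0" by (rule LIMSEQ_inverse_real_of_nat)
  qed auto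
  ultimately show thesis using that by blast
qed

text \<open>
  A continuous inequality needs to be tested on rational vectors only, which turns the conditions below
  into countable intersections of measurable sets.
\<close>

lemma ratvec_closed_condition:
  fixes f g :: "(nat \<Rightarrow> real) \<Rightarrow> real"
  assumes cont: "\<And>s a. (\<And>j. j < k \<Longrightarrow> (\<lambda>m. s m j) \<longlonglongrightarrow> a j) \<Longrightarrow> (\<lambda>m. f (s m)) \<longlonglongrightarrow> f a"
    "\<And>s a. (\<And>j. j < k \<Longrightarrow> (\<lambda>m. s m j) \<longlonglongrightarrow> a j) \<Longrightarrow> (\<lambda>m. g (s m)) \<longlonglongrightarrow> g a"
    and le: "\<And>a. a \<in> ratvec k \<Longrightarrow> f a \<le> g a"
  shows "f a \<le> g a"
proof -
  obtain s where s: "\<And>m. s m \<in> ratvec k" "\<And>j. j < k \<Longrightarrow> (\<lambda>m. s m j) \<longlonglongrightarrow> a j"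
    using ratvec_approx[of k a] by blast
  show ?thesis
    by (rule LIMSEQ_le[OF cont(1)[OF s(2)] cont(2)[OF s(2)]]) (use le s(1) in auto)
qed

lemma tendsto_L2_set:
  assumes "\<And>i. i < n \<Longrightarrow> (\<lambda>m. x m i) \<longlonglongrightarrow> y i"
  shows "(\<lambda>m. nrm n (x m)) \<longlonglongrightarrow> nrm n y"
  unfolding L2_set_def using assms by (intro tendsto_intros) auto

lemma tendsto_comb:
  assumes "\<And>j. j < k \<Longrightarrow> (\<lambda>m. s m j) \<longlonglongrightarrow> a j"
  shows "(\<lambda>m. comb n k (s m) Y i) \<longlonglongrightarrow> comb n k a Y i"
  unfolding comb_def using assms by (cases "i < n") (auto intro!: tendsto_intros)

lemma well_cond_ratvec:
  "well_cond n k \<beta> Y \<longleftrightarrow> (\<forall>a\<in>ratvec k. \<beta> * nrm k a \<le> nrm n (comb n k a Y))"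
proof
  assume *: "\<forall>a\<in>ratvec k. \<beta> * nrm k a \<le> nrm n (comb n k a Y)"
  show "well_cond n k \<beta> Y" unfolding well_cond_def
  proof
    fix a show "\<beta> * nrm k a \<le> nrm n (comb n k a Y)"
      by (rule ratvec_closed_condition[where k = k and f = "\<lambda>a. \<beta> * nrm k a"])
        (auto intro!: tendsto_mult tendsto_L2_set tendsto_comb simp: *)
  qed
qed (auto simp: well_cond_def)

definition residual :: "nat \<Rightarrow> (nat \<Rightarrow> real) set \<Rightarrow> (nat \<Rightarrow> real) \<Rightarrow> real" where
  "residual n E y = L2_set (\<lambda>i. y i - (\<Sum>j<n. proj_matrix n E i j * y j)) {..<n}"

lemma tendsto_residual:
  assumes "\<And>j. j < n \<Longrightarrow> (\<lambda>m. x m j) \<longlonglongrightarrow> y j"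
  shows "(\<lambda>m. residual n E (x m)) \<longlonglongrightarrow> residual n E y"
  unfolding residual_def using assms by (intro tendsto_L2_set tendsto_intros) auto

lemma residual_eq:
  assumes "E \<in> Grassmannian n k" "0 < k"
  shows "residual n E y = nrm n (y - orth_proj n E y)"
  by (simp add: residual_def orth_proj_matrix[OF assms] L2_set_def)

text \<open>
  The projection is the nearest point of \<open>E\<close>, so the existential quantifier can be replaced by a
  polynomial in the entries of the projection matrix and of \<open>Y\<close>.
\<close>

lemma close_to_colspan:
  assumes E: "E \<in> Grassmannian n k" and k: "0 < k"
  shows "close_to n t (colspan n k Y) E \<longleftrightarrow>
    (\<forall>a\<in>ratvec k. residual n E (comb n k a Y) \<le> t * nrm n (comb n k a Y))"
proof -
  have "close_to n t (colspan n k Y) E \<longleftrightarrow> (\<forall>a. residual n E (comb n k a Y) \<le> t * nrm n (comb n k a Y))"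
  proof
    assume c: "close_to n t (colspan n k Y) E"
    show "\<forall>a. residual n E (comb n k a Y) \<le> t * nrm n (comb n k a Y)"
    proof
      fix a
      obtain x where "x \<in> E" "nrm n (comb n k a Y - x) \<le> t * nrm n (comb n k a Y)"
        using c unfolding close_to_def colspan_def by blast
      then show "residual n E (comb n k a Y) \<le> t * nrm n (comb n k a Y)"
        unfolding residual_eq[OF E k] using orth_proj_props(4)[OF E k] order_trans by blast
    qed
  next
    assume "\<forall>a. residual n E (comb n k a Y) \<le> t * nrm n (comb n k a Y)"
    then show "close_to n t (colspan n k Y) E"
      unfolding close_to_def colspan_def residual_eq[OF E k] using orth_proj_props(1)[OF E k] by blast
  qed
  also have "\<dots> \<longleftrightarrow> (\<forall>a\<in>ratvec k. residual n E (comb n k a Y) \<le> t * nrm n (comb n k a Y))"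
  proof
    assume *: "\<forall>a\<in>ratvec k. residual n E (comb n k a Y) \<le> t * nrm n (comb n k a Y)"
    show "\<forall>a. residual n E (comb n k a Y) \<le> t * nrm n (comb n k a Y)"
    proof
      fix a show "residual n E (comb n k a Y) \<le> t * nrm n (comb n k a Y)"
        by (rule ratvec_closed_condition[where k = k and f = "\<lambda>a. residual n E (comb n k a Y)"])
          (auto intro!: tendsto_mult tendsto_L2_set tendsto_comb tendsto_residual simp: *)
    qed
  qed auto
  finally show ?thesis .
qed

lemma space_Gr_borel [simp]: "space (Gr_borel n k) = Grassmannian n k"
  by (simp add: Gr_borel_def)

lemma measurable_proj_matrix: "(\<lambda>E. proj_matrix n E i j) \<in> borel_measurable (Gr_borel n k)"
proof -
  have "proj_matrix n \<in> Gr_borel n k \<rightarrow>\<^sub>M borel"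
    unfolding Gr_borel_def by (rule measurable_vimage_algebra1) auto
  moreover have "(\<lambda>M::nat \<Rightarrow> nat \<Rightarrow> real. M i j) \<in> borel_measurable borel"
    by (rule measurable_compose[OF measurable_product_coordinates measurable_product_coordinates])
  ultimately show ?thesis by (rule measurable_compose)
qed

lemma measurable_Gr_borelI:
  assumes "\<And>x. x \<in> space M \<Longrightarrow> f x \<in> Grassmannian n k"
    and "\<And>i j. (\<lambda>x. proj_matrix n (f x) i j) \<in> borel_measurable M"
  shows "f \<in> M \<rightarrow>\<^sub>M Gr_borel n k"
  unfolding Gr_borel_def
proof (rule measurable_vimage_algebra2)
  show "f \<in> space M \<rightarrow> Grassmannian n k" using assms(1) by auto
  show "(\<lambda>x. proj_matrix n (f x)) \<in> borel_measurable M"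
    by (intro measurable_coordinatewise_then_product assms(2))
qed

lemma proj_matrix_reflection:
  assumes v: "v \<in> Rn n" "inner_n n v v = 1" and E: "E \<in> Grassmannian n k" and k: "0 < k"
  shows "proj_matrix n (reflection n v ` E) i j =
    (\<Sum>i'<n. ((if i' = i then 1 else 0) - 2 * v i * v i') *
      (\<Sum>j'<n. proj_matrix n E i' j' * reflection n v (\<lambda>l. if l = j then 1 else 0) j'))"
proof -
  obtain u where u: "orthonormal n k u" "E = range (lincomb k u)" using orthonormal_basis[OF E k] .
  let ?e = "\<lambda>l. if l = j then 1 else (0::real)"
  note u' = orthonormal_reflection[OF v u(1)]
  have RE: "reflection n v ` E = range (lincomb k (\<lambda>j. reflection n v (u j)))"
    unfolding u(2) by (rule reflection_image_lincomb)
  have "orth_proj n (reflection n v ` E) ?e = reflection n v (orth_proj n E (reflection n v ?e))"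
    unfolding RE orth_proj_eq[OF u'] unfolding u(2) orth_proj_eq[OF u(1)] reflection_lincomb reflection_adjoint ..
  then have "proj_matrix n (reflection n v ` E) i j = reflection n v (orth_proj n E (reflection n v ?e)) i"
    by (simp add: proj_matrix_def)
  also have "\<dots> = orth_proj n E (reflection n v ?e) i - 2 * (\<Sum>i'<n. v i' * orth_proj n E (reflection n v ?e) i') * v i"
    by (simp add: reflection_def[of n v "orth_proj n E _"] fscale_def inner_n_def)
  also have "\<dots> = (\<Sum>i'<n. ((if i' = i then 1 else 0) - 2 * v i * v i') * orth_proj n E (reflection n v ?e) i')"
  proof -
    have "orth_proj n E z i = (\<Sum>i'<n. (if i' = i then 1 else 0) * orth_proj n E z i')" for z
    proof (cases "i < n")
      case False
      have "orth_proj n E z \<in> Rn n" using orth_proj_props(1)[OF E k] E by (auto simp: Grassmannian_def)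
      then have "orth_proj n E z i = 0" using False by (auto simp: Rn_def)
      then show ?thesis using False by (auto intro!: sum.neutral)
    qed (simp add: if_distrib[of "\<lambda>c. c * _"] cong: if_cong)
    moreover have "2 * (\<Sum>i'<n. v i' * orth_proj n E z i') * v i = (\<Sum>i'<n. (2 * v i * v i') * orth_proj n E z i')" for z
      by (simp add: sum_distrib_left sum_distrib_right mult_ac)
    ultimately show ?thesis by (simp only: left_diff_distrib sum_subtractf)
  qed
  finally show ?thesis unfolding orth_proj_matrix[OF E k] .
qed

lemma measurable_reflection_image:
  assumes v: "v \<in> Rn n" "inner_n n v v = 1" and k: "0 < k"
  shows "(\<lambda>E. reflection n v ` E) \<in> Gr_borel n k \<rightarrow>\<^sub>M Gr_borel n k"
proof (rule measurable_Gr_borelI)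
  fix i j
  have "(\<lambda>E. \<Sum>i'<n. ((if i' = i then 1 else 0) - 2 * v i * v i') *
      (\<Sum>j'<n. proj_matrix n E i' j' * reflection n v (\<lambda>l. if l = j then 1 else 0) j'))
    \<in> borel_measurable (Gr_borel n k)"
    by (intro borel_measurable_sum borel_measurable_times borel_measurable_const measurable_proj_matrix)
  then show "(\<lambda>E. proj_matrix n (reflection n v ` E) i j) \<in> borel_measurable (Gr_borel n k)"
    by (rule measurable_cong[THEN iffD1, rotated]) (simp add: proj_matrix_reflection[OF v _ k])
qed (use reflection_Grassmannian[OF v _ k] in auto)

lemma close_to_reflection:
  assumes v: "inner_n n v v = 1"
  shows "close_to n t (reflection n v ` F) (reflection n v ` E) \<longleftrightarrow> close_to n t F E"
  unfolding close_to_def ball_simps bex_simps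
  by (simp add: reflection_linear(2)[symmetric] reflection_nrm[OF v])

lemma std_normal_interval_lower:
  assumes "a \<le> b" "c \<ge> 0" "\<And>x. a \<le> x \<Longrightarrow> x \<le> b \<Longrightarrow> c \<le> std_normal_density x"
  shows "ennreal (c * (b - a)) \<le> emeasure std_normal {a..b}"
proof -
  have "ennreal (c * (b - a)) = (\<integral>\<^sup>+x. ennreal c * indicator {a..b} x \<partial>lborel)"
    using assms by (subst nn_integral_cmult_indicator) (auto simp: ennreal_mult)
  also have "\<dots> \<le> (\<integral>\<^sup>+x. ennreal (std_normal_density x) * indicator {a..b} x \<partial>lborel)"
    using assms(3) by (intro nn_integral_mono) (auto simp: indicator_def intro!: ennreal_leI)
  also have "\<dots> = emeasure std_normal {a..b}" by (subst emeasure_density) auto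
  finally show ?thesis .
qed

lemma std_normal_interval_pos:
  assumes "a < b"
  shows "0 < emeasure std_normal {a..b}"
proof -
  define R where "R = max \<bar>a\<bar> \<bar>b\<bar>"
  define c where "c = 1 / sqrt (2 * pi) * exp (- R\<^sup>2 / 2)"
  have c: "c > 0" by (simp add: c_def)
  have "c \<le> std_normal_density x" if "a \<le> x" "x \<le> b" for x
  proof -
    have "\<bar>x\<bar> \<le> R" using that unfolding R_def by linarith
    then have "x\<^sup>2 \<le> R\<^sup>2" by (metis abs_ge_zero power2_abs power_mono)
    then show ?thesis unfolding c_def std_normal_density_def by (intro mult_left_mono) auto
  qed
  then have "ennreal (c * (b - a)) \<le> emeasure std_normal {a..b}"
    using assms c by (intro std_normal_interval_lower) auto
  moreover have "0 < ennreal (c * (b - a))" using c assms by simp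
  ultimately show ?thesis by (rule order.strict_trans2[rotated])
qed

text \<open>
  The relation between subspaces and matrices that is integrated in both orders.
\<close>

definition near_pairs :: "nat \<Rightarrow> nat \<Rightarrow> real \<Rightarrow> real \<Rightarrow> ((nat \<Rightarrow> real) set \<times> (nat \<times> nat \<Rightarrow> real)) set" where
  "near_pairs n k t \<beta> = {(E, Y). E \<in> Grassmannian n k \<and> Y \<in> space (gmat n k) \<and>
     well_cond n k \<beta> Y \<and> close_to n t (colspan n k Y) E}"

lemma well_cond_sets: "{Y \<in> space (gmat n k). well_cond n k \<beta> Y} \<in> sets (gmat n k)"
proof -
  have "(\<lambda>Y. nrm n (comb n k a Y)) \<in> borel_measurable (gmat n k)" for a
    unfolding L2_set_def
    by (intro measurable_compose[OF _ borel_measurable_sqrt] borel_measurable_sum borel_measurable_power comb_measurable)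
  then have "{Y \<in> space (gmat n k). \<beta> * nrm k a \<le> nrm n (comb n k a Y)} \<in> sets (gmat n k)" for a
    by (intro borel_measurable_le) auto
  then show ?thesis
    unfolding well_cond_ratvec by (intro sets.sets_Collect_countable_All' countable_ratvec)
qed

lemma near_pairs_sets:
  assumes k: "0 < k"
  shows "near_pairs n k t \<beta> \<in> sets (Gr_borel n k \<Otimes>\<^sub>M gmat n k)" (is "_ \<in> sets ?M")
proof -
  have c: "(\<lambda>z. comb n k a (snd z) i) \<in> borel_measurable ?M" for a i
    by (rule measurable_compose[OF measurable_snd comb_measurable])
  have P: "(\<lambda>z. proj_matrix n (fst z) i j) \<in> borel_measurable ?M" for i j
    by (rule measurable_compose[OF measurable_fst measurable_proj_matrix])
  have m: "(\<lambda>z. t * nrm n (comb n k a (snd z))) \<in> borel_measurable ?M" for a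
    unfolding L2_set_def
    by (intro borel_measurable_times borel_measurable_const measurable_compose[OF _ borel_measurable_sqrt] borel_measurable_sum
        borel_measurable_power c)
  have r: "(\<lambda>z. residual n (fst z) (comb n k a (snd z))) \<in> borel_measurable ?M" for a
    unfolding L2_set_def residual_def
    by (intro borel_measurable_times borel_measurable_diff measurable_compose[OF _ borel_measurable_sqrt] borel_measurable_sum
        borel_measurable_power c P)
  have A: "{z \<in> space ?M. \<forall>a\<in>ratvec k. residual n (fst z) (comb n k a (snd z)) \<le> t * nrm n (comb n k a (snd z))} \<in> sets ?M"
    by (intro sets.sets_Collect_countable_All' countable_ratvec borel_measurable_le r m)
  have B: "{z \<in> space ?M. snd z \<in> {Y \<in> space (gmat n k). well_cond n k \<beta> Y}} \<in> sets ?M"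
    using measurable_sets[OF measurable_snd well_cond_sets[of n k \<beta>], of "Gr_borel n k"]
    by (simp add: vimage_def Int_def conj_commute)
  have "near_pairs n k t \<beta>
    = {z \<in> space ?M. \<forall>a\<in>ratvec k. residual n (fst z) (comb n k a (snd z)) \<le> t * nrm n (comb n k a (snd z))}
      \<inter> {z \<in> space ?M. snd z \<in> {Y \<in> space (gmat n k). well_cond n k \<beta> Y}}"
    using close_to_colspan[OF _ k] by (auto simp: near_pairs_def space_pair_measure)
  then show ?thesis using A B by simp
qed

definition reflect_columns :: "nat \<Rightarrow> nat \<Rightarrow> (nat \<Rightarrow> real) \<Rightarrow> (nat \<times> nat \<Rightarrow> real) \<Rightarrow> nat \<times> nat \<Rightarrow> real" where
  "reflect_columns n k v Y = (\<lambda>l\<in>{..<n} \<times> {..<k}. Y l - 2 * v (fst l) * (\<Sum>i<n. v i * Y (i, snd l)))"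

lemma reflect_columns_preserves:
  assumes "inner_n n v v = 1"
  shows "preserves (gmat n k) (reflect_columns n k v)"
  unfolding reflect_columns_def[abs_def] using assms
  by (intro gmat_column_householder) (simp add: inner_n_def power2_eq_square)

lemma comb_reflect_columns:
  assumes v: "v \<in> Rn n"
  shows "comb n k a (reflect_columns n k v Y) = reflection n v (comb n k a Y)"
proof
  fix i
  show "comb n k a (reflect_columns n k v Y) i = reflection n v (comb n k a Y) i"
  proof (cases "i < n")
    case True
    have "inner_n n v (comb n k a Y) = (\<Sum>i'<n. \<Sum>j<k. v i' * (a j * Y (i', j)))"
      by (simp add: inner_n_def comb_def sum_distrib_left)
    also have "\<dots> = (\<Sum>j<k. a j * (\<Sum>i'<n. v i' * Y (i', j)))"
      by (subst sum.swap) (simp add: sum_distrib_left mult_ac)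
    finally have s: "inner_n n v (comb n k a Y) = (\<Sum>j<k. a j * (\<Sum>i'<n. v i' * Y (i', j)))" .
    have "comb n k a (reflect_columns n k v Y) i = (\<Sum>j<k. a j * Y (i, j) - 2 * v i * (a j * (\<Sum>i'<n. v i' * Y (i', j))))"
      using True by (simp add: comb_def reflect_columns_def algebra_simps)
    also have "\<dots> = comb n k a Y i - 2 * v i * inner_n n v (comb n k a Y)"
      using True unfolding s by (simp add: comb_def sum_subtractf sum_distrib_left)
    finally show ?thesis by (simp add: reflection_def fscale_def)
  next
    case False
    then have "v i = 0" using v by (simp add: Rn_def)
    then show ?thesis using False by (simp add: comb_def reflection_def fscale_def)
  qed
qed

lemma near_pairs_reflect_columns:
  assumes v: "v \<in> Rn n" "inner_n n v v = 1" and E: "E \<in> Grassmannian n k" and k: "0 < k"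
    and Y: "Y \<in> space (gmat n k)"
  shows "(reflection n v ` E, reflect_columns n k v Y) \<in> near_pairs n k t \<beta> \<longleftrightarrow> (E, Y) \<in> near_pairs n k t \<beta>"
proof -
  have "reflect_columns n k v Y \<in> space (gmat n k)" by (simp add: reflect_columns_def)
  moreover have "colspan n k (reflect_columns n k v Y) = reflection n v ` colspan n k Y"
    by (auto simp: colspan_def comb_reflect_columns[OF v(1)])
  moreover have "well_cond n k \<beta> (reflect_columns n k v Y) \<longleftrightarrow> well_cond n k \<beta> Y"
    by (simp add: well_cond_def comb_reflect_columns[OF v(1)] reflection_nrm[OF v(2)])
  ultimately show ?thesis
    using reflection_Grassmannian[OF v E k] E Y
    by (simp add: near_pairs_def close_to_reflection[OF v(2)])
qed

text \<open>
  Reflecting \<open>E\<close> is compensated by reflecting the columns of \<open>Y\<close>, which preserves the Gaussian law.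
\<close>

lemma gauss_near_pairs_const:
  assumes k: "0 < k" and E: "E \<in> Grassmannian n k" "F \<in> Grassmannian n k"
  shows "emeasure (gmat n k) (Pair E -` near_pairs n k t \<beta>) = emeasure (gmat n k) (Pair F -` near_pairs n k t \<beta>)"
proof (rule reflection_invariant_constant[OF k E])
  fix E v assume E: "E \<in> Grassmannian n k" and v: "v \<in> Rn n" "inner_n n v v = 1"
  let ?N = "near_pairs n k t \<beta>"
  have "emeasure (gmat n k) (Pair (reflection n v ` E) -` ?N)
      = emeasure (gmat n k) (reflect_columns n k v -` (Pair (reflection n v ` E) -` ?N) \<inter> space (gmat n k))"
    by (rule preserves_emeasure[OF reflect_columns_preserves[OF v(2)] sets_Pair1[OF near_pairs_sets[OF k]], symmetric])
  also have "reflect_columns n k v -` (Pair (reflection n v ` E) -` ?N) \<inter> space (gmat n k) = Pair E -` ?N"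
    using near_pairs_reflect_columns[OF v E k] by (auto simp: near_pairs_def)
  finally show "emeasure (gmat n k) (Pair (reflection n v ` E) -` ?N) = emeasure (gmat n k) (Pair E -` ?N)" .
qed

text \<open>
  A section of the measurable set of near pairs, taken at a matrix whose columns span \<open>F\<close>.
\<close>

lemma close_to_sets:
  assumes k: "0 < k" and F: "F \<in> Grassmannian n k"
  shows "{E \<in> Grassmannian n k. close_to n t F E} \<in> sets (Gr_borel n k)"
proof -
  obtain u where u: "orthonormal n k u" "F = range (lincomb k u)" using orthonormal_basis[OF F k] .
  define Y where "Y = (\<lambda>l\<in>{..<n} \<times> {..<k}. u (snd l) (fst l))"
  have Y: "Y \<in> space (gmat n k)" by (simp add: Y_def)
  have "comb n k a Y = lincomb k u a" for a
    using u(1) by (auto simp: fun_eq_iff comb_def lincomb_apply Y_def orthonormal_def Rn_def)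
  then have c: "colspan n k Y = F" by (simp add: colspan_def u(2))
  have n0: "well_cond n k 0 Y" by (simp add: well_cond_def)
  have "{E \<in> Grassmannian n k. close_to n t F E} = (\<lambda>E. (E, Y)) -` near_pairs n k t 0"
    using Y n0 by (auto simp: near_pairs_def c)
  then show ?thesis using sets_Pair2[OF near_pairs_sets[OF k]] by simp
qed

lemma uniform_close_to_const:
  assumes \<mu>: "uniform_Gr n k \<mu>" and k: "0 < k" and F: "F \<in> Grassmannian n k" "F' \<in> Grassmannian n k"
  shows "emeasure \<mu> {E \<in> Grassmannian n k. close_to n t F E} = emeasure \<mu> {E \<in> Grassmannian n k. close_to n t F' E}"
proof (rule reflection_invariant_constant[OF k F])
  fix F v assume F: "F \<in> Grassmannian n k" and v: "v \<in> Rn n" "inner_n n v v = 1"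
  let ?T = "\<lambda>E. reflection n v ` E"
  have s: "sets \<mu> = sets (Gr_borel n k)" and d: "distr \<mu> (Gr_borel n k) ?T = \<mu>"
    using \<mu> rotation_reflection[OF v] by (auto simp: uniform_Gr_def)
  have sp: "space \<mu> = Grassmannian n k" using sets_eq_imp_space_eq[OF s] by simp
  have T: "?T \<in> \<mu> \<rightarrow>\<^sub>M Gr_borel n k"
    using measurable_reflection_image[OF v k] measurable_cong_sets[OF s refl] by auto
  let ?A = "\<lambda>F. {E \<in> Grassmannian n k. close_to n t F E}"
  have "emeasure \<mu> (?A (?T F)) = emeasure (distr \<mu> (Gr_borel n k) ?T) (?A (?T F))" by (simp add: d)
  also have "\<dots> = emeasure \<mu> (?T -` ?A (?T F) \<inter> space \<mu>)"
    by (rule emeasure_distr[OF T close_to_sets[OF k reflection_Grassmannian[OF v F k]]])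
  also have "?T -` ?A (?T F) \<inter> space \<mu> = ?A F"
    using reflection_Grassmannian[OF v _ k] by (auto simp: sp close_to_reflection[OF v(2)])
  finally show "emeasure \<mu> (?A (?T F)) = emeasure \<mu> (?A F)" .
qed

lemma gauss_box_pos:
  assumes I: "finite I" and ab: "\<And>i. i \<in> I \<Longrightarrow> a i < b i"
  shows "0 < emeasure (gauss I) (Pi\<^sub>E I (\<lambda>i. {a i..b i}))"
proof -
  interpret N: prob_space std_normal by (rule prob_space_normal_density) simp
  interpret product_sigma_finite "\<lambda>_. std_normal" ..
  have "emeasure (gauss I) (Pi\<^sub>E I (\<lambda>i. {a i..b i})) = (\<Prod>i\<in>I. emeasure std_normal {a i..b i})"
    unfolding gauss_def by (rule emeasure_PiM[OF I]) simp
  also have "\<dots> \<noteq> 0"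
  proof
    assume "(\<Prod>i\<in>I. emeasure std_normal {a i..b i}) = 0"
    then obtain i where "i \<in> I" "emeasure std_normal {a i..b i} = 0"
      using I by (auto simp: prod_zero_iff)
    then show False using std_normal_interval_pos[OF ab] by (metis less_irrefl)
  qed
  finally show ?thesis by (simp add: zero_less_iff_neq_zero)
qed

lemma L2_set_le_bound:
  assumes "\<And>i. i < n \<Longrightarrow> \<bar>x i\<bar> \<le> c"
  shows "nrm n x \<le> real n * c"
proof -
  have "nrm n x \<le> (\<Sum>i<n. \<bar>x i\<bar>)" by (rule L2_set_le_sum_abs)
  also have "\<dots> \<le> (\<Sum>i<n. c)" using assms by (intro sum_mono) auto
  finally show ?thesis by simp
qed

text \<open>
  The subspace spanned by the first \<open>k\<close> unit vectors is near every matrix in a small box around a multiple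
  of the identity matrix, and boxes have positive Gaussian measure.
\<close>

lemma gauss_near_pairs_pos:
  assumes k: "0 < k" "k \<le> n" and t: "0 < t" "t \<le> 1" and \<beta>: "0 < \<beta>" and E: "E \<in> Grassmannian n k"
  shows "0 < emeasure (gmat n k) (Pair E -` near_pairs n k t \<beta>)"
proof -
  define e where "e j = (\<lambda>i. if i = j then 1 else 0 :: real)" for j :: nat
  have e: "orthonormal n k e"
    using k by (auto simp: orthonormal_def e_def Rn_def inner_n_def if_distrib[of "\<lambda>c. c * _"] cong: if_cong)
  let ?F = "range (lincomb k e)"
  have F: "?F \<in> Grassmannian n k" by (rule orthonormal_Grassmannian[OF e])
  \<comment> \<open>an error of \<open>\<eta>\<close> in every entry changes \<open>Y a\<close> by at most \<open>t * \<beta>\<close> times the norm of \<open>a\<close>\<close>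
  define \<eta> where "\<eta> = t * \<beta> / (real n * real k)"
  have nk: "real n > 0" "real k > 0" using k by auto
  have \<eta>: "\<eta> > 0" using t \<beta> nk by (simp add: \<eta>_def)
  define m where "m l = (if fst l = snd l then 2 * \<beta> else 0)" for l :: "nat \<times> nat"
  let ?I = "{..<n} \<times> {..<k}"
  let ?B = "Pi\<^sub>E ?I (\<lambda>l. {m l - \<eta>..m l + \<eta>})"
  have "?B \<subseteq> Pair ?F -` near_pairs n k t \<beta>"
  proof
    fix Y assume Y: "Y \<in> ?B"
    have Ym: "\<bar>Y (i, j) - m (i, j)\<bar> \<le> \<eta>" if "i < n" "j < k" for i j
    proof -
      have "Y (i, j) \<in> {m (i, j) - \<eta>..m (i, j) + \<eta>}" using Y that by (intro PiE_mem[OF Y]) auto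
      then show ?thesis by (simp add: abs_le_iff)
    qed
    have main: "nrm n (comb n k a Y - lincomb k e (\<lambda>j. 2 * \<beta> * a j)) \<le> t * (\<beta> * nrm k a)"
      "nrm n (lincomb k e (\<lambda>j. 2 * \<beta> * a j)) = 2 * \<beta> * nrm k a" for a
    proof -
      let ?x = "lincomb k e (\<lambda>j. 2 * \<beta> * a j)"
      have "\<bar>(comb n k a Y - ?x) i\<bar> \<le> real k * (nrm k a * \<eta>)" if i: "i < n" for i
      proof -
        have "(comb n k a Y - ?x) i = (\<Sum>j<k. a j * (Y (i, j) - m (i, j)))"
          using i by (simp add: comb_def lincomb_apply sum_subtractf[symmetric])
            (intro sum.cong, auto simp: m_def e_def algebra_simps)
        also have "\<bar>\<dots>\<bar> \<le> (\<Sum>j<k. \<bar>a j * (Y (i, j) - m (i, j))\<bar>)" by (rule sum_abs)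
        also have "\<dots> \<le> (\<Sum>j<k. nrm k a * \<eta>)"
        proof (rule sum_mono)
          fix j assume j: "j \<in> {..<k}"
          have "\<bar>a j\<bar> \<le> nrm k a"
            using member_le_L2_set[of "{..<k}" j "\<lambda>j. \<bar>a j\<bar>"] j by (simp add: L2_set_def)
          then show "\<bar>a j * (Y (i, j) - m (i, j))\<bar> \<le> nrm k a * \<eta>"
            unfolding abs_mult using Ym[OF i] j by (intro mult_mono) auto
        qed
        finally show ?thesis by simp
      qed
      then have "nrm n (comb n k a Y - ?x) \<le> real n * (real k * (nrm k a * \<eta>))"
        by (rule L2_set_le_bound)
      also have "\<dots> = t * (\<beta> * nrm k a)" using nk by (simp add: \<eta>_def)
      finally show "nrm n (comb n k a Y - ?x) \<le> t * (\<beta> * nrm k a)" .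
      have "(nrm n ?x)\<^sup>2 = (2 * \<beta> * nrm k a)\<^sup>2"
        unfolding inner_n_self[symmetric] inner_lincomb using orthonormal_inner'[OF e]
        by (simp add: power_mult_distrib L2_set_def sum_nonneg sum_distrib_left power2_eq_square algebra_simps)
      then show "nrm n ?x = 2 * \<beta> * nrm k a"
        by (rule power2_eq_imp_eq) (use \<beta> in auto)
    qed
    have wc: "\<beta> * nrm k a \<le> nrm n (comb n k a Y)" for a
    proof -
      let ?x = "lincomb k e (\<lambda>j. 2 * \<beta> * a j)"
      have "nrm n ?x \<le> nrm n (comb n k a Y) + nrm n (?x - comb n k a Y)"
        using nrm_triangle[where n = n and x = "comb n k a Y" and y = "?x - comb n k a Y"] by simp
      also have "nrm n (?x - comb n k a Y) \<le> t * (\<beta> * nrm k a)"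
        using main(1)[of a] nrm_minus_commute[where n = n and x = ?x] by simp
      also have "\<dots> \<le> 1 * (\<beta> * nrm k a)" using t \<beta> by (intro mult_right_mono) auto
      finally show ?thesis using main(2)[of a] by simp
    qed
    have "close_to n t (colspan n k Y) ?F"
      unfolding close_to_def colspan_def
    proof (intro ballI, elim rangeE)
      fix y a assume y: "y = comb n k a Y"
      have "nrm n (y - lincomb k e (\<lambda>j. 2 * \<beta> * a j)) \<le> t * nrm n y"
        using main(1)[of a] mult_left_mono[OF wc[of a], of t] t unfolding y by linarith
      then show "\<exists>x\<in>?F. nrm n (y - x) \<le> t * nrm n y" by blast
    qed
    moreover have "Y \<in> space (gmat n k)" using Y by (simp add: PiE_def)
    ultimately show "Y \<in> Pair ?F -` near_pairs n k t \<beta>"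
      using wc F by (simp add: near_pairs_def well_cond_def)
  qed
  then have "emeasure (gmat n k) ?B \<le> emeasure (gmat n k) (Pair ?F -` near_pairs n k t \<beta>)"
    by (rule emeasure_mono) (rule sets_Pair1[OF near_pairs_sets[OF k(1)]])
  moreover have "0 < emeasure (gmat n k) ?B" using \<eta> by (intro gauss_box_pos) auto
  ultimately show ?thesis using gauss_near_pairs_const[OF k(1) E F] by (simp add: order.strict_trans2)
qed

text \<open>
  Let \<open>c\<close> be the Gaussian probability of being near a given subspace and \<open>h\<close> the \<open>\<mu>\<close>-measure of the
  subspaces near a given well conditioned matrix. Fubini gives \<open>c = h P(J)\<close> for the set \<open>J\<close> of well
  conditioned matrices. The same computation for the pairs with \<open>E \<in> B\<close> gives
  \<open>c \<mu>(B) \<le> h P(J - G)\<close>, since a matrix in \<open>G\<close> is near no member of \<open>B\<close>. Dividing by \<open>h\<close>, which is positive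
  because \<open>c\<close> is, proves the claim.
\<close>

lemma uniform_Gr_transfer:
  assumes \<mu>: "uniform_Gr n k \<mu>" and k: "0 < k" "k \<le> n" and t: "0 < t" "t \<le> 1" and \<beta>: "0 < \<beta>"
    and B: "B \<in> sets \<mu>" and G: "G \<in> sets (gmat n k)"
    and BG: "\<And>E Y. E \<in> B \<Longrightarrow> Y \<in> G \<Longrightarrow> well_cond n k \<beta> Y \<Longrightarrow> close_to n t (colspan n k Y) E \<Longrightarrow> False"
  shows "measure \<mu> B * measure (gmat n k) {Y \<in> space (gmat n k). well_cond n k \<beta> Y}
    \<le> 1 - measure (gmat n k) G"
proof -
  interpret \<mu>: prob_space \<mu> using \<mu> by (simp add: uniform_Gr_def)
  interpret \<gamma>: prob_space "gmat n k" by (rule prob_space_gauss)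
  interpret P: pair_sigma_finite \<mu> "gmat n k" ..
  have s: "sets \<mu> = sets (Gr_borel n k)" using \<mu> by (simp add: uniform_Gr_def)
  have sp: "space \<mu> = Grassmannian n k" using sets_eq_imp_space_eq[OF s] by simp
  let ?N = "near_pairs n k t \<beta>"
  let ?J = "{Y \<in> space (gmat n k). well_cond n k \<beta> Y}"
  let ?M = "\<mu> \<Otimes>\<^sub>M gmat n k"
  have N: "?N \<in> sets ?M"
    using near_pairs_sets[OF k(1)] sets_pair_measure_cong[OF s refl[of "sets (gmat n k)"]] by simp
  have J: "?J \<in> sets (gmat n k)" by (rule well_cond_sets)
  obtain E0 where E0: "E0 \<in> Grassmannian n k" using \<mu>.not_empty sp by auto
  define c where "c = emeasure (gmat n k) (Pair E0 -` ?N)"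
  define h where "h = emeasure \<mu> {E \<in> Grassmannian n k. close_to n t E0 E}"
  have c0: "c > 0" unfolding c_def by (rule gauss_near_pairs_pos[OF k t \<beta> E0])
  have upper: "c * emeasure \<mu> A = emeasure ?M (?N \<inter> (A \<times> space (gmat n k)))" if A: "A \<in> sets \<mu>" for A
  proof -
    have "emeasure ?M (?N \<inter> (A \<times> space (gmat n k)))
      = (\<integral>\<^sup>+E. emeasure (gmat n k) (Pair E -` (?N \<inter> (A \<times> space (gmat n k)))) \<partial>\<mu>)"
      by (intro \<gamma>.emeasure_pair_measure_alt sets.Int pair_measureI N A sets.top)
    also have "\<dots> = (\<integral>\<^sup>+E. c * indicator A E \<partial>\<mu>)"
    proof (rule nn_integral_cong)
      fix E assume "E \<in> space \<mu>"
      then have "emeasure (gmat n k) (Pair E -` ?N) = c"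
        unfolding c_def using gauss_near_pairs_const[OF k(1) _ E0] sp by simp
      moreover have "Pair E -` (?N \<inter> (A \<times> space (gmat n k))) = (if E \<in> A then Pair E -` ?N else {})"
        by (auto simp: near_pairs_def)
      ultimately show "emeasure (gmat n k) (Pair E -` (?N \<inter> (A \<times> space (gmat n k)))) = c * indicator A E"
        by simp
    qed
    also have "\<dots> = c * emeasure \<mu> A" using A by (simp add: nn_integral_cmult_indicator)
    finally show ?thesis by simp
  qed
  have slice: "emeasure \<mu> ((\<lambda>E. (E, Y)) -` ?N) = h * indicator ?J Y" if Y: "Y \<in> space (gmat n k)" for Y
  proof (cases "well_cond n k \<beta> Y")
    case True
    have "(\<lambda>E. (E, Y)) -` ?N = {E \<in> Grassmannian n k. close_to n t (colspan n k Y) E}"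
      using True Y by (auto simp: near_pairs_def)
    moreover have "emeasure \<mu> \<dots> = h" unfolding h_def
      by (rule uniform_close_to_const[OF \<mu> k(1) well_cond_Grassmannian[OF True \<beta>] E0])
    ultimately show ?thesis using True Y by simp
  next
    case False
    then have "(\<lambda>E. (E, Y)) -` ?N = {}" by (auto simp: near_pairs_def)
    then show ?thesis using False by simp
  qed
  have whole: "c = h * emeasure (gmat n k) ?J"
  proof -
    have "?N \<inter> (space \<mu> \<times> space (gmat n k)) = ?N" using sp by (auto simp: near_pairs_def)
    then have "c = emeasure ?M ?N" using upper[OF sets.top] \<mu>.emeasure_space_1 by simp
    also have "\<dots> = (\<integral>\<^sup>+Y. emeasure \<mu> ((\<lambda>E. (E, Y)) -` ?N) \<partial>gmat n k)"
      by (rule P.emeasure_pair_measure_alt2[OF N])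
    also have "\<dots> = (\<integral>\<^sup>+Y. h * indicator ?J Y \<partial>gmat n k)"
      by (rule nn_integral_cong) (rule slice)
    also have "\<dots> = h * emeasure (gmat n k) ?J" using J by (rule nn_integral_cmult_indicator)
    finally show ?thesis .
  qed
  have part: "c * emeasure \<mu> B \<le> h * emeasure (gmat n k) (?J - G)"
  proof -
    let ?K = "?N \<inter> (B \<times> space (gmat n k))"
    have K: "?K \<in> sets ?M" by (intro sets.Int pair_measureI N B sets.top)
    have "c * emeasure \<mu> B = emeasure ?M ?K" by (rule upper[OF B])
    also have "\<dots> = (\<integral>\<^sup>+Y. emeasure \<mu> ((\<lambda>E. (E, Y)) -` ?K) \<partial>gmat n k)"
      by (rule P.emeasure_pair_measure_alt2[OF K])
    also have "\<dots> \<le> (\<integral>\<^sup>+Y. h * indicator (?J - G) Y \<partial>gmat n k)"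
    proof (rule nn_integral_mono)
      fix Y assume Y: "Y \<in> space (gmat n k)"
      show "emeasure \<mu> ((\<lambda>E. (E, Y)) -` ?K) \<le> h * indicator (?J - G) Y"
      proof (cases "Y \<in> G")
        case True
        then have "(\<lambda>E. (E, Y)) -` ?K = {}" using BG by (auto simp: near_pairs_def)
        then show ?thesis by simp
      next
        case False
        have "emeasure \<mu> ((\<lambda>E. (E, Y)) -` ?K) \<le> emeasure \<mu> ((\<lambda>E. (E, Y)) -` ?N)"
          by (rule emeasure_mono) (auto intro: sets_Pair2[OF N])
        also have "\<dots> = h * indicator (?J - G) Y" unfolding slice[OF Y] using False Y by (simp add: indicator_def)
        finally show ?thesis .
      qed
    qed
    also have "\<dots> = h * emeasure (gmat n k) (?J - G)"
      using J G by (intro nn_integral_cmult_indicator sets.Diff)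
    finally show ?thesis .
  qed
  define h' where "h' = measure \<mu> {E \<in> Grassmannian n k. close_to n t E0 E}"
  have hh: "h = ennreal h'" "h' \<ge> 0" by (simp_all add: h_def h'_def \<mu>.emeasure_eq_measure)
  have h0: "h' > 0" using c0 whole hh by (metis ennreal_0 less_eq_real_def mult_zero_left order_less_irrefl)
  have "ennreal (h' * measure (gmat n k) ?J * measure \<mu> B) \<le> ennreal (h' * measure (gmat n k) (?J - G))"
    using part unfolding whole hh(1) \<mu>.emeasure_eq_measure \<gamma>.emeasure_eq_measure
    by (simp add: ennreal_mult hh(2))
  then have "h' * (measure (gmat n k) ?J * measure \<mu> B) \<le> h' * measure (gmat n k) (?J - G)"
    using hh(2) by (simp add: mult.assoc)
  then have "measure (gmat n k) ?J * measure \<mu> B \<le> measure (gmat n k) (?J - G)"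
    using h0 by simp
  also have "\<dots> \<le> measure (gmat n k) (space (gmat n k) - G)"
    by (intro \<gamma>.finite_measure_mono sets.Diff sets.top G) auto
  also have "\<dots> = 1 - measure (gmat n k) G" using G by (rule \<gamma>.prob_compl)
  finally show ?thesis by (simp add: mult.commute)
qed

section \<open>Spherical subspaces\<close>

lemma lp_norm_le_nrm:
  assumes p: "p \<ge> 1"
  shows "lp_norm n p x \<le> real n * nrm n x"
proof (cases "n = 0")
  case False
  have "lp_norm n p x \<le> lp_norm n p (\<lambda>i. nrm n x * 1)"
  proof (rule lp_norm_mono[OF p])
    fix i assume "i < n"
    then show "\<bar>x i\<bar> \<le> \<bar>nrm n x * 1\<bar>"
      using member_le_L2_set[of "{..<n}" i "\<lambda>j. \<bar>x j\<bar>"] by (simp add: L2_set_def)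
  qed
  also have "\<dots> = nrm n x * lp_norm n p (\<lambda>_. 1)"
    unfolding lp_norm_scale[OF p] by simp
  also have "\<dots> \<le> nrm n x * real n"
  proof (rule mult_left_mono)
    have "lp_norm n p (\<lambda>_. 1) = real n powr (1 / p)" by (simp add: lp_norm_def)
    also have "\<dots> \<le> real n powr 1" using False p by (intro powr_mono) auto
    finally show "lp_norm n p (\<lambda>_. 1) \<le> real n" by simp
  qed simp
  finally show ?thesis by (simp only: mult.commute)
qed (simp add: lp_norm_def)

lemma coordinate_le_lp_norm:
  assumes p: "p \<ge> 1" and i: "i < n"
  shows "\<bar>x i\<bar> \<le> lp_norm n p x"
proof -
  have "\<bar>x i\<bar> powr p \<le> (\<Sum>i<n. \<bar>x i\<bar> powr p)" using i by (intro member_le_sum) auto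
  then have "(\<bar>x i\<bar> powr p) powr (1 / p) \<le> (\<Sum>i<n. \<bar>x i\<bar> powr p) powr (1 / p)"
    using p by (intro powr_mono2) auto
  then show ?thesis using p by (simp add: lp_norm_def powr_powr)
qed

lemma nrm_le_lp_norm:
  assumes p: "p \<ge> 1"
  shows "nrm n x \<le> real n * lp_norm n p x"
  using coordinate_le_lp_norm[OF p] by (rule L2_set_le_bound)

lemma lp_norm_fscale: "p \<ge> 1 \<Longrightarrow> lp_norm n p (fscale c x) = \<bar>c\<bar> * lp_norm n p x"
  unfolding fscale_def by (rule lp_norm_scale)

lemma lp_norm_plus: "p \<ge> 1 \<Longrightarrow> lp_norm n p (x + y) \<le> lp_norm n p x + lp_norm n p y"
  using lp_norm_triangle[where p = p and n = n and x = x and y = y] by (simp add: plus_fun_def)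

lemma lp_norm_perturb:
  assumes p: "p \<ge> 1" and xy: "nrm n (y - x) \<le> r"
  shows "\<bar>lp_norm n p x - lp_norm n p y\<bar> \<le> real n * r"
proof -
  have d: "lp_norm n p (y - x) \<le> real n * r" "lp_norm n p (x - y) \<le> real n * r"
    using lp_norm_le_nrm[OF p, where n = n and x = "y - x"] lp_norm_le_nrm[OF p, where n = n and x = "x - y"]
      mult_left_mono[OF xy, of "real n"] by (auto simp: nrm_minus_commute[where x = x])
  show ?thesis
    using lp_norm_plus[OF p, where n = n and x = x and y = "y - x"] lp_norm_plus[OF p, where n = n and x = y and y = "x - y"] d by simp
qed

text \<open>
  On the unit sphere of \<open>E\<close> the norm lies between \<open>1 / n\<close> and \<open>n\<close>, so its supremum and infimum there are
  finite and positive and the quotient can be cleared.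
\<close>

lemma spherical_iff:
  assumes E: "E \<in> Grassmannian n k" and k: "0 < k" and n: "0 < n" and p: "p \<ge> 1" and K: "K > 0"
  shows "spherical n (lp_norm n p) K E \<longleftrightarrow>
    (\<forall>x\<in>E. \<forall>y\<in>E. lp_norm n p x * nrm n y \<le> K * (lp_norm n p y * nrm n x))"
proof -
  let ?N = "lp_norm n p"
  let ?S = "{x \<in> E. nrm n x = 1}"
  have sub: "fvec.subspace E" and ER: "E \<subseteq> Rn n" using E by (auto simp: Grassmannian_def)
  obtain u where u: "orthonormal n k u" "E = range (lincomb k u)" using orthonormal_basis[OF E k] .
  have ne: "?S \<noteq> {}"
  proof -
    have "u 0 = lincomb k u (\<lambda>l. if l = 0 then 1 else 0)"
      using k by (simp add: fun_eq_iff lincomb_apply if_distrib[of "\<lambda>c. c * _"] cong: if_cong)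
    then have "u 0 \<in> E" using u by auto
    moreover have "(nrm n (u 0))\<^sup>2 = 1" using u k by (auto simp: inner_n_self[symmetric] orthonormal_def)
    then have "nrm n (u 0) = 1" by (simp add: power2_eq_1_iff) (use L2_set_nonneg[of "u 0" "{..<n}"] in linarith)
    ultimately show ?thesis by blast
  qed
  have up: "?N x \<le> real n" if "x \<in> ?S" for x using lp_norm_le_nrm[OF p, where n = n and x = x] that by simp
  have low: "1 / real n \<le> ?N x" if "x \<in> ?S" for x
    using nrm_le_lp_norm[OF p, where n = n and x = x] that n by (simp add: field_simps)
  have ba: "bdd_above (?N ` ?S)" by (rule bdd_aboveI[of _ "real n"]) (use up in auto)
  have bb: "bdd_below (?N ` ?S)" by (rule bdd_belowI[of _ 0]) (auto simp: lp_norm_nonneg)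
  have "1 / real n \<le> (INF x\<in>?S. ?N x)" using ne low by (intro cINF_greatest) auto
  then have I: "(INF x\<in>?S. ?N x) > 0" using n by (smt (verit) of_nat_0_less_iff zero_less_divide_1_iff)
  have "spherical n ?N K E \<longleftrightarrow> (SUP x\<in>?S. ?N x) \<le> K * (INF x\<in>?S. ?N x)"
    unfolding spherical_def lp_norm_2 using I by (simp add: pos_divide_le_eq)
  also have "\<dots> \<longleftrightarrow> (\<forall>x\<in>?S. \<forall>y\<in>?S. ?N x \<le> K * ?N y)"
  proof
    assume *: "(SUP x\<in>?S. ?N x) \<le> K * (INF x\<in>?S. ?N x)"
    show "\<forall>x\<in>?S. \<forall>y\<in>?S. ?N x \<le> K * ?N y"
    proof (intro ballI)
      fix x y assume x: "x \<in> ?S" and y: "y \<in> ?S"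
      have "?N x \<le> (SUP x\<in>?S. ?N x)" using x ba by (rule cSUP_upper)
      also note *
      also have "K * (INF x\<in>?S. ?N x) \<le> K * ?N y" using K y bb by (intro mult_left_mono cINF_lower) auto
      finally show "?N x \<le> K * ?N y" .
    qed
  next
    assume *: "\<forall>x\<in>?S. \<forall>y\<in>?S. ?N x \<le> K * ?N y"
    show "(SUP x\<in>?S. ?N x) \<le> K * (INF x\<in>?S. ?N x)"
    proof (rule cSUP_least[OF ne])
      fix x assume x: "x \<in> ?S"
      have "?N x / K \<le> (INF x\<in>?S. ?N x)"
        using * x K by (intro cINF_greatest[OF ne]) (simp add: pos_divide_le_eq mult.commute)
      then show "?N x \<le> K * (INF x\<in>?S. ?N x)" using K by (simp add: pos_divide_le_eq mult.commute)
    qed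
  qed
  also have "\<dots> \<longleftrightarrow> (\<forall>x\<in>E. \<forall>y\<in>E. ?N x * nrm n y \<le> K * (?N y * nrm n x))"
  proof
    assume *: "\<forall>x\<in>?S. \<forall>y\<in>?S. ?N x \<le> K * ?N y"
    show "\<forall>x\<in>E. \<forall>y\<in>E. ?N x * nrm n y \<le> K * (?N y * nrm n x)"
    proof (intro ballI)
      fix x y assume x: "x \<in> E" and y: "y \<in> E"
      show "?N x * nrm n y \<le> K * (?N y * nrm n x)"
      proof (cases "nrm n x = 0 \<or> nrm n y = 0")
        case True
        have z: "?N v = 0" if "nrm n v = 0" for v
          using lp_norm_le_nrm[OF p, where n = n and x = v] that lp_norm_nonneg[of n p v] by simp
        then show ?thesis using True by auto
      next
        case False
        then have pos: "nrm n x > 0" "nrm n y > 0"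
          using L2_set_nonneg[of x "{..<n}"] L2_set_nonneg[of y "{..<n}"] by linarith+
        have "fscale (1 / nrm n v) v \<in> ?S" if "v \<in> E" "nrm n v > 0" for v
          using that sub by (auto intro: fvec.subspace_scale simp: nrm_scale)
        then have "?N (fscale (1 / nrm n x) x) \<le> K * ?N (fscale (1 / nrm n y) y)"
          using * x y pos by blast
        then have "?N x / nrm n x \<le> K * (?N y / nrm n y)"
          unfolding lp_norm_fscale[OF p] using pos by simp
        then show ?thesis using pos by (simp add: field_simps)
      qed
    qed
  next
    assume *: "\<forall>x\<in>E. \<forall>y\<in>E. ?N x * nrm n y \<le> K * (?N y * nrm n x)"
    show "\<forall>x\<in>?S. \<forall>y\<in>?S. ?N x \<le> K * ?N y"
    proof (intro ballI)
      fix x y assume "x \<in> ?S" "y \<in> ?S"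
      then show "?N x \<le> K * ?N y" using *[rule_format, of x y] by simp
    qed
  qed
  finally show ?thesis .
qed

lemma tendsto_lp_norm:
  assumes p: "p \<ge> 1" and "\<And>i. i < n \<Longrightarrow> (\<lambda>m. x m i) \<longlonglongrightarrow> y i"
  shows "(\<lambda>m. lp_norm n p (x m)) \<longlonglongrightarrow> lp_norm n p y"
  unfolding lp_norm_def using assms
  by (intro tendsto_powr' tendsto_sum tendsto_rabs tendsto_const) (auto intro!: always_eventually sum_nonneg)

definition proj_apply :: "nat \<Rightarrow> (nat \<Rightarrow> real) set \<Rightarrow> (nat \<Rightarrow> real) \<Rightarrow> nat \<Rightarrow> real" where
  "proj_apply n E x = (\<lambda>i. \<Sum>j<n. proj_matrix n E i j * x j)"

lemma proj_apply_eq: "E \<in> Grassmannian n k \<Longrightarrow> 0 < k \<Longrightarrow> proj_apply n E x = orth_proj n E x"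
  by (simp add: fun_eq_iff proj_apply_def orth_proj_matrix)

lemma spherical_ratvec:
  assumes E: "E \<in> Grassmannian n k" and k: "0 < k" and n: "0 < n" and p: "p \<ge> 1" and K: "K > 0"
  shows "spherical n (lp_norm n p) K E \<longleftrightarrow>
    (\<forall>a\<in>ratvec n. \<forall>b\<in>ratvec n. lp_norm n p (proj_apply n E a) * nrm n (proj_apply n E b)
      \<le> K * (lp_norm n p (proj_apply n E b) * nrm n (proj_apply n E a)))"
    (is "_ \<longleftrightarrow> (\<forall>a\<in>_. \<forall>b\<in>_. ?L a b \<le> ?R a b)")
proof -
  have "spherical n (lp_norm n p) K E \<longleftrightarrow> (\<forall>a b. ?L a b \<le> ?R a b)"
  proof -
    have "E = range (proj_apply n E)"
    proof
      show "range (proj_apply n E) \<subseteq> E" using orth_proj_props(1)[OF E k] by (auto simp: proj_apply_eq[OF E k])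
      show "E \<subseteq> range (proj_apply n E)"
      proof
        fix x assume "x \<in> E"
        then have "x = proj_apply n E x" using orth_proj_props(3)[OF E k] by (simp add: proj_apply_eq[OF E k])
        then show "x \<in> range (proj_apply n E)" by (rule range_eqI[of _ "proj_apply n E" x])
      qed
    qed
    then have *: "(\<forall>x\<in>E. Q x) \<longleftrightarrow> (\<forall>a. Q (proj_apply n E a))" for Q
      by (metis (no_types, lifting) rangeE rangeI)
    show ?thesis unfolding spherical_iff[OF assms] by (simp only: *)
  qed
  also have "\<dots> \<longleftrightarrow> (\<forall>a\<in>ratvec n. \<forall>b\<in>ratvec n. ?L a b \<le> ?R a b)"
  proof
    assume *: "\<forall>a\<in>ratvec n. \<forall>b\<in>ratvec n. ?L a b \<le> ?R a b"
    have P: "(\<lambda>m. proj_apply n E (s m) i) \<longlonglongrightarrow> proj_apply n E a i"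
      if "\<And>j. j < n \<Longrightarrow> (\<lambda>m. s m j) \<longlonglongrightarrow> a j" for s a i
      unfolding proj_apply_def using that by (intro tendsto_intros) auto
    have 1: "?L a b \<le> ?R a b" if "a \<in> ratvec n" for a b
      by (rule ratvec_closed_condition[where k = n and f = "\<lambda>b. ?L a b"])
        (use * that in \<open>auto intro!: tendsto_mult tendsto_L2_set tendsto_lp_norm P p\<close>)
    have "?L a b \<le> ?R a b" for a b
      by (rule ratvec_closed_condition[where k = n and f = "\<lambda>a. ?L a b"])
        (use 1 in \<open>auto intro!: tendsto_mult tendsto_L2_set tendsto_lp_norm P p\<close>)
    then show "\<forall>a b. ?L a b \<le> ?R a b" by blast
  qed auto
  finally show ?thesis .
qed

lemma spherical_sets:
  assumes k: "0 < k" and n: "0 < n" and p: "p \<ge> 1" and K: "K > 0"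
  shows "{E \<in> Grassmannian n k. spherical n (lp_norm n p) K E} \<in> sets (Gr_borel n k)"
proof -
  let ?M = "Gr_borel n k"
  have c: "(\<lambda>E. proj_apply n E a i) \<in> borel_measurable ?M" for a i
    unfolding proj_apply_def
    by (intro borel_measurable_sum borel_measurable_times borel_measurable_const measurable_proj_matrix)
  have r: "(\<lambda>E. nrm n (proj_apply n E a)) \<in> borel_measurable ?M" for a
    unfolding L2_set_def
    by (intro measurable_compose[OF _ borel_measurable_sqrt] borel_measurable_sum borel_measurable_power c)
  have l: "(\<lambda>E. lp_norm n p (proj_apply n E a)) \<in> borel_measurable ?M" for a
    unfolding lp_norm_def
    by (intro powr_real_measurable borel_measurable_sum borel_measurable_abs borel_measurable_const c)
  have "{E \<in> space ?M. \<forall>a\<in>ratvec n. \<forall>b\<in>ratvec n. lp_norm n p (proj_apply n E a) * nrm n (proj_apply n E b)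
      \<le> K * (lp_norm n p (proj_apply n E b) * nrm n (proj_apply n E a))} \<in> sets ?M"
    by (intro sets.sets_Collect_countable_All' countable_ratvec borel_measurable_le borel_measurable_times
        borel_measurable_const r l)
  moreover have "{E \<in> Grassmannian n k. spherical n (lp_norm n p) K E}
    = {E \<in> space ?M. \<forall>a\<in>ratvec n. \<forall>b\<in>ratvec n. lp_norm n p (proj_apply n E a) * nrm n (proj_apply n E b)
      \<le> K * (lp_norm n p (proj_apply n E b) * nrm n (proj_apply n E a))}"
    using spherical_ratvec[OF _ assms] by auto
  ultimately show ?thesis by simp
qed

text \<open>
  Nearness controls the vectors in the span of \<open>Y\<close> only. The projection onto \<open>E\<close> is injective on
  this span, and both spaces have dimension \<open>k\<close>, so every vector of \<open>E\<close> is the projection of a vector in the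
  span.
\<close>

lemma close_to_surj:
  assumes E: "E \<in> Grassmannian n k" and k: "0 < k" and t: "t < 1" and \<beta>: "\<beta> > 0"
    and wc: "well_cond n k \<beta> Y" and cl: "close_to n t (colspan n k Y) E" and x: "x \<in> E"
  obtains a where "nrm n (comb n k a Y - x) \<le> t * nrm n (comb n k a Y)"
proof -
  have pn: "nrm n (comb n k a Y - orth_proj n E (comb n k a Y)) \<le> t * nrm n (comb n k a Y)" for a
  proof -
    obtain z where "z \<in> E" "nrm n (comb n k a Y - z) \<le> t * nrm n (comb n k a Y)"
      using cl unfolding close_to_def colspan_def by blast
    then show ?thesis using orth_proj_props(4)[OF E k] order_trans by blast
  qed
  define u where "u j = orth_proj n E (column n Y j)" for j
  have lin: "lincomb k u a = orth_proj n E (comb n k a Y)" for a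
  proof
    fix i
    have "lincomb k u a i = (\<Sum>l<k. \<Sum>j<n. a l * (proj_matrix n E i j * column n Y l j))"
      by (simp add: lincomb_apply u_def orth_proj_matrix[OF E k] sum_distrib_left)
    also have "\<dots> = (\<Sum>j<n. proj_matrix n E i j * comb n k a Y j)"
      unfolding comb_lincomb lincomb_apply by (subst sum.swap) (simp add: sum_distrib_left mult_ac)
    finally show "lincomb k u a i = orth_proj n E (comb n k a Y) i"
      by (simp add: orth_proj_matrix[OF E k])
  qed
  have "lin_indep k u"
    unfolding lin_indep_def lin
  proof (intro allI impI)
    fix a j assume a: "orth_proj n E (comb n k a Y) = 0" and j: "j < k"
    have "nrm n (comb n k a Y) \<le> t * nrm n (comb n k a Y)" using pn[of a] a by simp
    then have "nrm n (comb n k a Y) = 0"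
    proof -
      have "(1 - t) * nrm n (comb n k a Y) \<le> 0" using \<open>nrm n (comb n k a Y) \<le> t * nrm n (comb n k a Y)\<close>
        by (simp add: algebra_simps)
      then show ?thesis using t L2_set_nonneg[of "comb n k a Y" "{..<n}"] by (simp add: mult_le_0_iff)
    qed
    then have "comb n k a Y = 0" using nrm_pos[of "comb n k a Y" n] by (auto simp: Rn_def comb_def)
    then show "a j = 0"
      using well_cond_lin_indep[OF wc \<beta>] j unfolding lin_indep_def comb_lincomb by blast
  qed
  then have "E = range (lincomb k u)"
    using orth_proj_props(1)[OF E k] by (intro Grassmannian_lin_indep_spans[OF E k]) (auto simp: u_def)
  then obtain a where "x = orth_proj n E (comb n k a Y)" using x unfolding lin by auto
  then show thesis using that pn by blast
qed

lemma near_isometry_well_cond: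
  assumes c: "c > 0" and \<epsilon>: "0 < \<epsilon>" "\<epsilon> < 1"
    and R: "\<And>a. \<bar>nrm n (comb n k a Y) - c * nrm k a\<bar> \<le> \<epsilon> / 16 * (c * nrm k a)"
  shows "well_cond n k (c / 2) Y"
  unfolding well_cond_def
proof
  fix a
  have "\<epsilon> / 16 * (c * nrm k a) \<le> 1 / 2 * (c * nrm k a)"
    using \<epsilon> c by (intro mult_right_mono) auto
  then have "c * nrm k a - 1 / 2 * (c * nrm k a) \<le> nrm n (comb n k a Y)"
    using R[of a] by linarith
  then show "c / 2 * nrm k a \<le> nrm n (comb n k a Y)" by simp
qed

text \<open>
  If both norms of \<open>Y a\<close> are known up to a factor \<open>1 \<plusminus> \<theta>\<close>, passing to \<open>E\<close> with small \<open>t\<close> loses another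
  such factor for each of them. The resulting quotient is at most
  \<open>(1 + \<theta>)\<^sup>4 / ((1 - 3 \<theta>) (1 - \<theta>)\<^sup>2)\<close>, which is below \<open>1 + 16 \<theta>\<close>.
\<close>

lemma near_isometry_imp_spherical:
  assumes E: "E \<in> Grassmannian n k" and k: "0 < k" and n: "0 < n" and p: "p \<ge> 1"
    and \<epsilon>: "0 < \<epsilon>" "\<epsilon> < 1" and \<theta>: "\<theta> = \<epsilon> / 16" and bc: "b > 0" "c > 0"
    and N: "\<And>a. \<bar>lp_norm n p (comb n k a Y) - b * nrm k a\<bar> \<le> \<theta> * (b * nrm k a)"
    and R: "\<And>a. \<bar>nrm n (comb n k a Y) - c * nrm k a\<bar> \<le> \<theta> * (c * nrm k a)"
    and t: "0 < t" "t \<le> \<theta>" "real n * t * c \<le> \<theta> * b"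
    and cl: "close_to n t (colspan n k Y) E"
  shows "spherical n (lp_norm n p) (1 + \<epsilon>) E"
proof -
  have \<theta>0: "0 < \<theta>" "\<theta> \<le> 1 / 16" using \<epsilon> by (auto simp: \<theta>)
  have wc: "well_cond n k (c / 2) Y"
    using R unfolding \<theta> by (intro near_isometry_well_cond[OF bc(2) \<epsilon>])
  have key: "\<exists>r\<ge>0. b * (1 - 3 * \<theta>) * r \<le> lp_norm n p x \<and> lp_norm n p x \<le> b * (1 + \<theta>)\<^sup>2 * r \<and>
      c * (1 - \<theta>)\<^sup>2 * r \<le> nrm n x \<and> nrm n x \<le> c * (1 + \<theta>)\<^sup>2 * r" if x: "x \<in> E" for x
  proof -
    have t1: "t < 1" and c2: "c / 2 > 0" using t \<theta>0 bc by auto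
    obtain a where a: "nrm n (comb n k a Y - x) \<le> t * nrm n (comb n k a Y)"
      by (rule close_to_surj[OF E k t1 c2 wc cl x])
    define r where "r = nrm k a"
    define y where "y = comb n k a Y"
    have r: "r \<ge> 0" by (simp add: r_def)
    have Ny: "b * (1 - \<theta>) * r \<le> lp_norm n p y" "lp_norm n p y \<le> b * (1 + \<theta>) * r"
      using N[of a] by (simp_all add: r_def[symmetric] y_def[symmetric] abs_le_iff algebra_simps)
    have Ry: "c * (1 - \<theta>) * r \<le> nrm n y" "nrm n y \<le> c * (1 + \<theta>) * r"
      using R[of a] by (simp_all add: r_def[symmetric] y_def[symmetric] abs_le_iff algebra_simps)
    have yx: "nrm n (y - x) \<le> t * nrm n y" using a by (simp add: y_def)
    have "\<bar>lp_norm n p x - lp_norm n p y\<bar> \<le> real n * (t * nrm n y)" by (rule lp_norm_perturb[OF p yx])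
    also have "\<dots> \<le> real n * (t * (c * (1 + \<theta>) * r))" using Ry(2) t by (intro mult_left_mono) auto
    also have "\<dots> = real n * t * c * ((1 + \<theta>) * r)" by simp
    also have "\<dots> \<le> \<theta> * b * ((1 + \<theta>) * r)" using t(3) \<theta>0 r by (intro mult_right_mono) auto
    finally have D: "\<bar>lp_norm n p x - lp_norm n p y\<bar> \<le> \<theta> * b * ((1 + \<theta>) * r)" .
    have up: "lp_norm n p x \<le> b * (1 + \<theta>)\<^sup>2 * r"
      using D Ny(2) by (simp add: power2_eq_square algebra_simps abs_le_iff)
    have lo: "b * (1 - 3 * \<theta>) * r \<le> lp_norm n p x"
    proof -
      have "\<theta> * \<theta> * (b * r) \<le> \<theta> * (b * r)" using \<theta>0 bc r by (intro mult_right_mono) auto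
      moreover have "b * (1 - \<theta>) * r - \<theta> * b * ((1 + \<theta>) * r) \<le> lp_norm n p x" using D Ny(1) by linarith
      ultimately show ?thesis by (simp add: algebra_simps)
    qed
    have tri: "nrm n x \<le> nrm n y + nrm n (y - x)" "nrm n y \<le> nrm n x + nrm n (y - x)"
      using nrm_triangle[where n = n and x = y and y = "x - y"] nrm_triangle[where n = n and x = x and y = "y - x"]
      by (simp_all add: nrm_minus_commute[where x = x])
    have ty: "t * nrm n y \<le> \<theta> * nrm n y" using t by (intro mult_right_mono) auto
    have "nrm n x \<le> (1 + \<theta>) * nrm n y" using tri yx ty by (simp add: algebra_simps)
    also have "\<dots> \<le> (1 + \<theta>) * (c * (1 + \<theta>) * r)" using Ry \<theta>0 by (intro mult_left_mono) auto
    finally have rup: "nrm n x \<le> c * (1 + \<theta>)\<^sup>2 * r" by (simp add: power2_eq_square mult_ac)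
    have "(1 - \<theta>) * (c * (1 - \<theta>) * r) \<le> (1 - \<theta>) * nrm n y" using Ry \<theta>0 by (intro mult_left_mono) auto
    also have "\<dots> \<le> nrm n x" using tri yx ty by (simp add: algebra_simps)
    finally have rlo: "c * (1 - \<theta>)\<^sup>2 * r \<le> nrm n x" by (simp add: power2_eq_square mult_ac)
    show ?thesis using r up lo rup rlo by blast
  qed
  show ?thesis
    unfolding spherical_iff[OF E k n p, of "1 + \<epsilon>", simplified, OF add_pos_pos[OF zero_less_one \<epsilon>(1)]]
  proof (intro ballI)
    fix x y assume "x \<in> E" "y \<in> E"
    then obtain r s where r: "r \<ge> 0" "lp_norm n p x \<le> b * (1 + \<theta>)\<^sup>2 * r" "c * (1 - \<theta>)\<^sup>2 * r \<le> nrm n x"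
      and s: "s \<ge> 0" "b * (1 - 3 * \<theta>) * s \<le> lp_norm n p y" "nrm n y \<le> c * (1 + \<theta>)\<^sup>2 * s"
      using key by metis
    have "lp_norm n p x * nrm n y \<le> (b * (1 + \<theta>)\<^sup>2 * r) * (c * (1 + \<theta>)\<^sup>2 * s)"
      using r s \<theta>0 bc by (intro mult_mono) auto
    also have "\<dots> = (1 + \<theta>)^4 * (b * c * r * s)" by (simp add: power2_eq_square power4_eq_xxxx)
    also have "\<dots> \<le> ((1 + \<epsilon>) * ((1 - 3 * \<theta>) * (1 - \<theta>)\<^sup>2)) * (b * c * r * s)"
    proof (rule mult_right_mono)
      have q: "\<theta>\<^sup>2 \<le> \<theta> / 16" using \<theta>0 by (simp add: power2_eq_square)
      have q3: "\<theta>^3 \<le> \<theta>\<^sup>2" "\<theta>^4 \<le> \<theta>\<^sup>2" using \<theta>0 by (auto intro!: power_decreasing)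
      have "(1 + \<theta>)^4 = 1 + 4 * \<theta> + 6 * \<theta>\<^sup>2 + 4 * \<theta>^3 + \<theta>^4"
        by (simp add: power4_eq_xxxx power3_eq_cube power2_eq_square algebra_simps)
      then have "(1 + \<theta>)^4 \<le> 1 + 5 * \<theta>" using q q3 \<theta>0 by linarith
      also have "\<dots> \<le> (1 + \<epsilon>) * (1 - 5 * \<theta>)"
      proof -
        have "\<epsilon> * \<epsilon> \<le> 1 * \<epsilon>" using \<epsilon> by (intro mult_right_mono) auto
        moreover have "(1 + \<epsilon>) * (1 - 5 * \<theta>) = 1 + \<epsilon> - 5 / 16 * \<epsilon> - 5 / 16 * (\<epsilon> * \<epsilon>)"
          by (simp add: \<theta> field_simps)
        ultimately show ?thesis using \<epsilon> \<theta> by linarith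
      qed
      also have "\<dots> \<le> (1 + \<epsilon>) * ((1 - 3 * \<theta>) * (1 - \<theta>)\<^sup>2)"
      proof (rule mult_left_mono)
        have "(1 - 3 * \<theta>) * (1 - \<theta>)\<^sup>2 = 1 - 5 * \<theta> + 7 * \<theta>\<^sup>2 - 3 * \<theta>^3"
          by (simp add: power3_eq_cube power2_eq_square algebra_simps)
        then show "1 - 5 * \<theta> \<le> (1 - 3 * \<theta>) * (1 - \<theta>)\<^sup>2" using q3 zero_le_power2[of \<theta>] by linarith
      qed (use \<epsilon> in simp)
      finally show "(1 + \<theta>)^4 \<le> (1 + \<epsilon>) * ((1 - 3 * \<theta>) * (1 - \<theta>)\<^sup>2)" .
    qed (use bc r s in simp)
    also have "\<dots> = (1 + \<epsilon>) * ((b * (1 - 3 * \<theta>) * s) * (c * (1 - \<theta>)\<^sup>2 * r))" by (simp add: mult_ac)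
    also have "\<dots> \<le> (1 + \<epsilon>) * (lp_norm n p y * nrm n x)"
      using r s \<theta>0 bc \<epsilon> by (intro mult_left_mono mult_mono) (auto simp: lp_norm_nonneg)
    finally show "lp_norm n p x * nrm n y \<le> (1 + \<epsilon>) * (lp_norm n p y * nrm n x)" .
  qed
qed

section \<open>Exponents below the critical one\<close>

lemma comb_scale: "comb n k (\<lambda>j. c * a j) Y = (\<lambda>i. c * comb n k a Y i)"
  by (auto simp: comb_def fun_eq_iff sum_distrib_left mult.assoc)

lemma comb_add: "comb n k (\<lambda>j. a j + b j) Y = (\<lambda>i. comb n k a Y i + comb n k b Y i)"
  by (auto simp: comb_def fun_eq_iff sum.distrib algebra_simps)

lemma lp_norm_comb_near_constant:
  assumes p: "p \<ge> 1" and \<theta>: "0 < \<theta>" "\<theta> \<le> 1 / 3" and b: "b \<ge> 0"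
    and N: "\<And>d. d \<in> N \<Longrightarrow> nrm k d = 1"
      "\<And>a. nrm k a = 1 \<Longrightarrow> \<exists>d\<in>N. nrm k (\<lambda>j. a j - d j) \<le> \<theta>"
    and near: "\<And>d. d \<in> N \<Longrightarrow> \<bar>lp_norm n p (comb n k d Y) - b\<bar> \<le> \<theta> * b"
  shows "\<bar>lp_norm n p (comb n k a Y) - b * nrm k a\<bar> \<le> 3 * \<theta> * (b * nrm k a)"
proof -
  let ?f = "\<lambda>a. lp_norm n p (comb n k a Y)"
  have cong: "?f a = ?f a'" if "\<And>j. j < k \<Longrightarrow> a j = a' j" for a a'
    using that by (intro lp_norm_cong) (simp add: comb_def)
  have scale: "?f (\<lambda>j. c * a j) = \<bar>c\<bar> * ?f a" for c a
    unfolding comb_scale by (rule lp_norm_scale[OF p])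
  have unit: "\<bar>?f a - b\<bar> \<le> 3 * \<theta> * b" if a: "nrm k a = 1" for a
  proof (rule seminorm_near_constant_on_sphere[where N = N and f = ?f and k = k])
    show "?f a \<le> ?f a' + ?f (\<lambda>j. a j - a' j)" for a a'
    proof -
      have "comb n k a Y = (\<lambda>i. comb n k a' Y i + comb n k (\<lambda>j. a j - a' j) Y i)"
        using comb_add[of n k a' "\<lambda>j. a j - a' j" Y] by simp
      then show ?thesis using lp_norm_triangle[OF p] by metis
    qed
    show "?f a \<le> lp_norm n p (\<lambda>i. \<Sum>j<k. \<bar>Y (i, j)\<bar>)" if a: "nrm k a = 1" for a
    proof (rule lp_norm_mono[OF p])
      fix i assume i: "i < n"
      have "\<bar>comb n k a Y i\<bar> \<le> (\<Sum>j<k. \<bar>a j * Y (i, j)\<bar>)" using i by (simp add: comb_def sum_abs)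
      also have "\<dots> \<le> (\<Sum>j<k. \<bar>Y (i, j)\<bar>)"
      proof (rule sum_mono)
        fix j assume "j \<in> {..<k}"
        then have "\<bar>a j\<bar> \<le> 1" using member_le_L2_set[of "{..<k}" j "\<lambda>j. \<bar>a j\<bar>"] a by (simp add: L2_set_def)
        then show "\<bar>a j * Y (i, j)\<bar> \<le> \<bar>Y (i, j)\<bar>" by (simp add: abs_mult mult_left_le_one_le)
      qed
      finally show "\<bar>comb n k a Y i\<bar> \<le> \<bar>\<Sum>j<k. \<bar>Y (i, j)\<bar>\<bar>" by simp
    qed
    show "nrm k d = 1" if "d \<in> N" for d by (rule N(1)[OF that])
    show "\<exists>d\<in>N. nrm k (\<lambda>j. a j - d j) \<le> \<theta>" if "nrm k a = 1" for a by (rule N(2)[OF that])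
    show "\<bar>?f d - b\<bar> \<le> \<theta> * b" if "d \<in> N" for d by (rule near[OF that])
    show "?f (\<lambda>j. c * a j) = \<bar>c\<bar> * ?f a" for c a by (rule scale)
    show "?f a = ?f a'" if "\<And>j. j < k \<Longrightarrow> a j = a' j" for a a' by (rule cong[OF that])
  qed (rule \<theta> b a)+
  let ?r = "nrm k a"
  show ?thesis
  proof (cases "?r = 0")
    case True
    then have "?f a = ?f (\<lambda>j. 0 * a j)" by (intro cong) (simp add: L2_set_eq_0_iff)
    then have "?f a = 0" unfolding scale by simp
    then show ?thesis using True by simp
  next
    case False
    then have r: "?r > 0" using L2_set_nonneg[of a "{..<k}"] by linarith
    have "L2_set (\<lambda>j. (1 / ?r) * a j) {..<k} = (1 / ?r) * ?r"
      using r by (subst L2_set_right_distrib[symmetric]) auto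
    then have "\<bar>(1 / ?r) * ?f a - b\<bar> \<le> 3 * \<theta> * b" using unit[of "\<lambda>j. (1 / ?r) * a j"] r unfolding scale by simp
    then have "?r * \<bar>(1 / ?r) * ?f a - b\<bar> \<le> ?r * (3 * \<theta> * b)" using r by (intro mult_left_mono) auto
    also have "?r * \<bar>(1 / ?r) * ?f a - b\<bar> = \<bar>?r * ((1 / ?r) * ?f a - b)\<bar>" using r by (simp only: abs_mult abs_of_pos)
    also have "?r * ((1 / ?r) * ?f a - b) = ?f a - b * ?r" using r by (simp add: right_diff_distrib)
    finally show ?thesis by (simp add: mult_ac)
  qed
qed

lemma gmat_lp_norm_measurable: "(\<lambda>Y. lp_norm n p (comb n k a Y)) \<in> borel_measurable (gmat n k)"
  unfolding lp_norm_def
  by (intro powr_real_measurable borel_measurable_sum borel_measurable_abs borel_measurable_const comb_measurable)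

lemma deviation_sets:
  fixes f :: "'a \<Rightarrow> real"
  assumes "f \<in> borel_measurable M"
  shows "{x \<in> space M. \<not> \<bar>f x - b\<bar> < r} \<in> sets M"
  using assms by measurable

lemma gmat_lp_norm_deviation:
  assumes k: "0 < k" and a: "nrm k a = 1"
  shows "measure (gmat n k) {Y \<in> space (gmat n k). \<not> \<bar>lp_norm n p (comb n k a Y) - b\<bar> < r}
    = measure (gauss {..<n}) {x \<in> space (gauss {..<n}). \<not> \<bar>lp_norm n p x - b\<bar> < r}"
proof (rule measure_gmat_comb[OF k])
  show "(\<Sum>j<k. (a j)\<^sup>2) = 1"
    using a by (simp add: L2_set_def)
  show "Measurable.pred (gauss {..<n}) (\<lambda>x. \<not> \<bar>lp_norm n p x - b\<bar> < r)"
    unfolding pred_def by (intro deviation_sets lp_norm_measurable)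
  show "(\<not> \<bar>lp_norm n p x - b\<bar> < r) = (\<not> \<bar>lp_norm n p y - b\<bar> < r)" if "\<And>i. i < n \<Longrightarrow> x i = y i" for x y
    using lp_norm_cong[where n = n and x = x and y = y and p = p] that by simp
qed

abbreviation net_bound :: "real \<Rightarrow> nat \<Rightarrow> nat \<Rightarrow> real \<Rightarrow> real" where
  "net_bound \<delta> n k \<epsilon> \<equiv> 30000 * ln n * n powr (- (\<delta>\<^sup>2 / 16)) * (1152 / \<epsilon>) ^ k * (48 / \<epsilon>)\<^sup>2"

lemma gaussian_matrix_near_isometry:
  fixes \<delta> \<epsilon> p :: real and n k :: nat
  assumes \<delta>: "0 < \<delta>" "\<delta> < 1" and n: "n \<ge> 1" and k: "0 < k" and p: "2 \<le> p" "p \<le> (2 - \<delta>) * ln n"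
    and \<epsilon>: "0 < \<epsilon>" "\<epsilon> < 1"
  obtains b c G where "b > 0" "c > 0" "G \<in> sets (gmat n k)"
    "1 - net_bound \<delta> n k \<epsilon> \<le> measure (gmat n k) G"
    "\<And>Y a. Y \<in> G \<Longrightarrow> \<bar>lp_norm n p (comb n k a Y) - b * nrm k a\<bar> \<le> \<epsilon> / 16 * (b * nrm k a)"
    "\<And>Y a. Y \<in> G \<Longrightarrow> \<bar>nrm n (comb n k a Y) - c * nrm k a\<bar> \<le> \<epsilon> / 16 * (c * nrm k a)"
proof -
  interpret prob_space "gmat n k" by (rule prob_space_gauss)
  define \<theta> where "\<theta> = \<epsilon> / 48"
  have \<theta>: "0 < \<theta>" "\<theta> \<le> 1" "\<theta> \<le> 1 / 3" using \<epsilon> by (auto simp: \<theta>_def)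
  have two: "(2::real) \<le> (2 - \<delta>) * ln n" using p by linarith
  define q where "q = deviation_bound \<delta> n \<theta>"
  obtain b where b: "b > 0" "measure (gauss {..<n}) {x \<in> space (gauss {..<n}). \<not> \<bar>lp_norm n p x - b\<bar> < \<theta> * b} \<le> q"
    using gauss_lp_norm_concentration[OF \<delta> n p] \<theta>(1,2) unfolding q_def by blast
  obtain c where c: "c > 0" "measure (gauss {..<n}) {x \<in> space (gauss {..<n}). \<not> \<bar>lp_norm n 2 x - c\<bar> < \<theta> * c} \<le> q"
    using gauss_lp_norm_concentration[OF \<delta> n order_refl two] \<theta>(1,2) unfolding q_def by blast
  obtain N :: "(nat \<Rightarrow> real) set" where N: "finite N" "real (card N) \<le> (24 / \<theta>) ^ k"
    "\<And>d. d \<in> N \<Longrightarrow> nrm k d = 1"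
    "\<And>a. nrm k a = 1 \<Longrightarrow> \<exists>d\<in>N. nrm k (\<lambda>j. a j - d j) \<le> \<theta>"
    using sphere_net[OF k \<theta>(1,2)] by blast
  define A where "A d = {Y \<in> space (gmat n k). \<not> \<bar>lp_norm n p (comb n k d Y) - b\<bar> < \<theta> * b}" for d
  define C where "C d = {Y \<in> space (gmat n k). \<not> \<bar>lp_norm n 2 (comb n k d Y) - c\<bar> < \<theta> * c}" for d
  have As: "A d \<in> sets (gmat n k)" for d
    unfolding A_def by (intro deviation_sets gmat_lp_norm_measurable)
  have Cs: "C d \<in> sets (gmat n k)" for d
    unfolding C_def by (intro deviation_sets gmat_lp_norm_measurable)
  define U where "U = (\<Union>d\<in>N. A d \<union> C d)"
  have Us: "U \<in> sets (gmat n k)" unfolding U_def using N(1) As Cs by (intro sets.finite_UN sets.Un)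
  have "measure (gmat n k) U \<le> (\<Sum>d\<in>N. measure (gmat n k) (A d \<union> C d))"
    unfolding U_def using N(1) As Cs by (intro measure_UNION_le sets.Un)
  also have "\<dots> \<le> (\<Sum>d\<in>N. q + q)"
  proof (rule sum_mono)
    fix d assume d: "d \<in> N"
    have "measure (gmat n k) (A d \<union> C d) \<le> measure (gmat n k) (A d) + measure (gmat n k) (C d)"
      using As Cs by (intro measure_Un_le)
    also have "\<dots> \<le> q + q"
      unfolding A_def C_def gmat_lp_norm_deviation[OF k N(3)[OF d]] using b(2) c(2) by (rule add_mono)
    finally show "measure (gmat n k) (A d \<union> C d) \<le> q + q" .
  qed
  also have "\<dots> = real (card N) * (2 * q)" by simp
  also have "\<dots> \<le> (24 / \<theta>) ^ k * (2 * q)"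
    using n by (intro mult_right_mono N(2)) (auto simp: q_def)
  also have "\<dots> = net_bound \<delta> n k \<epsilon>"
    unfolding q_def \<theta>_def by (simp add: power_divide)
  finally have mU: "measure (gmat n k) U \<le> net_bound \<delta> n k \<epsilon>" .
  define G where "G = space (gmat n k) - U"
  show thesis
  proof (rule that[of b c G])
    show "G \<in> sets (gmat n k)" unfolding G_def by (intro sets.Diff sets.top Us)
    show "1 - net_bound \<delta> n k \<epsilon> \<le> measure (gmat n k) G"
      unfolding G_def prob_compl[OF Us] using mU by simp
    fix Y a assume "Y \<in> G"
    then have Y: "\<bar>lp_norm n p (comb n k d Y) - b\<bar> < \<theta> * b" "\<bar>lp_norm n 2 (comb n k d Y) - c\<bar> < \<theta> * c"
      if "d \<in> N" for d using that unfolding G_def U_def A_def C_def by auto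
    have "\<bar>lp_norm n p (comb n k a Y) - b * nrm k a\<bar> \<le> 3 * \<theta> * (b * nrm k a)"
      by (rule lp_norm_comb_near_constant[OF _ \<theta>(1,3) _ N(3,4)]) (use p b Y(1) in \<open>auto intro: less_imp_le\<close>)
    then show "\<bar>lp_norm n p (comb n k a Y) - b * nrm k a\<bar> \<le> \<epsilon> / 16 * (b * nrm k a)"
      by (simp add: \<theta>_def)
    have "\<bar>lp_norm n 2 (comb n k a Y) - c * nrm k a\<bar> \<le> 3 * \<theta> * (c * nrm k a)"
      by (rule lp_norm_comb_near_constant[OF _ \<theta>(1,3) _ N(3,4)]) (use c Y(2) in \<open>auto intro: less_imp_le\<close>)
    then show "\<bar>nrm n (comb n k a Y) - c * nrm k a\<bar> \<le> \<epsilon> / 16 * (c * nrm k a)"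
      by (simp add: \<theta>_def lp_norm_2)
  qed (use b c in auto)
qed

lemma uniform_space: "uniform_Gr n k \<mu> \<Longrightarrow> space \<mu> = Grassmannian n k"
  "uniform_Gr n k \<mu> \<Longrightarrow> sets \<mu> = sets (Gr_borel n k)"
  using sets_eq_imp_space_eq[of \<mu> "Gr_borel n k"] by (auto simp: uniform_Gr_def)

text \<open>
  The probability \<open>q\<close> of a bad matrix enters twice: once for \<open>G\<close>, and once because the transfer divides
  by the probability of being well conditioned, which is at least \<open>1 / 2\<close>.
\<close>

lemma random_subspace_spherical:
  fixes \<delta> \<epsilon> p :: real and n k :: nat
  assumes \<delta>: "0 < \<delta>" "\<delta> < 1" and n: "n \<ge> 1" and k: "0 < k" "k \<le> n" and p: "2 \<le> p" "p \<le> (2 - \<delta>) * ln n"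
    and \<epsilon>: "0 < \<epsilon>" "\<epsilon> < 1" and \<mu>: "uniform_Gr n k \<mu>"
    and q: "net_bound \<delta> n k \<epsilon> \<le> q" "q \<le> 1 / 2"
  shows "measure \<mu> {E \<in> space \<mu>. spherical n (lp_norm n p) (1 + \<epsilon>) E} \<ge> 1 - 2 * q"
proof -
  interpret \<mu>: prob_space \<mu> using \<mu> by (simp add: uniform_Gr_def)
  interpret \<gamma>: prob_space "gmat n k" by (rule prob_space_gauss)
  obtain b c G where G: "b > 0" "c > 0" "G \<in> sets (gmat n k)"
    "1 - net_bound \<delta> n k \<epsilon> \<le> measure (gmat n k) G"
    "\<And>Y a. Y \<in> G \<Longrightarrow> \<bar>lp_norm n p (comb n k a Y) - b * nrm k a\<bar> \<le> \<epsilon> / 16 * (b * nrm k a)"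
    "\<And>Y a. Y \<in> G \<Longrightarrow> \<bar>nrm n (comb n k a Y) - c * nrm k a\<bar> \<le> \<epsilon> / 16 * (c * nrm k a)"
    by (rule gaussian_matrix_near_isometry[OF \<delta> n k(1) p \<epsilon>]) blast
  have mG: "1 - q \<le> measure (gmat n k) G" using G(4) q by linarith
  let ?S = "{E \<in> space \<mu>. spherical n (lp_norm n p) (1 + \<epsilon>) E}"
  have S: "?S \<in> sets \<mu>"
    unfolding uniform_space[OF \<mu>] using k n p \<epsilon> by (intro spherical_sets) auto
  \<comment> \<open>small compared with the ratio of the two norms, which may depend on \<open>n\<close>\<close>
  define t where "t = min (\<epsilon> / 16) (\<epsilon> / 16 * b / (real n * c))"
  have t: "0 < t" "t \<le> \<epsilon> / 16" "t \<le> 1" "real n * t * c \<le> \<epsilon> / 16 * b"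
  proof -
    show "0 < t" "t \<le> \<epsilon> / 16" "t \<le> 1" using \<epsilon> G n by (auto simp: t_def)
    have "real n * t * c \<le> real n * (\<epsilon> / 16 * b / (real n * c)) * c"
      using G n by (intro mult_right_mono mult_left_mono) (auto simp: t_def)
    also have "\<dots> = \<epsilon> / 16 * b" using G n by simp
    finally show "real n * t * c \<le> \<epsilon> / 16 * b" .
  qed
  let ?J = "{Y \<in> space (gmat n k). well_cond n k (c / 2) Y}"
  have "measure \<mu> (space \<mu> - ?S) * measure (gmat n k) ?J \<le> 1 - measure (gmat n k) G"
  proof (rule uniform_Gr_transfer[OF \<mu> k t(1) t(3)])
    show "space \<mu> - ?S \<in> sets \<mu>" by (intro sets.Diff sets.top S)
    show "G \<in> sets (gmat n k)" by (rule G)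
    fix E Y assume E: "E \<in> space \<mu> - ?S" and Y: "Y \<in> G" and cl: "close_to n t (colspan n k Y) E"
    have "E \<in> Grassmannian n k" using E uniform_space[OF \<mu>] by auto
    then have "spherical n (lp_norm n p) (1 + \<epsilon>) E"
      by (rule near_isometry_imp_spherical[OF _ k(1) _ _ \<epsilon> refl G(1,2) G(5)[OF Y] G(6)[OF Y] t(1,2,4) cl])
        (use n p in auto)
    then show False using E by auto
  qed (use G in simp)
  also have "\<dots> \<le> q" using mG by simp
  finally have A: "measure \<mu> (space \<mu> - ?S) * measure (gmat n k) ?J \<le> q" .
  have "measure (gmat n k) G \<le> measure (gmat n k) ?J"
  proof (rule \<gamma>.finite_measure_mono)
    show "G \<subseteq> ?J" using near_isometry_well_cond[OF G(2) \<epsilon> G(6)] sets.sets_into_space[OF G(3)] by blast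
  qed (rule well_cond_sets)
  then have "1 / 2 \<le> measure (gmat n k) ?J" using mG q by linarith
  then have "measure \<mu> (space \<mu> - ?S) * (1 / 2) \<le> measure \<mu> (space \<mu> - ?S) * measure (gmat n k) ?J"
    by (intro mult_left_mono) auto
  then have "measure \<mu> (space \<mu> - ?S) \<le> 2 * q" using A by simp
  then show ?thesis unfolding \<mu>.prob_compl[OF S] by simp
qed

section \<open>The size of the largest Gaussian coordinate\<close>

lemma nn_integral_exponential:
  fixes C l :: real
  assumes l: "l > 0" and C: "C \<ge> 0"
  shows "(\<integral>\<^sup>+y. ennreal (C * exp (- l * y)) * indicator {0..} y \<partial>lborel) = ennreal (C / l)"
proof -
  have "((\<lambda>x. - (C / l) * exp (- l * x)) \<longlongrightarrow> - (C / l) * 0) at_top"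
  proof (intro tendsto_mult tendsto_const filterlim_compose[OF exp_at_bot])
    show "LIM x at_top. - l * x :> at_bot"
      using l by (simp add: filterlim_uminus_at_bot filterlim_tendsto_pos_mult_at_top[OF tendsto_const _ filterlim_ident])
  qed
  then have "(\<integral>\<^sup>+y. ennreal (C * exp (- l * y)) * indicator {0..} y \<partial>lborel) = ennreal (- (C / l) * 0 - (- (C / l) * exp (- l * 0)))"
    using l C by (intro nn_integral_FTC_atLeast) (auto intro!: derivative_eq_intros)
  then show ?thesis by simp
qed

text \<open>
  Folds the real line, so that only an integrable majorant on the positive half line is needed.
\<close>

lemma nn_integral_std_normal_even_le:
  fixes g h :: "real \<Rightarrow> real"
  assumes g: "g \<in> borel_measurable borel" and h: "h \<in> borel_measurable borel"
    and le: "\<And>x. x \<ge> 0 \<Longrightarrow> g x * std_normal_density x \<le> h x" and g0: "\<And>x. g x \<ge> 0"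
  shows "(\<integral>\<^sup>+x. ennreal (g \<bar>x\<bar>) \<partial>std_normal) \<le> 2 * (\<integral>\<^sup>+x. ennreal (h x) * indicator {0..} x \<partial>lborel)"
proof -
  let ?f = "\<lambda>x. ennreal (h x) * indicator {0..} x"
  have fm: "?f \<in> borel_measurable borel" using h by measurable
  have "(\<integral>\<^sup>+x. ennreal (g \<bar>x\<bar>) \<partial>std_normal) = (\<integral>\<^sup>+x. ennreal (std_normal_density x) * ennreal (g \<bar>x\<bar>) \<partial>lborel)"
    using g by (subst nn_integral_density) auto
  also have "\<dots> \<le> (\<integral>\<^sup>+x. ?f x + ?f (- x) \<partial>lborel)"
  proof (rule nn_integral_mono)
    fix x :: real
    have n: "std_normal_density (- x) = std_normal_density x" by (simp add: std_normal_density_def)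
    have "ennreal (std_normal_density x) * ennreal (g \<bar>x\<bar>) = ennreal (g \<bar>x\<bar> * std_normal_density x)"
      using g0 by (simp add: ennreal_mult mult.commute)
    also have "\<dots> \<le> ?f x + ?f (- x)"
    proof (cases "x \<ge> 0")
      case True
      then have "ennreal (g \<bar>x\<bar> * std_normal_density x) \<le> ?f x" using le[of x] by (simp add: ennreal_leI)
      then show ?thesis by (rule order_trans) simp
    next
      case False
      then have "ennreal (g \<bar>x\<bar> * std_normal_density x) \<le> ?f (- x)" using le[of "- x"] n by (simp add: ennreal_leI)
      then show ?thesis by (rule order_trans) simp
    qed
    finally show "ennreal (std_normal_density x) * ennreal (g \<bar>x\<bar>) \<le> ?f x + ?f (- x)" .
  qed
  also have "\<dots> = (\<integral>\<^sup>+x. ?f x \<partial>lborel) + (\<integral>\<^sup>+x. ?f (- x) \<partial>lborel)"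
    using h by (intro nn_integral_add) auto
  also have "(\<integral>\<^sup>+x. ?f (- x) \<partial>lborel) = (\<integral>\<^sup>+x. ?f x \<partial>lborel)"
    using nn_integral_real_affine[OF fm, of "- 1" 0] by simp
  finally show ?thesis by (simp add: mult_2)
qed

lemma std_normal_density_exp_bound:
  "std_normal_density x = std_normal_density s * exp ((s\<^sup>2 - x\<^sup>2) / 2)"
proof -
  have "exp (- x\<^sup>2 / 2) = exp (- s\<^sup>2 / 2) * exp ((s\<^sup>2 - x\<^sup>2) / 2)"
    unfolding exp_add[symmetric] by (simp add: field_simps)
  then show ?thesis by (simp add: std_normal_density_def)
qed

text \<open>
  For \<open>x \<ge> s\<close> the density is at most \<open>std_normal_density s * exp (- s * (x - s))\<close>.
\<close>

lemma std_normal_tail_upper: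
  assumes s: "s > 0"
  shows "measure std_normal {y. \<bar>y\<bar> > s} \<le> 2 * std_normal_density s / s"
proof -
  interpret prob_space std_normal by (rule prob_space_normal_density) simp
  let ?h = "\<lambda>x. if x \<ge> s then std_normal_density s * exp (- s * (x - s)) else 0"
  let ?g = "\<lambda>x. if x > s then 1 else 0 :: real"
  have "emeasure std_normal {y. \<bar>y\<bar> > s} = (\<integral>\<^sup>+x. indicator {y. \<bar>y\<bar> > s} x \<partial>std_normal)"
    by (rule nn_integral_indicator[symmetric]) simp
  also have "\<dots> = (\<integral>\<^sup>+x. ennreal (?g \<bar>x\<bar>) \<partial>std_normal)"
    by (rule nn_integral_cong) (simp add: indicator_def)
  also have "\<dots> \<le> 2 * (\<integral>\<^sup>+x. ennreal (?h x) * indicator {0..} x \<partial>lborel)"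
  proof (rule nn_integral_std_normal_even_le)
    show "?g x * std_normal_density x \<le> ?h x" for x
    proof (cases "x > s")
      case True
      have "(s\<^sup>2 - x\<^sup>2) / 2 \<le> - s * (x - s)"
        using zero_le_power2[of "x - s"] by (simp add: power2_eq_square field_simps)
      then have "std_normal_density s * exp ((s\<^sup>2 - x\<^sup>2) / 2) \<le> std_normal_density s * exp (- s * (x - s))"
        by (intro mult_left_mono) auto
      then show ?thesis using True std_normal_density_exp_bound[of x s] by simp
    qed auto
  qed auto
  also have "(\<integral>\<^sup>+x. ennreal (?h x) * indicator {0..} x \<partial>lborel)
      = (\<integral>\<^sup>+x. ennreal (?h (s + 1 * x)) * indicator {0..} (s + 1 * x) \<partial>lborel)"
    using nn_integral_real_affine[of "\<lambda>x. ennreal (?h x) * indicator {0..} x" 1 s] by simp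
  also have "\<dots> = (\<integral>\<^sup>+y. ennreal (std_normal_density s * exp (- s * y)) * indicator {0..} y \<partial>lborel)"
    using s by (intro nn_integral_cong) (auto simp: indicator_def)
  also have "\<dots> = ennreal (std_normal_density s / s)"
    using s by (intro nn_integral_exponential) auto
  also have "2 * ennreal (std_normal_density s / s) = ennreal (2 * std_normal_density s / s)"
    using s by (simp add: ennreal_mult'[symmetric] ennreal_numeral[symmetric] del: ennreal_numeral)
  finally show ?thesis using s by (simp add: emeasure_eq_measure)
qed

text \<open>
  On \<open>{0..s}\<close> the logarithm of the integrand \<open>x powr p * std_normal_density x\<close> has derivative at least
  \<open>p / s - s > 0\<close>, so the integrand decays exponentially to the left of \<open>s\<close>.
\<close>

lemma std_normal_truncated_moment:
  assumes s: "s > 0" and p: "p > s\<^sup>2"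
  shows "(\<integral>x. (if \<bar>x\<bar> \<le> s then \<bar>x\<bar> powr p else 0) \<partial>std_normal)
    \<le> 2 * s powr (p + 1) * std_normal_density s / (p - s\<^sup>2)"
proof -
  define l where "l = (p - s\<^sup>2) / s"
  have l: "l > 0" using s p by (simp add: l_def)
  define C where "C = s powr p * std_normal_density s"
  have C: "C \<ge> 0" by (simp add: C_def)
  let ?g = "\<lambda>x. if x \<le> s then \<bar>x\<bar> powr p else 0 :: real"
  let ?h = "\<lambda>x. if x \<le> s then C * exp (- l * (s - x)) else 0"
  have "(\<integral>\<^sup>+x. ennreal (?g \<bar>x\<bar>) \<partial>std_normal) \<le> 2 * (\<integral>\<^sup>+x. ennreal (?h x) * indicator {0..} x \<partial>lborel)"
  proof (rule nn_integral_std_normal_even_le)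
    fix x :: real assume x: "x \<ge> 0"
    show "?g x * std_normal_density x \<le> ?h x"
    proof (cases "0 < x \<and> x \<le> s")
      case True
      then have x0: "x > 0" "x \<le> s" by auto
      have pp: "p \<ge> 0" using p zero_le_power2[of s] by linarith
      have "p * ln (x / s) \<le> p * (x / s - 1)" using x0 s pp by (intro mult_left_mono ln_le_minus_one) auto
      moreover have "p * (x / s - 1) = - (s - x) * (p / s)" using s by (simp add: field_simps)
      moreover have "(s\<^sup>2 - x\<^sup>2) / 2 \<le> (s - x) * s"
        using zero_le_power2[of "s - x"] by (simp add: power2_eq_square field_simps)
      moreover have "- l * (s - x) = - (s - x) * (p / s) + (s - x) * s"
        using s by (simp add: l_def power2_eq_square field_simps)
      ultimately have *: "p * ln (x / s) + (s\<^sup>2 - x\<^sup>2) / 2 \<le> - l * (s - x)" by linarith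
      have "x powr p * std_normal_density x = C * exp (p * ln (x / s) + (s\<^sup>2 - x\<^sup>2) / 2)"
      proof -
        have "x powr p = s powr p * exp (p * ln (x / s))"
          using x0 s by (simp add: powr_def exp_add[symmetric] ln_div right_diff_distrib)
        then show ?thesis unfolding std_normal_density_exp_bound[of x s] C_def exp_add by simp
      qed
      also have "\<dots> \<le> C * exp (- l * (s - x))" using * C by (intro mult_left_mono) auto
      finally show ?thesis using x0 by simp
    qed (use x C in auto)
  qed auto
  also have "(\<integral>\<^sup>+x. ennreal (?h x) * indicator {0..} x \<partial>lborel)
      = (\<integral>\<^sup>+x. ennreal (?h (s + - 1 * x)) * indicator {0..} (s + - 1 * x) \<partial>lborel)"
    using nn_integral_real_affine[of "\<lambda>x. ennreal (?h x) * indicator {0..} x" "- 1" s] by simp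
  also have "\<dots> \<le> (\<integral>\<^sup>+y. ennreal (C * exp (- l * y)) * indicator {0..} y \<partial>lborel)"
    by (intro nn_integral_mono) (auto simp: indicator_def)
  also have "\<dots> = ennreal (C / l)" by (rule nn_integral_exponential[OF l C])
  also have "2 * ennreal (C / l) = ennreal (2 * (C / l))"
    using C l by (simp add: ennreal_mult'[symmetric] ennreal_numeral[symmetric] del: ennreal_numeral)
  finally have "(\<integral>\<^sup>+x. ennreal (?g \<bar>x\<bar>) \<partial>std_normal) \<le> ennreal (2 * (C / l))"
    by (simp add: mult_left_mono)
  moreover have "(\<integral>\<^sup>+x. ennreal (?g \<bar>x\<bar>) \<partial>std_normal) = (\<integral>\<^sup>+x. ennreal (if \<bar>x\<bar> \<le> s then \<bar>x\<bar> powr p else 0) \<partial>std_normal)"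
    by (intro nn_integral_cong) simp
  ultimately have "(\<integral>x. (if \<bar>x\<bar> \<le> s then \<bar>x\<bar> powr p else 0) \<partial>std_normal) \<le> 2 * (C / l)"
    using C l by (intro integral_real_bounded) auto
  also have "2 * (C / l) = 2 * s powr (p + 1) * std_normal_density s / (p - s\<^sup>2)"
    using s p by (simp add: C_def l_def powr_add)
  finally show ?thesis .
qed

text \<open>
  By the tail bound, some coordinate exceeds \<open>s\<close> with probability at most \<open>1 / 4\<close>. The
  coordinates below \<open>s\<close> contribute at most \<open>s powr p / (2 * \<delta>)\<close> in the mean, so by Markov's inequality they
  exceed twice that value with probability at most \<open>1 / 2\<close>.
\<close>

lemma gauss_lp_norm_small_probability:
  fixes \<delta> L s p :: real and n :: nat
  assumes \<delta>: "0 < \<delta>" "\<delta> < 1" and s: "s > 0" "s\<^sup>2 \<le> 2 * L" and p: "p = (2 + \<delta>) * L"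
    and n: "n \<ge> 1" "n * std_normal_density s = s / 8"
  shows "1 / 4 \<le> measure (gauss {..<n}) {x \<in> space (gauss {..<n}). lp_norm n p x powr p \<le> s powr p / \<delta>}"
proof -
  interpret N: prob_space std_normal by (rule prob_space_normal_density) simp
  interpret G: prob_space "gauss {..<n}" by (rule prob_space_gauss)
  have "0 < s\<^sup>2" using s by simp
  then have L: "L > 0" using s(2) by linarith
  have ps: "p - s\<^sup>2 \<ge> \<delta> * L" using s p by (simp add: algebra_simps)
  have ps': "s\<^sup>2 < p" using ps mult_pos_pos[OF \<delta>(1) L] by linarith
  have p0: "p > 0" using p L \<delta> by simp
  define T where "T y = (if \<bar>y\<bar> \<le> s then \<bar>y\<bar> powr p else 0)" for y :: real
  have Tm: "T \<in> borel_measurable std_normal" unfolding T_def by measurable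
  have T0: "T y \<ge> 0" "T y \<le> s powr p" for y using s p0 by (auto simp: T_def intro!: powr_mono2)
  have Ti: "integrable std_normal T"
    using T0 Tm by (intro N.integrable_const_bound[of _ "s powr p"]) auto
  have "(\<integral>y. T y \<partial>std_normal) \<le> 2 * s powr (p + 1) * std_normal_density s / (p - s\<^sup>2)"
    unfolding T_def by (intro std_normal_truncated_moment s(1) ps')
  also have "\<dots> \<le> 2 * s powr (p + 1) * std_normal_density s / (\<delta> * L)"
    using ps ps' \<delta> L by (intro divide_left_mono) (auto intro!: mult_pos_pos)
  finally have "n * (\<integral>y. T y \<partial>std_normal) \<le> n * (2 * s powr (p + 1) * std_normal_density s / (\<delta> * L))"
    by (rule mult_left_mono) simp
  also have "\<dots> = s powr p * (2 * s * (n * std_normal_density s)) / (\<delta> * L)"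
    using s by (simp add: powr_add)
  also have "\<dots> = s powr p * s\<^sup>2 / (4 * \<delta> * L)"
    unfolding n(2) by (simp add: power2_eq_square)
  also have "\<dots> \<le> s powr p * (2 * L) / (4 * \<delta> * L)"
    using s \<delta> L by (intro divide_right_mono mult_left_mono) auto
  also have "\<dots> = s powr p / \<delta> * (1 / 2)" using L by simp
  finally have mean: "n * (\<integral>y. T y \<partial>std_normal) \<le> s powr p / \<delta> * (1 / 2)" .
  let ?S = "\<lambda>x. \<Sum>i<n. T (x i)"
  have Tx: "integrable (gauss {..<n}) (\<lambda>x. T (x i))" "(\<integral>x. T (x i) \<partial>gauss {..<n}) = (\<integral>y. T y \<partial>std_normal)"
    if i: "i \<in> {..<n}" for i
    unfolding gauss_def
    by (rule integral_PiM_coordinate(2)[OF N.prob_space_axioms i Tm Ti], rule integral_PiM_coordinate(1)[OF N.prob_space_axioms i Tm])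
  have Si: "integrable (gauss {..<n}) ?S"
    by (intro Bochner_Integration.integrable_sum Tx)
  have "(\<integral>x. ?S x \<partial>gauss {..<n}) = (\<Sum>i<n. (\<integral>y. T y \<partial>std_normal))"
  proof -
    have "(\<integral>x. ?S x \<partial>gauss {..<n}) = (\<Sum>i<n. (\<integral>x. T (x i) \<partial>gauss {..<n}))"
      by (rule Bochner_Integration.integral_sum) (rule Tx(1))
    also have "\<dots> = (\<Sum>i<n. (\<integral>y. T y \<partial>std_normal))" by (intro sum.cong refl Tx(2))
    finally show ?thesis .
  qed
  then have mean': "(\<integral>x. ?S x \<partial>gauss {..<n}) \<le> s powr p / \<delta> * (1 / 2)" using mean by simp
  let ?V = "{x \<in> space (gauss {..<n}). s powr p / \<delta> \<le> ?S x}"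
  have "measure (gauss {..<n}) ?V \<le> (\<integral>x. ?S x \<partial>gauss {..<n}) / (s powr p / \<delta>)"
    by (rule integral_Markov_inequality_measure[OF Si, of "space (gauss {..<n})"])
      (use s \<delta> T0 in \<open>auto intro!: sum_nonneg simp del: space_gauss\<close>)
  also have "\<dots> \<le> s powr p / \<delta> * (1 / 2) / (s powr p / \<delta>)"
    using mean' \<delta> by (intro divide_right_mono) auto
  also have "\<dots> = 1 / 2" using s \<delta> by simp
  finally have V: "measure (gauss {..<n}) ?V \<le> 1 / 2" .
  let ?U = "\<lambda>i. {x \<in> space (gauss {..<n}). \<bar>x i\<bar> > s}"
  have Um: "?U i \<in> sets (gauss {..<n})" if "i \<in> {..<n}" for i
    by (intro borel_measurable_less borel_measurable_const borel_measurable_abs measurable_gauss_component that)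
  have U: "measure (gauss {..<n}) (?U i) \<le> 1 / (4 * n)" if i: "i \<in> {..<n}" for i
  proof -
    have d: "distr (gauss {..<n}) std_normal (\<lambda>x. x i) = std_normal"
      unfolding gauss_def using i N.prob_space_axioms by (intro distr_PiM_component) auto
    have m: "(\<lambda>x. x i) \<in> gauss {..<n} \<rightarrow>\<^sub>M std_normal" using measurable_gauss_component[OF i] by simp
    have "measure std_normal {y. \<bar>y\<bar> > s} = measure (distr (gauss {..<n}) std_normal (\<lambda>x. x i)) {y. \<bar>y\<bar> > s}"
      by (simp only: d)
    also have "\<dots> = measure (gauss {..<n}) ((\<lambda>x. x i) -` {y. \<bar>y\<bar> > s} \<inter> space (gauss {..<n}))"
      by (rule measure_distr[OF m]) simp
    also have "(\<lambda>x. x i) -` {y. \<bar>y\<bar> > s} \<inter> space (gauss {..<n}) = ?U i" by auto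
    finally have "measure (gauss {..<n}) (?U i) \<le> 2 * std_normal_density s / s"
      using std_normal_tail_upper[OF s(1)] by simp
    also have "std_normal_density s = s / 8 / n" using n by (simp add: field_simps)
    finally show ?thesis using s n by simp
  qed
  let ?D = "{x \<in> space (gauss {..<n}). lp_norm n p x powr p \<le> s powr p / \<delta>}"
  have UU: "(\<Union>i<n. ?U i) \<in> sets (gauss {..<n})" using Um by (intro sets.finite_UN) auto
  have Vm: "?V \<in> sets (gauss {..<n})"
    by (intro borel_measurable_le borel_measurable_const borel_measurable_integrable Si)
  have Dm: "?D \<in> sets (gauss {..<n})"
    by (intro borel_measurable_le borel_measurable_const powr_real_measurable lp_norm_measurable)
  have "space (gauss {..<n}) - ?D \<subseteq> ?V \<union> (\<Union>i<n. ?U i)"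
  proof
    fix x assume x: "x \<in> space (gauss {..<n}) - ?D"
    show "x \<in> ?V \<union> (\<Union>i<n. ?U i)"
    proof (cases "\<exists>i<n. \<bar>x i\<bar> > s")
      case True then show ?thesis using x by auto
    next
      case False
      have "lp_norm n p x powr p = (\<Sum>i<n. \<bar>x i\<bar> powr p)"
        using p0 by (simp add: lp_norm_def powr_powr sum_nonneg)
      also have "\<dots> = ?S x" using False by (intro sum.cong) (auto simp: T_def)
      finally show ?thesis using x by auto
    qed
  qed
  then have "measure (gauss {..<n}) (space (gauss {..<n}) - ?D) \<le> measure (gauss {..<n}) (?V \<union> (\<Union>i<n. ?U i))"
    by (intro G.finite_measure_mono sets.Un Vm UU)
  also have "\<dots> \<le> measure (gauss {..<n}) ?V + measure (gauss {..<n}) (\<Union>i<n. ?U i)"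
    by (intro measure_Un_le Vm UU)
  also have "measure (gauss {..<n}) (\<Union>i<n. ?U i) \<le> (\<Sum>i<n. measure (gauss {..<n}) (?U i))"
    using Um by (intro measure_UNION_le) auto
  also have "\<dots> \<le> (\<Sum>i<n. 1 / (4 * real n))" using U by (intro sum_mono) auto
  also have "\<dots> = 1 / 4" using n by simp
  also note V
  finally have "measure (gauss {..<n}) (space (gauss {..<n}) - ?D) \<le> 3 / 4" by simp
  then show ?thesis unfolding G.prob_compl[OF Dm] by simp
qed

text \<open>
  Since \<open>s\<^sup>2 \<le> 2 L\<close>, raising the threshold by the factor \<open>exp (K / L)\<close> increases its square by at most
  \<open>8 K\<close>. A single coordinate therefore exceeds \<open>b\<close> with probability at least a constant times
  \<open>std_normal_density s / s = 1 / (8 n)\<close>.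
\<close>

lemma gauss_large_maximum_probability:
  fixes K L s b :: real and n :: nat
  assumes s: "s \<ge> 1" "s\<^sup>2 \<le> 2 * L" and K: "0 \<le> K" "2 * K \<le> L" and b: "b = s * exp (K / L)"
    and n: "n * std_normal_density s = s / 8"
  shows "measure (gauss {..<n}) {x \<in> space (gauss {..<n}). \<exists>i<n. b \<le> \<bar>x i\<bar>} \<ge> 1 - exp (- (exp (- (4 * K + 2)) / 8))"
proof -
  interpret N: prob_space std_normal by (rule prob_space_normal_density) simp
  interpret product_sigma_finite "\<lambda>_::nat. std_normal" ..
  interpret G: prob_space "gauss {..<n}" by (rule prob_space_gauss)
  have s2: "1 \<le> s\<^sup>2" using s by simp
  have L: "L > 0" using s2 s(2) by linarith
  have e1: "exp (K / L) \<ge> 1" using K L by simp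
  have b1: "b \<ge> 1" using s e1 mult_mono[of 1 s 1 "exp (K / L)"] by (simp add: b)
  have ex: "exp x \<le> 1 + 2 * x" if "0 \<le> x" "x \<le> 1" for x :: real
    using exp_bound[OF that] that mult_left_mono[of x 1 x] by (simp add: power2_eq_square)
  have "b\<^sup>2 = s\<^sup>2 * exp (2 * K / L)"
    by (simp add: b power_mult_distrib power2_eq_square exp_add[symmetric])
  also have "\<dots> \<le> s\<^sup>2 * (1 + 2 * (2 * K / L))" using K L by (intro mult_left_mono ex) auto
  also have "\<dots> = s\<^sup>2 + s\<^sup>2 * (4 * K / L)" by (simp add: algebra_simps)
  also have "s\<^sup>2 * (4 * K / L) \<le> 2 * L * (4 * K / L)" using s K L by (intro mult_right_mono) auto
  also have "2 * L * (4 * K / L) = 8 * K" using L by simp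
  finally have b2: "b\<^sup>2 \<le> s\<^sup>2 + 8 * K" by simp
  have b3: "(b + 1 / b)\<^sup>2 \<le> b\<^sup>2 + 3"
  proof -
    have "(b + 1 / b)\<^sup>2 = b\<^sup>2 + 2 + (1 / b)\<^sup>2" using b1 by (simp add: power2_eq_square field_simps)
    moreover have "(1 / b)\<^sup>2 \<le> 1" using b1 by (simp add: power_le_one)
    ultimately show ?thesis by simp
  qed
  define q where "q = measure std_normal {y. b \<le> \<bar>y\<bar>}"
  define c where "c = std_normal_density s * exp (- (8 * K + 3) / 2)"
  have "c * (1 / b) \<le> q"
  proof -
    have "ennreal (c * ((b + 1 / b) - b)) \<le> emeasure std_normal {b..b + 1 / b}"
    proof (rule std_normal_interval_lower)
      fix x assume x: "b \<le> x" "x \<le> b + 1 / b"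
      have "x\<^sup>2 \<le> (b + 1 / b)\<^sup>2" using x b1 by (intro power_mono) auto
      then have "- (8 * K + 3) / 2 \<le> (s\<^sup>2 - x\<^sup>2) / 2" using b2 b3 by simp
      then show "c \<le> std_normal_density x"
        unfolding c_def std_normal_density_exp_bound[of x s] by (intro mult_left_mono) auto
    qed (use b1 in \<open>auto simp: c_def\<close>)
    also have "\<dots> \<le> emeasure std_normal {y. b \<le> \<bar>y\<bar>}" using b1 by (intro emeasure_mono) auto
    finally show ?thesis using b1 by (simp add: N.emeasure_eq_measure q_def)
  qed
  then have "n * (c * (1 / b)) \<le> n * q" by (intro mult_left_mono) auto
  moreover have "exp (- (4 * K + 2)) / 8 \<le> n * (c * (1 / b))"
  proof -
    have "n * (c * (1 / b)) = (n * std_normal_density s) * (exp (- (8 * K + 3) / 2) * (exp (- (K / L)) / s))"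
      by (simp add: c_def b exp_minus field_simps)
    also have "\<dots> = exp (- (8 * K + 3) / 2 + - (K / L)) / 8" unfolding n exp_add using s by simp
    also have "\<dots> \<ge> exp (- (4 * K + 2)) / 8"
    proof -
      have "K / L \<le> 1 / 2" using K L by (simp add: field_simps)
      moreover have "- (4 * K + 2) \<le> - (8 * K + 3) / 2 + - r" if "r \<le> 1 / 2" for r
        using that by (simp add: field_simps)
      ultimately have "- (4 * K + 2) \<le> - (8 * K + 3) / 2 + - (K / L)" by blast
      then show ?thesis by simp
    qed
    finally show ?thesis .
  qed
  ultimately have nq: "exp (- (4 * K + 2)) / 8 \<le> n * q" by linarith
  let ?A = "{x \<in> space (gauss {..<n}). \<exists>i<n. b \<le> \<bar>x i\<bar>}"
  let ?B = "Pi\<^sub>E {..<n} (\<lambda>_. {y. \<bar>y\<bar> < b})"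
  have Bs: "?B \<in> sets (gauss {..<n})" unfolding gauss_def by (intro sets_PiM_I_finite) auto
  have "emeasure (gauss {..<n}) ?B = (\<Prod>i<n. emeasure std_normal {y. \<bar>y\<bar> < b})"
    unfolding gauss_def by (intro emeasure_PiM) auto
  then have "measure (gauss {..<n}) ?B = measure std_normal {y. \<bar>y\<bar> < b} ^ n"
    by (simp add: N.emeasure_eq_measure G.emeasure_eq_measure ennreal_power)
  also have "measure std_normal {y. \<bar>y\<bar> < b} = 1 - q"
  proof -
    have "{y. \<bar>y\<bar> < b} = space std_normal - {y. b \<le> \<bar>y\<bar>}" by auto
    then show ?thesis unfolding q_def using N.prob_compl[of "{y. b \<le> \<bar>y\<bar>}"] by simp
  qed
  also have "(1 - q) ^ n \<le> exp (- q) ^ n"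
    using exp_ge_add_one_self[of "- q"] N.prob_le_1[of "{y. b \<le> \<bar>y\<bar>}"] unfolding q_def[symmetric]
    by (intro power_mono) auto
  also have "\<dots> = exp (- (n * q))" by (simp flip: exp_of_nat_mult)
  also have "\<dots> \<le> exp (- (exp (- (4 * K + 2)) / 8))" using nq by simp
  finally have "measure (gauss {..<n}) ?B \<le> exp (- (exp (- (4 * K + 2)) / 8))" .
  moreover have "?A = space (gauss {..<n}) - ?B"
  proof -
    have "?B = {x \<in> space (gauss {..<n}). \<forall>i<n. \<bar>x i\<bar> < b}"
      unfolding space_gauss PiE_def Pi_def by blast
    moreover have "(\<exists>i<n. b \<le> \<bar>x i\<bar>) \<longleftrightarrow> \<not> (\<forall>i<n. \<bar>x i\<bar> < b)" for x
      by (simp only: not_all not_imp not_less)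
    ultimately show ?thesis by blast
  qed
  then have "measure (gauss {..<n}) ?A = 1 - measure (gauss {..<n}) ?B"
    using G.prob_compl[OF Bs] by (simp only:)
  ultimately show ?thesis by linarith
qed

text \<open>
  The equation says that about \<open>2 n * std_normal_density s / s = 1 / 4\<close> coordinates are expected to exceed
  \<open>s\<close> in absolute value. At \<open>s = sqrt (2 L)\<close> the left hand side is \<open>1 / sqrt (2 \<pi>)\<close> and already too small,
  which gives \<open>s\<^sup>2 \<le> 2 L\<close> without asymptotics.
\<close>

lemma gauss_quantile:
  fixes n :: nat and L :: real
  assumes n: "n \<ge> 2" and L: "L = ln n" "L \<ge> 8"
  obtains s where "s \<ge> 1" "s\<^sup>2 \<le> 2 * L" "n * std_normal_density s = s / 8"
proof -
  let ?f = "\<lambda>s. n * std_normal_density s - s / 8"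
  have sp: "sqrt (2 * pi) \<le> 3"
  proof -
    have "sqrt (2 * pi) \<le> sqrt (3\<^sup>2)" using pi_less_4 by (intro real_sqrt_le_mono) simp
    then show ?thesis by simp
  qed
  have "\<exists>s. 1 \<le> s \<and> s \<le> sqrt (2 * L) \<and> ?f s = 0"
  proof (rule IVT2)
    have "4 \<le> sqrt (2 * L)" using L by (intro real_le_rsqrt) auto
    moreover have "std_normal_density (sqrt (2 * L)) = 1 / sqrt (2 * pi) / n"
    proof -
      have "(sqrt (2 * L))\<^sup>2 = 2 * L" using L by simp
      moreover have "exp (- L) = 1 / n" using n unfolding L(1) by (simp add: exp_minus inverse_eq_divide)
      ultimately show ?thesis by (simp add: std_normal_density_def)
    qed
    moreover have "1 / sqrt (2 * pi) \<le> 1 / 2"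
    proof -
      have "sqrt (2\<^sup>2) \<le> sqrt (2 * pi)" using pi_gt3 by (intro real_sqrt_le_mono) simp
      then have "2 \<le> sqrt (2 * pi)" by simp
      then show ?thesis by (intro divide_left_mono) auto
    qed
    moreover from calculation have "n * std_normal_density (sqrt (2 * L)) = 1 / sqrt (2 * pi)" using n by simp
    ultimately show "?f (sqrt (2 * L)) \<le> 0" by linarith
    show "0 \<le> ?f 1"
    proof -
      have "exp (1 / 2) \<le> (3::real)" using exp_le exp_le_cancel_iff[of "1/2" "1::real"] by linarith
      then have "exp (1 / 2) * sqrt (2 * pi) \<le> 3 * 3" using sp by (intro mult_mono) auto
      then have "1 / 9 \<le> 1 / (exp (1 / 2) * sqrt (2 * pi))" by (intro divide_left_mono) auto
      also have "\<dots> = std_normal_density 1" by (simp add: std_normal_density_def exp_minus field_simps)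
      finally have "2 * (1 / 9) \<le> n * std_normal_density 1" using n by (intro mult_mono) auto
      then show ?thesis by simp
    qed
    show "1 \<le> sqrt (2 * L)" using L by (intro real_le_rsqrt) auto
    show "\<forall>x. 1 \<le> x \<and> x \<le> sqrt (2 * L) \<longrightarrow> isCont ?f x"
      by (auto simp: std_normal_density_def intro!: continuous_intros)
  qed
  then obtain s where s: "1 \<le> s" "s \<le> sqrt (2 * L)" "?f s = 0" by blast
  have "s\<^sup>2 \<le> (sqrt (2 * L))\<^sup>2" using s by (intro power_mono) auto
  then have "s\<^sup>2 \<le> 2 * L" using L by simp
  then show thesis using that s by simp
qed

section \<open>Two independent columns\<close>

lemma gauss_disjoint_coordinates_indep:
  assumes I: "J \<subseteq> I" "K \<subseteq> I" "J \<inter> K = {}"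
    and A: "A \<in> sets (PiM J (\<lambda>_. std_normal))" and B: "B \<in> sets (PiM K (\<lambda>_. std_normal))"
  shows "measure (gauss I) {x \<in> space (gauss I). restrict x J \<in> A \<and> restrict x K \<in> B}
    = measure (gauss I) {x \<in> space (gauss I). restrict x J \<in> A} * measure (gauss I) {x \<in> space (gauss I). restrict x K \<in> B}"
proof (cases "I = {}")
  case True
  interpret prob_space "gauss I" by (rule prob_space_gauss)
  have s: "space (gauss I) = {\<lambda>_. undefined}" using True by simp
  have r: "restrict x {} = (\<lambda>_. undefined)" for x :: "'a \<Rightarrow> real" by (simp add: fun_eq_iff)
  have JK: "J = {}" "K = {}" using I True by auto
  have one: "measure (gauss I) {\<lambda>_. undefined} = 1" using prob_space s by simp
  show ?thesis unfolding s JK r using one by (cases "(\<lambda>_. undefined) \<in> A"; cases "(\<lambda>_. undefined) \<in> B") auto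
next
  case False
  interpret N: prob_space std_normal by (rule prob_space_normal_density) simp
  interpret G: prob_space "gauss I" by (rule prob_space_gauss)
  have m: "(\<lambda>x. x i) \<in> gauss I \<rightarrow>\<^sub>M std_normal" if "i \<in> I" for i
    using measurable_gauss_component[OF that] by simp
  have "G.indep_vars (\<lambda>_. std_normal) (\<lambda>i x. x i) I"
  proof (subst G.indep_vars_iff_distr_eq_PiM'[OF False m])
    have "distr (gauss I) std_normal (\<lambda>x. x i) = std_normal" if "i \<in> I" for i
      unfolding gauss_def using that N.prob_space_axioms by (intro distr_PiM_component) auto
    then have "PiM I (\<lambda>i. distr (gauss I) std_normal (\<lambda>x. x i)) = PiM I (\<lambda>_. std_normal)"
      by (intro PiM_cong) auto
    moreover have "distr (gauss I) (PiM I (\<lambda>_. std_normal)) (\<lambda>x. \<lambda>i\<in>I. x i) = distr (gauss I) (gauss I) (\<lambda>x. x)"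
      by (intro distr_cong) (auto simp: gauss_def[symmetric] extensional_restrict)
    moreover have "distr (gauss I) (gauss I) (\<lambda>x. x) = PiM I (\<lambda>_. std_normal)"
      by (simp add: distr_id2 gauss_def)
    ultimately show "distr (gauss I) (PiM I (\<lambda>_. std_normal)) (\<lambda>x. \<lambda>i\<in>I. x i)
      = PiM I (\<lambda>i. distr (gauss I) std_normal (\<lambda>x. x i))" by simp
  qed
  then have ind: "G.indep_vars (\<lambda>b. PiM (if b then J else K) (\<lambda>_. std_normal))
      (\<lambda>b x. restrict (\<lambda>i. x i) (if b then J else K)) UNIV"
    using I by (intro G.indep_vars_restrict) (auto simp: disjoint_family_on_def)
  let ?X = "\<lambda>b x. restrict (\<lambda>i. x i) (if b then J else K)"
  let ?A = "\<lambda>b. if b then A else B"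
  have "G.prob (\<Inter>b\<in>UNIV. ?X b -` ?A b \<inter> space (gauss I)) = (\<Prod>b\<in>UNIV. G.prob (?X b -` ?A b \<inter> space (gauss I)))"
    by (rule G.indep_varsD_finite[OF ind]) (use A B in auto)
  moreover have "(\<Inter>b\<in>UNIV. ?X b -` ?A b \<inter> space (gauss I)) = {x \<in> space (gauss I). restrict x J \<in> A \<and> restrict x K \<in> B}"
    by (auto simp: UNIV_bool)
  moreover have "?X True -` A \<inter> space (gauss I) = {x \<in> space (gauss I). restrict x J \<in> A}"
    "?X False -` B \<inter> space (gauss I) = {x \<in> space (gauss I). restrict x K \<in> B}" by auto
  ultimately show ?thesis by (simp add: UNIV_bool mult.commute)
qed

abbreviation unit_vec :: "nat \<Rightarrow> nat \<Rightarrow> real" where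
  "unit_vec j \<equiv> (\<lambda>l. if l = j then 1 else 0)"

lemma comb_unit_vec: "j < k \<Longrightarrow> i < n \<Longrightarrow> comb n k (unit_vec j) Y i = Y (i, j)"
  by (simp add: comb_def if_distrib[of "\<lambda>c. c * _"] cong: if_cong)

lemma L2_set_unit_vec: "j < k \<Longrightarrow> nrm k (unit_vec j) = 1"
  by (simp add: L2_set_def if_distrib[of "\<lambda>c. c\<^sup>2"] cong: if_cong)

lemma gmat_two_columns_indep:
  assumes k: "2 \<le> k"
    and P: "Measurable.pred (gauss {..<n}) P" and Q: "Measurable.pred (gauss {..<n}) Q"
    and cong: "\<And>x y. (\<And>i. i < n \<Longrightarrow> x i = y i) \<Longrightarrow> P x = P y" "\<And>x y. (\<And>i. i < n \<Longrightarrow> x i = y i) \<Longrightarrow> Q x = Q y"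
  shows "measure (gmat n k) {Y \<in> space (gmat n k). P (comb n k (unit_vec 0) Y) \<and> Q (comb n k (unit_vec 1) Y)}
    = measure (gauss {..<n}) {x \<in> space (gauss {..<n}). P x} * measure (gauss {..<n}) {x \<in> space (gauss {..<n}). Q x}"
proof -
  let ?I = "{..<n} \<times> {..<k}"
  have set: "\<exists>A\<in>sets (PiM ({..<n} \<times> {j}) (\<lambda>_. std_normal)). \<forall>Y. (restrict Y ({..<n} \<times> {j}) \<in> A) = R (comb n k (unit_vec j) Y)"
    if j: "j < k" and R: "Measurable.pred (gauss {..<n}) R"
      and c: "\<And>x y. (\<And>i. i < n \<Longrightarrow> x i = y i) \<Longrightarrow> R x = R y" for j :: nat and R
  proof -
    let ?J = "{..<n} \<times> {j}"
    let ?h = "\<lambda>Z. \<lambda>i\<in>{..<n}. Z (i, j)"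
    have h: "?h \<in> gauss ?J \<rightarrow>\<^sub>M gauss {..<n}"
      by (rule measurable_into_gauss) (simp_all add: measurable_gauss_component)
    let ?A = "?h -` {x \<in> space (gauss {..<n}). R x} \<inter> space (gauss ?J)"
    have "?A \<in> sets (gauss ?J)" by (rule measurable_sets[OF h predE[OF R]])
    moreover have "(restrict Y ?J \<in> ?A) = R (comb n k (unit_vec j) Y)" for Y
    proof -
      have "(restrict Y ?J \<in> ?A) = R (?h (restrict Y ?J))" by simp
      also have "\<dots> = R (comb n k (unit_vec j) Y)"
        by (rule c) (simp add: comb_unit_vec[OF j])
      finally show ?thesis .
    qed
    ultimately show ?thesis unfolding gauss_def by blast
  qed
  have k01: "0 < k" "1 < k" using k by auto
  obtain A where A: "A \<in> sets (PiM ({..<n} \<times> {0}) (\<lambda>_. std_normal))"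
    "\<And>Y. (restrict Y ({..<n} \<times> {0}) \<in> A) = P (comb n k (unit_vec 0) Y)"
    using set[OF k01(1) P cong(1)] by blast
  obtain B where B: "B \<in> sets (PiM ({..<n} \<times> {1}) (\<lambda>_. std_normal))"
    "\<And>Y. (restrict Y ({..<n} \<times> {1}) \<in> B) = Q (comb n k (unit_vec 1) Y)"
    using set[OF k01(2) Q cong(2)] by blast
  have "measure (gmat n k) {Y \<in> space (gmat n k). P (comb n k (unit_vec 0) Y) \<and> Q (comb n k (unit_vec 1) Y)}
    = measure (gmat n k) {Y \<in> space (gmat n k). P (comb n k (unit_vec 0) Y)} * measure (gmat n k) {Y \<in> space (gmat n k). Q (comb n k (unit_vec 1) Y)}"
    unfolding A(2)[symmetric] B(2)[symmetric]
    by (rule gauss_disjoint_coordinates_indep[OF _ _ _ A(1) B(1)]) (use k in auto)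
  moreover have one: "(\<Sum>l<k. (unit_vec j l)\<^sup>2) = 1" if "j < k" for j
    using L2_set_unit_vec[OF that] by (simp add: L2_set_def)
  ultimately show ?thesis
    using measure_gmat_comb[OF k01(1) one[OF k01(1)] P cong(1)] measure_gmat_comb[OF k01(1) one[OF k01(2)] Q cong(2)] by simp
qed

text \<open>
  The approximation error \<open>s = \<kappa> / 12\<close> is chosen so that the four factors \<open>1 \<plusminus> s\<close> eat up less than
  the gap between \<open>1 + 2 \<kappa>\<close> and \<open>1 + \<kappa>\<close>.
\<close>

lemma far_norms_imp_not_spherical:
  assumes E: "E \<in> Grassmannian n k" and k: "0 < k" and n: "0 < n" and p: "p \<ge> 1"
    and \<kappa>: "0 < \<kappa>" "\<kappa> \<le> 1" and t: "t = \<kappa> / (12 * (real n)\<^sup>2)"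
    and cl: "close_to n t F E" and y: "y \<in> F" "z \<in> F"
    and far: "(1 + 2 * \<kappa>) * (lp_norm n p z * nrm n y) < lp_norm n p y * nrm n z"
  shows "\<not> spherical n (lp_norm n p) (1 + \<kappa>) E"
proof
  assume sph: "spherical n (lp_norm n p) (1 + \<kappa>) E"
  define s where "s = \<kappa> / 12"
  have s: "0 < s" "s \<le> 1 / 12" using \<kappa> by (auto simp: s_def)
  have n1: "real n \<ge> 1" using n by simp
  have nt: "real n * (t * real n) = s" using n by (simp add: t s_def power2_eq_square)
  have t0: "0 < t" using \<kappa> n by (simp add: t)
  have ts: "t \<le> s"
  proof -
    have "t * 1 \<le> t * (real n * real n)" using t0 n1 mult_mono[of 1 "real n" 1 "real n"] by (intro mult_left_mono) auto
    then show ?thesis using nt by (simp add: mult_ac)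
  qed
  have approx: "\<exists>x\<in>E. (1 - s) * lp_norm n p v \<le> lp_norm n p x \<and> lp_norm n p x \<le> (1 + s) * lp_norm n p v \<and>
      (1 - s) * nrm n v \<le> nrm n x \<and> nrm n x \<le> (1 + s) * nrm n v" if v: "v \<in> F" for v
  proof -
    obtain x where x: "x \<in> E" "nrm n (v - x) \<le> t * nrm n v" using cl v unfolding close_to_def by blast
    have "\<bar>lp_norm n p x - lp_norm n p v\<bar> \<le> real n * (t * nrm n v)" by (rule lp_norm_perturb[OF p x(2)])
    also have "\<dots> \<le> real n * (t * (real n * lp_norm n p v))"
      using t0 nrm_le_lp_norm[OF p, where n = n and x = v] by (intro mult_left_mono) auto
    also have "\<dots> = s * lp_norm n p v" using nt by (simp add: mult_ac)
    finally have 1: "\<bar>lp_norm n p x - lp_norm n p v\<bar> \<le> s * lp_norm n p v" .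
    have "t * nrm n v \<le> s * nrm n v" using ts by (intro mult_right_mono) auto
    then have "nrm n (v - x) \<le> s * nrm n v" using x(2) by linarith
    then have 2: "nrm n x \<le> nrm n v + s * nrm n v" "nrm n v \<le> nrm n x + s * nrm n v"
      using nrm_triangle[where n = n and x = v and y = "x - v"] nrm_triangle[where n = n and x = x and y = "v - x"]
      by (simp_all add: nrm_minus_commute[where x = x])
    show ?thesis using x(1) 1 2 by (intro bexI[of _ x]) (auto simp: algebra_simps abs_le_iff)
  qed
  obtain x where x: "x \<in> E" "(1 - s) * lp_norm n p y \<le> lp_norm n p x" "nrm n x \<le> (1 + s) * nrm n y"
    using approx[OF y(1)] by blast
  obtain x' where x': "x' \<in> E" "lp_norm n p x' \<le> (1 + s) * lp_norm n p z" "(1 - s) * nrm n z \<le> nrm n x'"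
    using approx[OF y(2)] by blast
  have "((1 - s) * lp_norm n p y) * ((1 - s) * nrm n z) \<le> lp_norm n p x * nrm n x'"
    using x x' s by (intro mult_mono) (auto simp: lp_norm_nonneg)
  also have "\<dots> \<le> (1 + \<kappa>) * (lp_norm n p x' * nrm n x)"
    using sph \<kappa> x x' unfolding spherical_iff[OF E k n p add_pos_pos[OF zero_less_one \<kappa>(1)]] by blast
  also have "\<dots> \<le> (1 + \<kappa>) * (((1 + s) * lp_norm n p z) * ((1 + s) * nrm n y))"
    using x x' s \<kappa> by (intro mult_left_mono mult_mono) (auto simp: lp_norm_nonneg)
  finally have main: "(1 - s)\<^sup>2 * (lp_norm n p y * nrm n z) \<le> (1 + \<kappa>) * (1 + s)\<^sup>2 * (lp_norm n p z * nrm n y)"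
    by (simp add: power2_eq_square mult_ac)
  have "(1 - s)\<^sup>2 * ((1 + 2 * \<kappa>) * (lp_norm n p z * nrm n y)) < (1 - s)\<^sup>2 * (lp_norm n p y * nrm n z)"
    using far s by (intro mult_strict_left_mono) auto
  then have lt: "((1 - s)\<^sup>2 * (1 + 2 * \<kappa>)) * (lp_norm n p z * nrm n y) < ((1 + \<kappa>) * (1 + s)\<^sup>2) * (lp_norm n p z * nrm n y)"
    using main by (simp add: mult.assoc)
  have "(1 + \<kappa>) * (1 + s)\<^sup>2 \<le> (1 - s)\<^sup>2 * (1 + 2 * \<kappa>)"
  proof -
    have k12: "\<kappa> = 12 * s" by (simp add: s_def)
    have "(1 - s)\<^sup>2 * (1 + 2 * \<kappa>) - (1 + \<kappa>) * (1 + s)\<^sup>2 = 8 * s - 72 * s\<^sup>2 + 12 * s^3"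
      unfolding k12 by (simp add: power2_eq_square power3_eq_cube algebra_simps)
    moreover have "72 * s\<^sup>2 \<le> 6 * s" using s by (simp add: power2_eq_square)
    ultimately show ?thesis using s zero_less_power[of s 3] by linarith
  qed
  then have "((1 + \<kappa>) * (1 + s)\<^sup>2) * (lp_norm n p z * nrm n y) \<le> ((1 - s)\<^sup>2 * (1 + 2 * \<kappa>)) * (lp_norm n p z * nrm n y)"
    by (intro mult_right_mono) (auto simp: lp_norm_nonneg)
  then show False using lt by linarith
qed

section \<open>Exponents above the critical one and choice of constants\<close>

text \<open>
  Taking the \<open>p\<close>-th root turns the constant \<open>1 / \<delta>\<close> into a factor \<open>1 + O (1 / L)\<close>.
\<close>

lemma small_norm_bound:
  assumes \<delta>: "0 < \<delta>" "\<delta> < 1" and L: "0 < L" "L \<le> p" "1 \<le> p" and s: "0 < s"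
    and le: "lp_norm n p x powr p \<le> s powr p / \<delta>"
  shows "lp_norm n p x \<le> s * exp (ln (1 / \<delta>) / L)"
proof -
  have "lp_norm n p x = (lp_norm n p x powr p) powr (1 / p)"
    using L lp_norm_nonneg[of n p x] by (simp add: powr_powr)
  also have "\<dots> \<le> (s powr p / \<delta>) powr (1 / p)"
    using L le by (intro powr_mono2) auto
  also have "\<dots> = s * exp (ln (1 / \<delta>) / p)"
  proof -
    have "(s powr p / \<delta>) powr (1 / p) = exp ((1 / p) * (p * ln s + ln (1 / \<delta>)))"
      using s \<delta> L by (simp add: powr_def ln_div ln_mult)
    also have "(1 / p) * (p * ln s + ln (1 / \<delta>)) = ln s + ln (1 / \<delta>) / p"
      using L by (simp add: field_simps)
    finally show ?thesis using s by (simp add: exp_add)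
  qed
  also have "\<dots> \<le> s * exp (ln (1 / \<delta>) / L)"
  proof -
    have "ln (1 / \<delta>) \<ge> 0" using \<delta> by simp
    then have "ln (1 / \<delta>) / p \<le> ln (1 / \<delta>) / L" using L by (intro divide_left_mono) auto
    then show ?thesis using s by simp
  qed
  finally show ?thesis .
qed

text \<open>
  On an event of probability at least \<open>cA / 4 - 2 \<eta>\<close>, the first column has a coordinate above
  \<open>s exp (K / L)\<close>, the second has norm at most \<open>s exp (ln (1 / \<delta>) / L)\<close>, and the Euclidean norms of both are
  within a factor \<open>1 \<plusminus> \<kappa> / 8\<close> of a common value. The summand \<open>4\<close> in \<open>K\<close> is what remains as a gap between the two norms.
\<close>

lemma random_subspace_not_spherical:
  fixes \<delta> L K w \<kappa> cA q \<eta> \<epsilon> p :: real and n k :: nat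
  assumes \<delta>: "0 < \<delta>" "\<delta> < 1" and n: "n \<ge> 2" and L: "L = ln n" "L \<ge> 8"
    and k: "2 \<le> k" "k \<le> n" and p: "p = (2 + \<delta>) * L" and \<mu>: "uniform_Gr n k \<mu>"
    and \<epsilon>: "0 < \<epsilon>" "\<epsilon> < 1" and w: "0 < w" "w \<le> 1" and \<kappa>: "\<kappa> = w / L"
    and K: "K = ln (1 / \<delta>) + 4" "2 * K \<le> L" and cA: "cA = 1 - exp (- (exp (- (4 * K + 2)) / 8))"
    and q: "30000 * L * n powr (- (\<delta>\<^sup>2 / 16)) * (1152 / \<epsilon>) ^ k * (48 / \<epsilon>)\<^sup>2 \<le> q"
    and \<eta>: "15000 * L * n powr (- (\<delta>\<^sup>2 / 16)) / (\<kappa> / 8)\<^sup>2 \<le> \<eta>"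
    and sum: "w + q + 2 * \<eta> \<le> cA / 4"
  shows "measure \<mu> {E \<in> space \<mu>. \<not> spherical n (lp_norm n p) (1 + \<kappa>) E} \<ge> w"
proof -
  interpret \<mu>: prob_space \<mu> using \<mu> by (simp add: uniform_Gr_def)
  interpret \<gamma>: prob_space "gmat n k" by (rule prob_space_gauss)
  have n1: "n \<ge> 1" "0 < n" and k0: "0 < k" "1 < k" using n k by auto
  have L0: "L > 0" using L by simp
  have \<kappa>01: "0 < \<kappa>" "\<kappa> \<le> 1 / L" "\<kappa> \<le> 1" using w L by (auto simp: \<kappa> field_simps)
  have "p = 2 * L + \<delta> * L" "0 < \<delta> * L" using \<delta> L0 by (auto simp: p algebra_simps)
  then have Lp: "L \<le> p" "1 \<le> p" using L(2) by linarith+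
  have two: "2 \<le> (2 - \<delta>) * ln n"
  proof -
    have "1 * L \<le> (2 - \<delta>) * L" using \<delta> L0 by (intro mult_right_mono) auto
    then show ?thesis using L(2) unfolding L(1)[symmetric] by linarith
  qed
  have K0: "0 \<le> K" using K \<delta> ln_ge_zero[of "1 / \<delta>"] by simp
  obtain b c G where G: "b > 0" "c > 0" "G \<in> sets (gmat n k)"
    "1 - net_bound \<delta> n k \<epsilon> \<le> measure (gmat n k) G"
    "\<And>Y a. Y \<in> G \<Longrightarrow> \<bar>lp_norm n 2 (comb n k a Y) - b * nrm k a\<bar> \<le> \<epsilon> / 16 * (b * nrm k a)"
    "\<And>Y a. Y \<in> G \<Longrightarrow> \<bar>nrm n (comb n k a Y) - c * nrm k a\<bar> \<le> \<epsilon> / 16 * (c * nrm k a)"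
    by (rule gaussian_matrix_near_isometry[OF \<delta> n1(1) k0(1) order_refl two \<epsilon>]) blast
  let ?J = "{Y \<in> space (gmat n k). well_cond n k (c / 2) Y}"
  have "measure (gmat n k) G \<le> measure (gmat n k) ?J"
  proof (rule \<gamma>.finite_measure_mono)
    show "G \<subseteq> ?J" using near_isometry_well_cond[OF G(2) \<epsilon> G(6)] sets.sets_into_space[OF G(3)] by blast
  qed (rule well_cond_sets)
  then have J: "1 - q \<le> measure (gmat n k) ?J" using G(4) q unfolding L(1) by linarith
  define \<tau> where "\<tau> = \<kappa> / 8"
  have \<tau>: "0 < \<tau>" "\<tau> \<le> 1" using \<kappa>01 by (auto simp: \<tau>_def)
  obtain d where d0: "d > 0" and dev: "\<And>\<tau>. 0 < \<tau> \<Longrightarrow> \<tau> \<le> 1 \<Longrightarrow>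
      measure (gauss {..<n}) {x \<in> space (gauss {..<n}). \<not> \<bar>lp_norm n 2 x - d\<bar> < \<tau> * d}
        \<le> deviation_bound \<delta> n \<tau>"
    by (rule gauss_lp_norm_concentration[OF \<delta> n1(1) order_refl two]) blast
  have d: "d > 0" "measure (gauss {..<n}) {x \<in> space (gauss {..<n}). \<not> \<bar>lp_norm n 2 x - d\<bar> < \<tau> * d} \<le> \<eta>"
    using d0 order_trans[OF dev[OF \<tau>] \<eta>[unfolded L(1), folded \<tau>_def]] by simp_all
  obtain s where s: "s \<ge> 1" "s\<^sup>2 \<le> 2 * L" "n * std_normal_density s = s / 8"
    by (rule gauss_quantile[OF n L])
  define u where "u = s * exp (K / L)"
  define P where "P x \<longleftrightarrow> (\<exists>i<n. u \<le> \<bar>x i\<bar>)" for x :: "nat \<Rightarrow> real"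
  define Q where "Q x \<longleftrightarrow> lp_norm n p x powr p \<le> s powr p / \<delta>" for x
  have Pm: "Measurable.pred (gauss {..<n}) P"
  proof -
    have "{x \<in> space (gauss {..<n}). P x} = (\<Union>i\<in>{..<n}. {x \<in> space (gauss {..<n}). u \<le> \<bar>x i\<bar>})"
      unfolding P_def by blast
    also have "\<dots> \<in> sets (gauss {..<n})"
      by (intro sets.finite_UN borel_measurable_le borel_measurable_const borel_measurable_abs measurable_gauss_component) auto
    finally show ?thesis unfolding pred_def .
  qed
  have Qm: "Measurable.pred (gauss {..<n}) Q"
    unfolding pred_def Q_def
    by (intro borel_measurable_le borel_measurable_const powr_real_measurable lp_norm_measurable)
  have Pc: "P x = P y" if "\<And>i. i < n \<Longrightarrow> x i = y i" for x y using that unfolding P_def by metis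
  have Qc: "Q x = Q y" if "\<And>i. i < n \<Longrightarrow> x i = y i" for x y
    using lp_norm_cong[where n = n and x = x and y = y and p = p] that unfolding Q_def by simp
  let ?y = "\<lambda>Y. comb n k (unit_vec 0) Y"
  let ?z = "\<lambda>Y. comb n k (unit_vec 1) Y"
  define W where "W = {Y \<in> space (gmat n k). P (?y Y) \<and> Q (?z Y)}"
  define V where "V j = {Y \<in> space (gmat n k). \<not> \<bar>lp_norm n 2 (comb n k (unit_vec j) Y) - d\<bar> < \<tau> * d}" for j
  have cA0: "cA \<ge> 0" by (simp add: cA)
  have "cA * (1 / 4) \<le> measure (gauss {..<n}) {x \<in> space (gauss {..<n}). P x} * measure (gauss {..<n}) {x \<in> space (gauss {..<n}). Q x}"
  proof (rule mult_mono)
    show "cA \<le> measure (gauss {..<n}) {x \<in> space (gauss {..<n}). P x}"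
      unfolding cA P_def by (rule gauss_large_maximum_probability[OF s(1,2) K0 K(2) u_def s(3)])
    show "1 / 4 \<le> measure (gauss {..<n}) {x \<in> space (gauss {..<n}). Q x}"
      unfolding Q_def by (rule gauss_lp_norm_small_probability[OF \<delta> _ s(2) p n1(1) s(3)]) (use s in simp)
  qed (use cA0 in auto)
  also have "\<dots> = measure (gmat n k) W"
    unfolding W_def by (rule gmat_two_columns_indep[OF k(1) Pm Qm, symmetric]) (rule Pc Qc; assumption)+
  finally have W: "cA / 4 \<le> measure (gmat n k) W" by simp
  have Vs: "V j \<in> sets (gmat n k)" for j unfolding V_def by (intro deviation_sets gmat_lp_norm_measurable)
  have Vm: "measure (gmat n k) (V j) \<le> \<eta>" if "j < k" for j
    unfolding V_def gmat_lp_norm_deviation[OF k0(1) L2_set_unit_vec[OF that]] by (rule d(2))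
  have Ws: "W \<in> sets (gmat n k)"
  proof -
    have c: "(\<lambda>Y. \<lambda>i\<in>{..<n}. comb n k a Y i) \<in> gmat n k \<rightarrow>\<^sub>M gauss {..<n}" for a
    proof (rule measurable_into_gauss)
      show "(\<lambda>Y. (\<lambda>i\<in>{..<n}. comb n k a Y i) i) \<in> borel_measurable (gmat n k)" if "i \<in> {..<n}" for i
        using comb_measurable[of n k a i] that by (simp only: restrict_apply' if_True)
    qed (simp only: restrict_apply if_False)
    have "{Y \<in> space (gmat n k). R (comb n k a Y)} \<in> sets (gmat n k)"
      if R: "Measurable.pred (gauss {..<n}) R" "\<And>x y. (\<And>i. i < n \<Longrightarrow> x i = y i) \<Longrightarrow> R x = R y" for R a
    proof -
      have "{Y \<in> space (gmat n k). R (comb n k a Y)} = {Y \<in> space (gmat n k). R (\<lambda>i\<in>{..<n}. comb n k a Y i)}"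
        using R(2)[of "comb n k a _" "\<lambda>i\<in>{..<n}. comb n k a _ i"] by auto
      then show ?thesis using predE[OF measurable_compose[OF c R(1)]] by simp
    qed
    then have "{Y \<in> space (gmat n k). P (?y Y)} \<in> sets (gmat n k)" "{Y \<in> space (gmat n k). Q (?z Y)} \<in> sets (gmat n k)"
      using Pm Pc Qm Qc by blast+
    then have "{Y \<in> space (gmat n k). P (?y Y)} \<inter> {Y \<in> space (gmat n k). Q (?z Y)} \<in> sets (gmat n k)"
      by (rule sets.Int)
    also have "{Y \<in> space (gmat n k). P (?y Y)} \<inter> {Y \<in> space (gmat n k). Q (?z Y)} = W"
      unfolding W_def by blast
    finally show ?thesis .
  qed
  define G2 where "G2 = W - (V 0 \<union> V 1)"
  have G2s: "G2 \<in> sets (gmat n k)" unfolding G2_def by (intro sets.Diff sets.Un Ws Vs)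
  have G2m: "cA / 4 - 2 * \<eta> \<le> measure (gmat n k) G2"
  proof -
    have "W \<subseteq> G2 \<union> (V 0 \<union> V 1)" by (auto simp: G2_def)
    then have "measure (gmat n k) W \<le> measure (gmat n k) (G2 \<union> (V 0 \<union> V 1))"
      by (intro \<gamma>.finite_measure_mono sets.Un G2s Vs)
    also have "\<dots> \<le> measure (gmat n k) G2 + measure (gmat n k) (V 0 \<union> V 1)"
      by (intro measure_Un_le sets.Un G2s Vs)
    also have "measure (gmat n k) (V 0 \<union> V 1) \<le> measure (gmat n k) (V 0) + measure (gmat n k) (V 1)"
      by (intro measure_Un_le Vs)
    finally show ?thesis using W Vm[OF k0(1)] Vm[OF k0(2)] by linarith
  qed
  have far: "(1 + 2 * \<kappa>) * (lp_norm n p (?z Y) * nrm n (?y Y)) < lp_norm n p (?y Y) * nrm n (?z Y)"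
    if Y: "Y \<in> G2" for Y
  proof -
    obtain i where i: "i < n" "u \<le> \<bar>?y Y i\<bar>" using Y unfolding G2_def W_def P_def by blast
    have Ny: "u \<le> lp_norm n p (?y Y)" using i coordinate_le_lp_norm[OF Lp(2) i(1)] order_trans by blast
    have "Q (?z Y)" using Y unfolding G2_def W_def by blast
    then have Nz: "lp_norm n p (?z Y) \<le> s * exp (ln (1 / \<delta>) / L)"
      unfolding Q_def using s by (intro small_norm_bound[OF \<delta> L0 Lp]) auto
    have "\<bar>nrm n (?y Y) - d\<bar> < \<tau> * d" "\<bar>nrm n (?z Y) - d\<bar> < \<tau> * d"
      using Y unfolding G2_def W_def V_def lp_norm_2 by auto
    then have ry: "nrm n (?y Y) \<le> (1 + \<tau>) * d" and rz: "(1 - \<tau>) * d \<le> nrm n (?z Y)"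
      by (auto simp: algebra_simps abs_less_iff)
    have ineq: "(1 + 2 * \<kappa>) * (1 + \<tau>) < exp (4 / L) * (1 - \<tau>)"
    proof -
      have "1 + 4 * \<kappa> \<le> 1 + 4 / L" using \<kappa>01 by simp
      also have "\<dots> \<le> exp (4 / L)" by (rule exp_ge_add_one_self)
      finally have "(1 + 4 * \<kappa>) * (1 - \<tau>) \<le> exp (4 / L) * (1 - \<tau>)" using \<tau> by (intro mult_right_mono) auto
      moreover have "(1 + 4 * \<kappa>) * (1 - \<tau>) - (1 + 2 * \<kappa>) * (1 + \<tau>) = 7 / 4 * \<kappa> - 3 / 4 * (\<kappa> * \<kappa>)"
        by (simp add: \<tau>_def field_simps)
      moreover have "\<kappa> * \<kappa> \<le> 1 * \<kappa>" using \<kappa>01 by (intro mult_right_mono) auto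
      ultimately show ?thesis using \<kappa>01 by linarith
    qed
    let ?e = "exp (ln (1 / \<delta>) / L)"
    have ue: "u = s * ?e * exp (4 / L)"
      by (simp add: u_def K(1) add_divide_distrib exp_add)
    have "(1 + 2 * \<kappa>) * (lp_norm n p (?z Y) * nrm n (?y Y)) \<le> (1 + 2 * \<kappa>) * ((s * ?e) * ((1 + \<tau>) * d))"
      using Nz ry \<kappa>01 s by (intro mult_left_mono mult_mono) (auto simp: lp_norm_nonneg)
    also have "\<dots> = ((1 + 2 * \<kappa>) * (1 + \<tau>)) * (s * ?e * d)" by simp
    also have "\<dots> < (exp (4 / L) * (1 - \<tau>)) * (s * ?e * d)"
      using ineq s d by (intro mult_strict_right_mono) auto
    also have "\<dots> = u * ((1 - \<tau>) * d)" by (simp add: ue)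
    also have "\<dots> \<le> lp_norm n p (?y Y) * nrm n (?z Y)"
      using Ny rz \<tau> d by (intro mult_mono) (auto simp: lp_norm_nonneg)
    finally show ?thesis .
  qed
  let ?S = "{E \<in> space \<mu>. spherical n (lp_norm n p) (1 + \<kappa>) E}"
  have S: "?S \<in> sets \<mu>"
    unfolding uniform_space[OF \<mu>] using k0 n1 Lp \<kappa>01 by (intro spherical_sets) auto
  define t where "t = \<kappa> / (12 * (real n)\<^sup>2)"
  have t: "0 < t" "t \<le> 1"
  proof -
    show "0 < t" using \<kappa>01 n1 by (simp add: t_def)
    have "1 \<le> (real n)\<^sup>2" using n1 by (simp add: one_le_power)
    then show "t \<le> 1" unfolding t_def using \<kappa>01 by (simp add: divide_le_eq)
  qed
  have "measure \<mu> ?S * measure (gmat n k) ?J \<le> 1 - measure (gmat n k) G2"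
  proof (rule uniform_Gr_transfer[OF \<mu> k0(1) k(2) t _ S G2s])
    fix E Y assume E: "E \<in> ?S" and Y: "Y \<in> G2" and cl: "close_to n t (colspan n k Y) E"
    have "E \<in> Grassmannian n k" using E uniform_space[OF \<mu>] by auto
    then have "\<not> spherical n (lp_norm n p) (1 + \<kappa>) E"
      by (rule far_norms_imp_not_spherical[OF _ k0(1) n1(2) Lp(2) \<kappa>01(1,3) t_def cl _ _ far[OF Y]])
        (auto simp: colspan_def)
    then show False using E by auto
  qed (use G in simp)
  then have main: "measure \<mu> ?S * measure (gmat n k) ?J \<le> 1 - (w + q)" using G2m sum by linarith
  have q0: "q \<ge> 0"
  proof -
    have "0 \<le> 30000 * L * n powr (- (\<delta>\<^sup>2 / 16)) * (1152 / \<epsilon>) ^ k * (48 / \<epsilon>)\<^sup>2"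
      using L0 \<epsilon> by (intro mult_nonneg_nonneg) auto
    then show ?thesis using q by linarith
  qed
  have "measure \<mu> ?S \<le> 1 - w"
  proof (rule ccontr)
    assume "\<not> measure \<mu> ?S \<le> 1 - w"
    then have gt: "1 - w < measure \<mu> ?S" by simp
    have "measure \<mu> ?S * (1 - q) \<le> measure \<mu> ?S * measure (gmat n k) ?J" using J by (intro mult_left_mono) auto
    then have "measure \<mu> ?S - measure \<mu> ?S * q \<le> 1 - (w + q)" using main by (simp add: right_diff_distrib)
    moreover have "measure \<mu> ?S * q \<le> 1 * q" using q0 by (intro mult_right_mono) auto
    ultimately show False using gt by linarith
  qed
  moreover have "{E \<in> space \<mu>. \<not> spherical n (lp_norm n p) (1 + \<kappa>) E} = space \<mu> - ?S" by auto
  then have "measure \<mu> {E \<in> space \<mu>. \<not> spherical n (lp_norm n p) (1 + \<kappa>) E} = 1 - measure \<mu> ?S"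
    using \<mu>.prob_compl[OF S] by (simp only:)
  ultimately show ?thesis by linarith
qed

lemma eventually_power_exp_le:
  fixes a C d :: real
  assumes a: "a > 0" and d: "d > 0"
  shows "eventually (\<lambda>L. C * L ^ m * exp (- a * L) \<le> d) at_top"
proof -
  have "((\<lambda>x. x ^ m / exp x) \<longlongrightarrow> (0::real)) at_top" by (rule tendsto_power_div_exp_0)
  then have "((\<lambda>L. (a * L) ^ m / exp (a * L)) \<longlongrightarrow> 0) at_top"
    by (rule filterlim_compose) (rule filterlim_tendsto_pos_mult_at_top[OF tendsto_const a filterlim_ident])
  then have "((\<lambda>L. C / a ^ m * ((a * L) ^ m / exp (a * L))) \<longlongrightarrow> C / a ^ m * 0) at_top"
    by (intro tendsto_mult tendsto_const)
  moreover have "C / a ^ m * ((a * L) ^ m / exp (a * L)) = C * L ^ m * exp (- a * L)" for L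
    using a by (simp add: power_mult_distrib exp_minus divide_inverse)
  ultimately have "((\<lambda>L. C * L ^ m * exp (- a * L)) \<longlongrightarrow> 0) at_top" by simp
  then have "eventually (\<lambda>L. C * L ^ m * exp (- a * L) < d) at_top" using d by (rule order_tendstoD)
  then show ?thesis by eventually_elim simp
qed

text \<open>
  The hypotheses on \<open>k\<close> force \<open>w L / ln (2 / \<epsilon>) > 1\<close>, hence rounding up at most doubles that quotient, and
  also \<open>ln (2 / \<epsilon>) < w L\<close>. Thus both \<open>(2 / \<epsilon>) ^ k\<close> and \<open>2 / \<epsilon>\<close> are small powers of \<open>n\<close>.
\<close>

lemma net_size_bound:
  fixes \<epsilon> w L :: real and k :: nat
  assumes \<epsilon>: "0 < \<epsilon>" "\<epsilon> < 1" and w: "0 < w" and L: "0 < L"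
    and k: "2 \<le> k" "int k \<le> \<lceil>w * L / ln (2 / \<epsilon>)\<rceil>"
  shows "k * ln (2 / \<epsilon>) \<le> 2 * w * L"
    "(1152 / \<epsilon>) ^ k * (48 / \<epsilon>)\<^sup>2 \<le> 576 * exp (24 * w * L)"
proof -
  define X where "X = 2 / \<epsilon>"
  have X: "X \<ge> 2" using \<epsilon> by (simp add: X_def field_simps)
  have lnX: "ln X > 0" using X by simp
  define r where "r = w * L / ln X"
  have "2 \<le> \<lceil>r\<rceil>" using k unfolding r_def X_def by linarith
  then have r1: "r > 1" by linarith
  have "real k \<le> r + 1" using k(2) unfolding r_def[symmetric] X_def[symmetric] by linarith
  then have "real k \<le> 2 * r" using r1 by simp
  then have "real k * ln X \<le> 2 * r * ln X" using lnX by (intro mult_right_mono) auto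
  also have "\<dots> = 2 * w * L" using lnX by (simp add: r_def)
  finally have kX: "real k * ln X \<le> 2 * w * L" .
  then show "k * ln (2 / \<epsilon>) \<le> 2 * w * L" by (simp add: X_def)
  have "ln X * 1 \<le> ln X * r" using r1 lnX by (intro mult_left_mono) auto
  then have X1: "ln X \<le> w * L" using lnX by (simp add: r_def)
  have "(2::real) ^ 10 \<le> X ^ 10" using X by (intro power_mono) auto
  then have "576 * X \<le> X ^ 10 * X" using X by (intro mult_right_mono) auto
  then have "(576 * X) ^ k \<le> (X ^ 11) ^ k" using X by (intro power_mono) (auto simp: power_Suc2[symmetric])
  also have "\<dots> = exp (11 * (real k * ln X))"
  proof -
    have "(X ^ 11) ^ k = X ^ (11 * k)" by (simp add: power_mult)
    also have "\<dots> = exp (ln X) ^ (11 * k)" using X by simp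
    also have "\<dots> = exp (11 * (real k * ln X))" by (subst exp_of_nat_mult[symmetric]) simp
    finally show ?thesis .
  qed
  also have "\<dots> \<le> exp (22 * w * L)" using mult_left_mono[OF kX, of 11] by (simp add: mult_ac)
  finally have 1: "(576 * X) ^ k \<le> exp (22 * w * L)" .
  have "X\<^sup>2 = exp (2 * ln X)" using X by (simp add: exp_double)
  also have "\<dots> \<le> exp (2 * w * L)" using X1 by simp
  finally have 2: "(24 * X)\<^sup>2 \<le> 576 * exp (2 * w * L)" by (simp add: power_mult_distrib)
  have "(576 * X) ^ k * (24 * X)\<^sup>2 \<le> exp (22 * w * L) * (576 * exp (2 * w * L))"
    using 1 2 by (intro mult_mono) auto
  also have "\<dots> = 576 * exp (24 * w * L)" by (simp add: exp_add[symmetric] algebra_simps)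
  finally show "(1152 / \<epsilon>) ^ k * (48 / \<epsilon>)\<^sup>2 \<le> 576 * exp (24 * w * L)" by (simp add: X_def)
qed

theorem corollaryB:
  fixes \<delta> :: real
  assumes "0 < \<delta>" "\<delta> < 1"
  shows "\<exists>w n\<^sub>0 :: real. 0 < w \<and> 0 < n\<^sub>0 \<and>
    (\<forall>(\<epsilon>::real) (n::nat) (k::nat) \<mu>.
       0 < \<epsilon> \<and> \<epsilon> < 1 \<and> real n \<ge> n\<^sub>0 \<and> 2 \<le> k \<and>
       int k \<le> \<lceil>w * ln (real n) / ln (2 / \<epsilon>)\<rceil> \<and> uniform_Gr n k \<mu> \<longrightarrow>
       measure \<mu> {E \<in> space \<mu>. spherical n (lp_norm n ((2 - \<delta>) * ln (real n))) (1 + \<epsilon>) E}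
         \<ge> 1 - real n powr (- w) \<and>
       measure \<mu> {E \<in> space \<mu>. \<not> spherical n (lp_norm n ((2 + \<delta>) * ln (real n))) (1 + w / ln (real n)) E}
         \<ge> w)"
proof -
  note \<delta> = assms
  define K where "K = ln (1 / \<delta>) + 4"
  define cA where "cA = 1 - exp (- (exp (- (4 * K + 2)) / 8))"
  have cA: "0 < cA" "cA \<le> 1" by (auto simp: cA_def)
  define h where "h = \<delta>\<^sup>2 / 16"
  have h: "0 < h" using \<delta> by (simp add: h_def)
  have d2: "\<delta>\<^sup>2 < 1" using \<delta> by (simp add: power_less_one_iff)
  \<comment> \<open>the first bound keeps the net smaller than the inverse deviation probability, the second leaves room in \<open>cA / 4\<close>\<close>
  define w where "w = min (\<delta>\<^sup>2 / 1000) (cA / 16)"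
  have w: "0 < w" "w \<le> cA / 16" "w \<le> 1 / 16" "24 * w \<le> h / 2" "w \<le> h / 4"
    using \<delta> cA d2 by (auto simp: w_def h_def min_def)
  have "eventually (\<lambda>L. L \<ge> 8 \<and> L \<ge> 2 * K \<and> 34560000 * L ^ 1 * exp (- (h / 4) * L) \<le> 1 \<and>
      1 * L ^ 0 * exp (- w * L) \<le> cA / 8 \<and> 960000 / w\<^sup>2 * L ^ 3 * exp (- h * L) \<le> cA / 32) at_top"
    using h w cA by (intro eventually_conj eventually_ge_at_top eventually_power_exp_le) auto
  then obtain L0 where L0: "\<And>L. L \<ge> L0 \<Longrightarrow> L \<ge> 8 \<and> L \<ge> 2 * K \<and> 34560000 * L ^ 1 * exp (- (h / 4) * L) \<le> 1 \<and>
      1 * L ^ 0 * exp (- w * L) \<le> cA / 8 \<and> 960000 / w\<^sup>2 * L ^ 3 * exp (- h * L) \<le> cA / 32"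
    unfolding eventually_at_top_linorder by blast
  show ?thesis
  proof (rule exI[of _ w], rule exI[of _ "exp L0"], intro conjI allI impI w(1))
    show "0 < exp L0" by simp
    fix \<epsilon> :: real and n k :: nat and \<mu>
    assume "0 < \<epsilon> \<and> \<epsilon> < 1 \<and> real n \<ge> exp L0 \<and> 2 \<le> k \<and>
       int k \<le> \<lceil>w * ln (real n) / ln (2 / \<epsilon>)\<rceil> \<and> uniform_Gr n k \<mu>"
    then have \<epsilon>: "0 < \<epsilon>" "\<epsilon> < 1" and n0: "real n \<ge> exp L0" and k: "2 \<le> k" "int k \<le> \<lceil>w * ln (real n) / ln (2 / \<epsilon>)\<rceil>"
      and \<mu>: "uniform_Gr n k \<mu>" by auto
    define L where "L = ln (real n)"
    have npos: "real n > 0" using n0 exp_gt_zero[of L0] by linarith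
    have "L0 \<le> L" using n0 npos unfolding L_def by (subst ln_ge_iff) auto
    note L = L0[OF this]
    have L8: "L \<ge> 8" "L > 0" using L by auto
    have Ln: "L \<le> real n" unfolding L_def using ln_le_minus_one[OF npos] by linarith
    then have n2: "n \<ge> 2" "n \<ge> 1" using L8 by linarith+
    have npow: "real n powr x = exp (x * L)" for x using npos by (simp add: powr_def L_def)
    note net = net_size_bound[OF \<epsilon> w(1) L8(2) k[folded L_def]]
    have kn: "k \<le> n"
    proof -
      have "1 / 2 \<le> ln (2::real)" using ln2_ge_two_thirds by simp
      also have "ln 2 \<le> ln (2 / \<epsilon>)" using \<epsilon> by (intro ln_mono) (auto simp: field_simps)
      finally have "real k * (1 / 2) \<le> real k * ln (2 / \<epsilon>)" by (intro mult_left_mono) auto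
      also have "\<dots> \<le> 2 * w * L" by (rule net(1))
      also have "\<dots> \<le> 2 * (1 / 16) * L" using w L8 by (intro mult_right_mono mult_left_mono) auto
      finally have "real k \<le> real n" using Ln L8 by linarith
      then show ?thesis by simp
    qed
    \<comment> \<open>half of \<open>n powr (- w)\<close>, since \<open>random_subspace_spherical\<close> doubles it\<close>
    define q where "q = exp (- w * L) / 2"
    have q: "30000 * L * n powr (- (\<delta>\<^sup>2 / 16)) * (1152 / \<epsilon>) ^ k * (48 / \<epsilon>)\<^sup>2 \<le> q"
    proof -
      have "30000 * L * n powr (- (\<delta>\<^sup>2 / 16)) * (1152 / \<epsilon>) ^ k * (48 / \<epsilon>)\<^sup>2
        = 30000 * L * exp (- h * L) * ((1152 / \<epsilon>) ^ k * (48 / \<epsilon>)\<^sup>2)"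
        unfolding npow h_def by simp
      also have "\<dots> \<le> 30000 * L * exp (- h * L) * (576 * exp (24 * w * L))"
        using L8 by (intro mult_left_mono net(2)) auto
      also have "\<dots> = 17280000 * L * exp (- h * L + 24 * w * L)"
      proof -
        have "30000 * L * A * (576 * B) = 17280000 * L * (A * B)" for A B :: real by simp
        then show ?thesis by (simp only: exp_add)
      qed
      also have "\<dots> \<le> 17280000 * L * exp (- (h / 4) * L + - w * L)"
      proof -
        have "24 * w * L \<le> h / 2 * L" "w * L \<le> h / 4 * L" using w L8 by (auto intro!: mult_right_mono)
        then have "- h * L + 24 * w * L \<le> - (h / 4) * L + - w * L" by (simp add: algebra_simps)
        then show ?thesis using L8 by (intro mult_left_mono) auto
      qed
      also have "\<dots> = (34560000 * L ^ 1 * exp (- (h / 4) * L)) * q"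
      proof -
        have "17280000 * L * (A * B) = (34560000 * L ^ 1 * A) * (B / 2)" for A B :: real by simp
        then show ?thesis by (simp only: exp_add q_def)
      qed
      also have "\<dots> \<le> 1 * q" using L by (intro mult_right_mono) (auto simp: q_def)
      finally show ?thesis by simp
    qed
    have "q \<le> 1 / 2" using w L8 by (simp add: q_def)
    have p: "2 \<le> (2 - \<delta>) * ln n"
    proof -
      have "1 * L \<le> (2 - \<delta>) * L" using \<delta> L8 by (intro mult_right_mono) auto
      then show ?thesis using L8 unfolding L_def[symmetric] by linarith
    qed
    have "1 - 2 * q \<le> measure \<mu> {E \<in> space \<mu>. spherical n (lp_norm n ((2 - \<delta>) * ln (real n))) (1 + \<epsilon>) E}"
      by (rule random_subspace_spherical[OF \<delta> n2(2) _ kn p order_refl \<epsilon> \<mu> q[unfolded L_def] \<open>q \<le> 1 / 2\<close>])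
        (use k in simp)
    then show "1 - real n powr (- w) \<le> measure \<mu> {E \<in> space \<mu>. spherical n (lp_norm n ((2 - \<delta>) * ln (real n))) (1 + \<epsilon>) E}"
      unfolding npow q_def by simp
    have \<eta>: "15000 * L * n powr (- (\<delta>\<^sup>2 / 16)) / (w / L / 8)\<^sup>2 \<le> cA / 32"
    proof -
      have "15000 * L * n powr (- (\<delta>\<^sup>2 / 16)) / (w / L / 8)\<^sup>2 = 960000 / w\<^sup>2 * L ^ 3 * exp (- h * L)"
        unfolding npow h_def using w L8 by (simp add: power_divide power2_eq_square power3_eq_cube field_simps)
      then show ?thesis using L by simp
    qed
    have "w + q + 2 * (cA / 32) \<le> cA / 4" using w(2) L cA(1) by (simp add: q_def)
    then show "w \<le> measure \<mu> {E \<in> space \<mu>. \<not> spherical n (lp_norm n ((2 + \<delta>) * ln (real n))) (1 + w / ln (real n)) E}"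
      unfolding L_def[symmetric] using w(3) L
      by (intro random_subspace_not_spherical[OF \<delta> n2(1) L_def L8(1) k(1) kn refl \<mu> \<epsilon> w(1) _ refl K_def _ cA_def q \<eta>]) auto
  qed
qed

end
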